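(* There is a set $N\subset \mathbb{H}^n$ of Lebesgue measure zero such that every Lipschitz function $f\colon \mathbb{H}^{n} \to \mathbb{R}$ is Pansu differentiable at a point of $N$.
   Context: Fix an integer $n\geq 1$. The Heisenberg group $\mathbb{H}^n$ is $\mathbb{R}^{2n+1}$, with points written $(a,b,c)$, $a,b\in\mathbb{R}^n$, $c\in\mathbb{R}$, equipped with the group law $(a,b,c)(a',b',c')=(a+a',b+b',c+c'-2(\langle a,b'\rangle-\langle b,a'\rangle))$. Dilations are $\delta_r(a,b,c)=(ra,rb,r^2c)$ for $r>0$. For $1\le i\le n$ define vector fields $X_i(a,b,c)=e_i+2b_ie_{2n+1}$, $Y_i(a,b,c)=e_{n+i}-2a_ie_{2n+1}$, where $e_1,\dots,e_{2n+1}$ is the standard basis. An absolutely continuous curve $\gamma\colon I\to\mathbb{H}^n$ ($I\subset\mathbb{R}$ an interval) is horizontal if there is $h\colon I\to\mathbb{R}^{2n}$ with $\gamma'(t)=\sum_{i=1}^n(h_i(t)X_i(\gamma(t))+h_{n+i}(t)Y_i(\gamma(t)))$ for a.e. $t\in I$; its horizontal length is $L_{\mathbb{H}}(\gamma)=\int_I|h|$. The Carnot-Carathéodory distance is $d(x,y)=\inf\{L_{\mathbb{H}}(\gamma):\gamma \text{ a horizontal curve joining } x \text{ to } y\}$. A function $f\colon\mathbb{H}^n\to\mathbb{R}$ is called Lipschitz if it is Lipschitz with respect to $d$ on $\mathbb{H}^n$. Lebesgue measure is $\mathcal{L}^{2n+1}$ on $\mathbb{R}^{2n+1}$. A function $L\colon\mathbb{H}^n\to\mathbb{R}$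 is $\mathbb{H}$-linear if $L(xy)=L(x)+L(y)$ and $L(\delta_r(x))=rL(x)$ for all $x,y\in\mathbb{H}^n$, $r>0$. A function $f\colon\mathbb{H}^n\to\mathbb{R}$ is Pansu differentiable at $x$ if there is an $\mathbb{H}$-linear $L\colon\mathbb{H}^n\to\mathbb{R}$ with $\lim_{y\to x}|f(y)-f(x)-L(x^{-1}y)|/d(x,y)=0$; then $L$ is the Pansu derivative of $f$ at $x$. *)

theory Defs
  imports "HOL-Analysis.Analysis"
begin

(* The Heisenberg group of dimension 2n+1 with n = CARD('n) >= 1.  A point (a, b, c) is a triple, so
   that topology, norm and Lebesgue measure are the Euclidean ones of R^(2n+1). *)
type_synonym 'n heis = "(real^'n) \<times> (real^'n) \<times> real"

fun heis_mult :: "('n::finite) heis \<Rightarrow> 'n heis \<Rightarrow> 'n heis" where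
  "heis_mult (a, b, c) (a', b', c') = (a + a', b + b', c + c' - 2 * (a \<bullet> b' - b \<bullet> a'))"

fun heis_inv :: "('n::finite) heis \<Rightarrow> 'n heis" where
  "heis_inv (a, b, c) = (- a, - b, - c)"

lemma heis_mult_assoc: "heis_mult (heis_mult x y) z = heis_mult x (heis_mult y z)"
  by (cases x; cases y; cases z) (simp add: inner_add_left inner_add_right algebra_simps)

lemma heis_mult_zero: "heis_mult 0 x = x" "heis_mult x 0 = x"
  by (cases x, simp add: zero_prod_def)+

lemma heis_mult_inv: "heis_mult (heis_inv x) x = 0" "heis_mult x (heis_inv x) = 0"
  by (cases x, simp add: zero_prod_def inner_commute)+

fun heis_dilation :: "real \<Rightarrow> ('n::finite) heis \<Rightarrow> 'n heis" where
  "heis_dilation r (a, b, c) = (r *\<^sub>R a, r *\<^sub>R b, r\<^sup>2 * c)"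

fun heis_X :: "'n \<Rightarrow> ('n::finite) heis \<Rightarrow> 'n heis" where
  "heis_X i (a, b, c) = (axis i 1, 0, 2 * (b $ i))"

fun heis_Y :: "'n \<Rightarrow> ('n::finite) heis \<Rightarrow> 'n heis" where
  "heis_Y i (a, b, c) = (0, axis i 1, - 2 * (a $ i))"

definition absolutely_continuous_curve :: "real set \<Rightarrow> (real \<Rightarrow> 'a::real_normed_vector) \<Rightarrow> bool" where
  "absolutely_continuous_curve I \<gamma> \<longleftrightarrow>
     (\<forall>\<epsilon>>0. \<exists>\<delta>>0. \<forall>D :: (real \<times> real) set.
        finite D \<and> (\<forall>(u, v)\<in>D. u \<le> v \<and> {u..v} \<subseteq> I) \<and>
        pairwise (\<lambda>p q. {fst p<..<snd p} \<inter> {fst q<..<snd q} = {}) D \<and>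
        (\<Sum>(u, v)\<in>D. v - u) < \<delta>
        \<longrightarrow> (\<Sum>(u, v)\<in>D. norm (\<gamma> v - \<gamma> u)) < \<epsilon>)"

(* The value h t = (h_1 t, ..., h_2n t) is encoded as the pair of its two halves; the norm of the
   pair is the Euclidean norm on R^(2n). *)
definition horizontal_control ::
    "real set \<Rightarrow> (real \<Rightarrow> ('n::finite) heis) \<Rightarrow> (real \<Rightarrow> (real^'n) \<times> (real^'n)) \<Rightarrow> bool" where
  "horizontal_control I \<gamma> h \<longleftrightarrow>
     (AE t in lebesgue. t \<in> I \<longrightarrow>
        (\<gamma> has_vector_derivative
          (\<Sum>i\<in>UNIV. (fst (h t) $ i) *\<^sub>R heis_X i (\<gamma> t) + (snd (h t) $ i) *\<^sub>R heis_Y i (\<gamma> t)))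
          (at t within I))"

(* The length of an absolutely continuous curve with control h on I.  The curve determines h almost
   everywhere on I, since h is the pair of the first two components of its derivative; hence h is
   Lebesgue measurable and, for compact I, integrable, and the value depends on the curve only. *)
definition horizontal_length :: "real set \<Rightarrow> (real \<Rightarrow> (real^'n) \<times> (real^('n::finite))) \<Rightarrow> real" where
  "horizontal_length I h = (LINT t:I|lebesgue. norm (h t))"

(* Any two points are joined by a horizontal curve, so this is the infimum of a nonempty set. *)
definition cc_dist :: "('n::finite) heis \<Rightarrow> 'n heis \<Rightarrow> real" where
  "cc_dist x y = Inf {horizontal_length {s..t} h | \<gamma> h s t.
     s \<le> t \<and> absolutely_continuous_curve {s..t} \<gamma> \<and> horizontal_control {s..t} \<gamma> h \<and>
     \<gamma> s = x \<and> \<gamma> t = y}"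

definition heis_lipschitz :: "(('n::finite) heis \<Rightarrow> real) \<Rightarrow> bool" where
  "heis_lipschitz f \<longleftrightarrow> (\<exists>C\<ge>0. \<forall>x y. \<bar>f x - f y\<bar> \<le> C * cc_dist x y)"

definition heis_linear :: "(('n::finite) heis \<Rightarrow> real) \<Rightarrow> bool" where
  "heis_linear L \<longleftrightarrow>
     (\<forall>x y. L (heis_mult x y) = L x + L y) \<and> (\<forall>r>0. \<forall>x. L (heis_dilation r x) = r * L x)"

(* The filter at x is Euclidean; the Carnot-Caratheodory distance induces the same topology. *)
definition pansu_differentiable_at :: "(('n::finite) heis \<Rightarrow> real) \<Rightarrow> 'n heis \<Rightarrow> bool" where
  "pansu_differentiable_at f x \<longleftrightarrow>
     (\<exists>L. heis_linear L \<and>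
        ((\<lambda>y. \<bar>f y - f x - L (heis_mult (heis_inv x) y)\<bar> / cc_dist x y) \<longlongrightarrow> 0) (at x))"

end

theory Submission
  imports Defs
begin

text \<open>
  A directional derivative that is almost as large as it can be forces differentiability: if f is
  badly approximated near x by the expected linear map, then one leaves the horizontal line through
  x in direction v for a short detour through a point where the approximation fails, and somewhere
  on the detour f must increase faster than along the line. This is the method of Preiss. It
  produces a point of differentiability inside any G_delta set N that contains enough horizontal
  lines, and countably many lines have G_delta neighbourhoods of measure zero.

  Write a point as (z, c) with z in R^2n and c real. After division by a constant, a Lipschitz
  function satisfies |f (x (z, c)) - f x| <= |z| + 2 sqrt |c|, and conversely the
  Carnot-Caratheodory distance from x to x (z, c) is at least (|z| + sqrt |c|) / 3. These two
  estimates are all that is used of the distance. The second one needs the fundamental theorem of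
  calculus for absolutely continuous curves.

  Consider triples (y, w, q) where y lies in N and q is the derivative of f at y in the horizontal
  direction w. Theorem almost_maximal_direction in locale direction_search constructs a triple
  (x, v, p) and a vector xi such that no triple (y, w, q) with y close to x satisfies
  q > p + xi . (w - v) + 20 |w - v|^2 + eta, provided that the increments of f in direction v, seen
  from y and from x, differ by at most a constant times g^(1/4), relative to their length, where g
  is the gain q - p - xi . (w - v) - 20 |w - v|^2. The triple is the limit of successive almost
  maximisers of q minus a sum of quadratic penalties in the direction, and xi is the gradient of the
  total penalty at v. The side condition on increments makes p the derivative of f at x in direction
  v, although derivatives do not pass to limits in general.

  Then z -> xi . z is the Pansu derivative of f at x (theorem linear_approximation). Otherwise
  there are points x (z, c) at arbitrarily small scale r where the error exceeds eps r. With kappa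
  small against eps and s = 2 r / kappa, the line t -> x (t v, 0) is replaced for |t| < s by a
  detour through x (z, c) made of horizontal segments whose directions w stay within 5 kappa of v.
  Along the detour, f minus its expected value is small at the ends and at least eps r in the
  middle. By steep_but_tame_point there is a parameter at which it has slope g of order at least
  eps kappa while its increments at all scales are of order sqrt g. Here the derivative of f in
  the direction w of the detour is about p + xi . (w - v) + g. As |w - v|^2 is of order kappa^2,
  which is small against eps kappa, the gain is at least g / 2 and the increments are close:
  a contradiction. A detour is determined by finitely many parameters and the estimates are open
  conditions on them, so it may be chosen from a countable family, whose lines N contains.
\<close>

section \<open>Derivatives of Lipschitz functions on the line\<close>

lemma closed_interval_cball:
  fixes a b :: real assumes "a \<le> b" shows "cball ((a + b) / 2) ((b - a) / 2) = {a..b}"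
  using assms by (simp add: cball_eq_atLeastAtMost field_simps)

text \<open>
  Vitali's covering theorem in terms of end points, over which the increments of a function are
  taken.
\<close>
lemma Vitali_intervals:
  fixes S :: "real set" and K :: "(real \<times> real) set"
  assumes K: "\<And>a b. (a, b) \<in> K \<Longrightarrow> a < b"
    and S: "\<And>x d. x \<in> S \<Longrightarrow> 0 < d \<Longrightarrow> \<exists>(a, b)\<in>K. a \<le> x \<and> x \<le> b \<and> b - a < d"
  obtains C where "countable C" "C \<subseteq> K" "disjoint_family_on (\<lambda>(a, b). {a..b}) C"
    "negligible (S - (\<Union>(a, b)\<in>C. {a..b}))"
proof -
  let ?m = "\<lambda>p::real \<times> real. (fst p + snd p) / 2" and ?r = "\<lambda>p::real \<times> real. (snd p - fst p) / 2"
  have cb: "cball (?m p) (?r p) = (\<lambda>(a, b). {a..b}) p" if "p \<in> K" for p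
    using K[of "fst p" "snd p"] that closed_interval_cball[of "fst p" "snd p"]
    by (cases p) auto
  obtain C where C: "countable C" "C \<subseteq> K"
     "pairwise (\<lambda>i j. disjnt (cball (?m i) (?r i)) (cball (?m j) (?r j))) C"
     "negligible (S - (\<Union>i \<in> C. cball (?m i) (?r i)))"
  proof (rule Vitali_covering_theorem_cballs[of K ?r S ?m])
    show "0 < ?r i" if "i \<in> K" for i using that K[of "fst i" "snd i"] by auto
    show "\<exists>i. i \<in> K \<and> x \<in> cball (?m i) (?r i) \<and> ?r i < d" if "x \<in> S" "0 < d" for x d
    proof -
      obtain a b where ab: "(a, b) \<in> K" "a \<le> x" "x \<le> b" "b - a < d" using S[OF \<open>x \<in> S\<close> \<open>0 < d\<close>] by blast
      then have "x \<in> cball (?m (a,b)) (?r (a,b))" using cb[OF ab(1)] by auto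
      moreover have "?r (a,b) < d" using ab K[OF ab(1)] by auto
      ultimately show ?thesis using ab(1) by blast
    qed
  qed blast
  have "disjoint_family_on (\<lambda>(a, b). {a..b}) C"
    using C(3) cb C(2) unfolding disjoint_family_on_def pairwise_def disjnt_def
    by (metis subsetD)
  moreover have "(\<Union>i \<in> C. cball (?m i) (?r i)) = (\<Union>(a, b)\<in>C. {a..b})"
    using cb C(2) by (intro SUP_cong) auto
  ultimately show ?thesis using C(1,2,4) that by auto
qed

text \<open>
  The increments are taken over intervals with t in their interior, not over intervals ending at t:
  then the set is a countable intersection of open sets whatever F and P are.
\<close>
definition straddle :: "(real \<Rightarrow> real) \<Rightarrow> (real \<Rightarrow> real \<Rightarrow> bool) \<Rightarrow> real set" where
  "straddle F P = {t. \<forall>\<epsilon>>0. \<exists>a b. a < t \<and> t < b \<and> b - a < \<epsilon> \<and> P (F b - F a) (b - a)}"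

lemma straddle_borel: "straddle F P \<in> sets borel"
proof -
  have eq: "straddle F P = (\<Inter>n. \<Union>(a, b)\<in>{(a, b). b - a < inverse (Suc n) \<and> P (F b - F a) (b - a)}. {a<..<b})"
    (is "_ = (\<Inter>n. ?O n)")
  proof (intro set_eqI iffI)
    fix t assume "t \<in> straddle F P"
    then show "t \<in> (\<Inter>n. ?O n)"
    proof (intro INT_I)
      fix n
      have "0 < inverse (real (Suc n))" by simp
      then obtain a b where "a < t" "t < b" "b - a < inverse (real (Suc n))" "P (F b - F a) (b - a)"
        using \<open>t \<in> straddle F P\<close> unfolding straddle_def by blast
      then show "t \<in> ?O n" by (intro UN_I[of "(a, b)"]) auto
    qed
  next
    fix t assume t: "t \<in> (\<Inter>n. ?O n)"
    show "t \<in> straddle F P" unfolding straddle_def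
    proof safe
      fix \<epsilon> :: real assume "0 < \<epsilon>"
      then obtain n where "inverse (Suc n) < \<epsilon>" using reals_Archimedean by blast
      moreover from t have "t \<in> ?O n" by blast
      ultimately show "\<exists>a b. a < t \<and> t < b \<and> b - a < \<epsilon> \<and> P (F b - F a) (b - a)" by fastforce
    qed
  qed
  have "open (?O n)" for n by (intro open_UN) auto
  then show ?thesis unfolding eq by (intro sets.countable_INT) auto
qed

lemma interval_family_measure:
  fixes C :: "(real \<times> real) set"
  assumes C: "countable C" "\<And>a b. (a, b) \<in> C \<Longrightarrow> a < b" "disjoint_family_on (\<lambda>(a, b). {a..b}) C"
    and M: "sets M = sets borel"
  shows "emeasure M (\<Union>(a, b)\<in>C. {a..b}) = (\<integral>\<^sup>+p. emeasure M {fst p..snd p} \<partial>count_space C)"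
proof -
  have "emeasure M (\<Union>p\<in>C. (\<lambda>(a, b). {a..b}) p) = (\<integral>\<^sup>+p. emeasure M ((\<lambda>(a, b). {a..b}) p) \<partial>count_space C)"
    by (rule emeasure_UN_countable) (use C M in auto)
  also have "\<dots> = (\<integral>\<^sup>+p. emeasure M {fst p..snd p} \<partial>count_space C)"
    by (intro nn_integral_cong) (auto split: prod.split)
  finally show ?thesis .
qed

text \<open>
  Two applications of Vitali's theorem. Let nu be the Stieltjes measure of F and S a bounded piece
  of the set. Disjoint intervals of slope below u cover almost all of S inside an open set U of
  nearly the same measure. Within them, disjoint intervals of slope above v cover almost all of S
  once more. Comparison of the nu-measures gives v |S| <= u |U|, so that S is null.
\<close>
lemma monotone_straddle_negligible:
  fixes F :: "real \<Rightarrow> real"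
  assumes mono: "\<And>x y. x \<le> y \<Longrightarrow> F x \<le> F y" and cont: "continuous_on UNIV F" and uv: "u < v"
  shows "negligible (straddle F (\<lambda>d l. d < u * l) \<inter> straddle F (\<lambda>d l. v * l < d))"
proof -
  define E where "E = straddle F (\<lambda>d l. d < u * l) \<inter> straddle F (\<lambda>d l. v * l < d)"
  have "negligible (E \<inter> cbox (-m) m)" for m
  proof (cases "u > 0")
    case False
    have "E = {}"
    proof -
      have "\<not> F b - F a < u * (b - a)" if "a < b" for a b
        using mono[of a b] that False mult_nonpos_nonneg[of u "b - a"] by auto
      then have "\<not> (\<exists>a b. a < t \<and> t < b \<and> b - a < 1 \<and> F b - F a < u * (b - a))" for t
        using less_trans by blast
      then have "t \<notin> straddle F (\<lambda>d l. d < u * l)" for t unfolding straddle_def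
        using zero_less_one by blast
      then show ?thesis unfolding E_def by auto
    qed
    then show ?thesis by simp
  next
    case u: True
    define S where "S = E \<inter> cbox (-m) m"
    define \<nu> where "\<nu> = interval_measure F"
    have S: "S \<in> lmeasurable" unfolding S_def E_def
      by (intro bounded_set_imp_lmeasurable)
         (auto intro!: sets.Int straddle_borel simp: bounded_Int sets_completionI_sets)
    have \<nu>: "emeasure \<nu> {a..b} = ennreal (F b - F a)" if "a \<le> b" for a b
      unfolding \<nu>_def using emeasure_interval_measure_Icc[OF that mono cont] by simp
    have sets\<nu>: "sets \<nu> = sets borel" unfolding \<nu>_def by simp
    have le: "ennreal v * emeasure lebesgue S \<le> ennreal u * (emeasure lebesgue S + ennreal e)" if e: "e > 0" for e
    proof -
      obtain U where U: "open U" "S \<subseteq> U" "(U - S) \<in> lmeasurable" "emeasure lebesgue (U - S) < ennreal e"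
        using sets_lebesgue_outer_open[OF fmeasurableD[OF S] e] by metis
      define K1 where "K1 = {(a, b). a < b \<and> {a..b} \<subseteq> U \<and> F b - F a < u * (b - a)}"
      obtain C1 where C1: "countable C1" "C1 \<subseteq> K1" "disjoint_family_on (\<lambda>(a, b). {a..b}) C1"
        "negligible (S - (\<Union>(a, b)\<in>C1. {a..b}))"
      proof (rule Vitali_intervals[of K1 S])
        show "\<exists>(a, b)\<in>K1. a \<le> x \<and> x \<le> b \<and> b - a < d" if "x \<in> S" "0 < d" for x d
        proof -
          obtain e' where e': "e' > 0" "ball x e' \<subseteq> U" using U(1,2) \<open>x \<in> S\<close> open_contains_ball by blast
          have "x \<in> straddle F (\<lambda>d l. d < u * l)" using \<open>x \<in> S\<close> unfolding S_def E_def by blast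
          then obtain a b where ab: "a < x" "x < b" "b - a < min d e'" "F b - F a < u * (b - a)"
            unfolding straddle_def using e'(1) \<open>0 < d\<close> by (auto dest!: spec[of _ "min d e'"])
          have "{a..b} \<subseteq> ball x e'" using ab by (auto simp: dist_real_def)
          then show ?thesis using ab e'(2) unfolding K1_def by (intro bexI[of _ "(a,b)"]) auto
        qed
      qed (auto simp: K1_def)
      \<comment> \<open>The second covering takes place in the interiors of the intervals of the first one.\<close>
      define T where "T = S \<inter> (\<Union>(a, b)\<in>C1. {a<..<b})"
      have negT: "negligible (S - T)"
      proof -
        have "negligible (\<Union>(a, b)\<in>C1. {a, b})"
          by (intro countable_imp_null_set_lborel[THEN negligible_iff_null_sets[THEN iffD2, OF null_sets_completionI]])
             (use C1(1) in auto)
        moreover have "S - T \<subseteq> (S - (\<Union>(a, b)\<in>C1. {a..b})) \<union> (\<Union>(a, b)\<in>C1. {a, b})"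
          unfolding T_def by (force simp: less_le)
        ultimately show ?thesis by (meson C1(4) negligible_Un negligible_subset)
      qed
      define K2 where "K2 = {(a, b). a < b \<and> (\<exists>(c, d)\<in>C1. {a..b} \<subseteq> {c..d}) \<and> v * (b - a) < F b - F a}"
      obtain C2 where C2: "countable C2" "C2 \<subseteq> K2" "disjoint_family_on (\<lambda>(a, b). {a..b}) C2"
        "negligible (T - (\<Union>(a, b)\<in>C2. {a..b}))"
      proof (rule Vitali_intervals[of K2 T])
        show "\<exists>(a, b)\<in>K2. a \<le> x \<and> x \<le> b \<and> b - a < d" if "x \<in> T" "0 < d" for x d
        proof -
          obtain p q where pq: "(p, q) \<in> C1" "p < x" "x < q" using \<open>x \<in> T\<close> unfolding T_def by auto
          define e' where "e' = min (x - p) (q - x)"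
          have "e' > 0" using pq unfolding e'_def by auto
          have "x \<in> straddle F (\<lambda>d l. v * l < d)" using \<open>x \<in> T\<close> unfolding S_def E_def T_def by blast
          then obtain a b where ab: "a < x" "x < b" "b - a < min d e'" "v * (b - a) < F b - F a"
            unfolding straddle_def using \<open>e' > 0\<close> \<open>0 < d\<close> by (auto dest!: spec[of _ "min d e'"])
          have "{a..b} \<subseteq> {p..q}" using ab unfolding e'_def by auto
          then show ?thesis using ab pq unfolding K2_def by (intro bexI[of _ "(a,b)"]) auto
        qed
      qed (auto simp: K2_def)
      have lt1: "a < b" "F b - F a < u * (b - a)" if "(a, b) \<in> C1" for a b
        using that C1(2) unfolding K1_def by auto
      have lt2: "a < b" "\<exists>(c, d)\<in>C1. {a..b} \<subseteq> {c..d}" "v * (b - a) < F b - F a" if "(a, b) \<in> C2" for a b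
        using that C2(2) unfolding K2_def by auto
      let ?U1 = "\<Union>(a, b)\<in>C1. {a..b}" and ?U2 = "\<Union>(a, b)\<in>C2. {a..b}"
      have b1: "?U1 \<in> sets borel" using C1(1) by (intro sets.countable_UN') auto
      have b2: "?U2 \<in> sets borel" using C2(1) by (intro sets.countable_UN') auto
      have neg2: "negligible (S - ?U2)"
        by (rule negligible_subset[OF negligible_Un[OF negT C2(4)]]) auto
      have "emeasure lebesgue S \<le> emeasure lebesgue (?U2 \<union> (S - ?U2))"
        using b2 S neg2 by (intro emeasure_mono) (auto simp: fmeasurable_def negligible_imp_sets)
      also have "\<dots> = emeasure lebesgue ?U2"
        by (rule emeasure_Un_null_set) (use b2 neg2 in \<open>auto simp: negligible_iff_null_sets\<close>)
      finally have "ennreal v * emeasure lebesgue S \<le> ennreal v * emeasure lborel ?U2"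
        using b2 by (auto intro: mult_left_mono)
      also have "\<dots> = (\<integral>\<^sup>+p. ennreal v * emeasure lborel {fst p..snd p} \<partial>count_space C2)"
        using interval_family_measure[OF C2(1) lt2(1) C2(3), of lborel]
        by (subst nn_integral_cmult) auto
      also have "\<dots> \<le> (\<integral>\<^sup>+p. emeasure \<nu> {fst p..snd p} \<partial>count_space C2)"
      proof (rule nn_integral_mono)
        fix p assume "p \<in> space (count_space C2)"
        then have "fst p < snd p" "v * (snd p - fst p) < F (snd p) - F (fst p)"
          using lt2[of "fst p" "snd p"] by auto
        then show "ennreal v * emeasure lborel {fst p..snd p} \<le> emeasure \<nu> {fst p..snd p}"
          using u uv by (simp add: \<nu> ennreal_mult'[symmetric] ennreal_leI)
      qed
      also have "\<dots> = emeasure \<nu> ?U2"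
        using interval_family_measure[OF C2(1) lt2(1) C2(3) sets\<nu>] by simp
      also have "\<dots> \<le> emeasure \<nu> ?U1"
      proof (rule emeasure_mono)
        show "?U2 \<subseteq> ?U1"
        proof safe
          fix x a b assume "(a, b) \<in> C2" "x \<in> {a..b}"
          then obtain c d where "(c, d) \<in> C1" "x \<in> {c..d}" using lt2(2) by blast
          then show "x \<in> ?U1" by blast
        qed
        show "?U1 \<in> sets \<nu>" using b1 sets\<nu> by simp
      qed
      also have "\<dots> = (\<integral>\<^sup>+p. emeasure \<nu> {fst p..snd p} \<partial>count_space C1)"
        using interval_family_measure[OF C1(1) lt1(1) C1(3) sets\<nu>] by simp
      also have "\<dots> \<le> (\<integral>\<^sup>+p. ennreal u * emeasure lborel {fst p..snd p} \<partial>count_space C1)"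
      proof (rule nn_integral_mono)
        fix p assume "p \<in> space (count_space C1)"
        then have "fst p < snd p" "F (snd p) - F (fst p) < u * (snd p - fst p)"
          using lt1[of "fst p" "snd p"] by auto
        then show "emeasure \<nu> {fst p..snd p} \<le> ennreal u * emeasure lborel {fst p..snd p}"
          using u by (simp add: \<nu> ennreal_mult'[symmetric] ennreal_leI)
      qed
      also have "\<dots> = ennreal u * emeasure lborel ?U1"
        using interval_family_measure[OF C1(1) lt1(1) C1(3), of lborel]
        by (subst nn_integral_cmult) auto
      also have "\<dots> \<le> ennreal u * emeasure lebesgue U"
      proof (intro mult_left_mono)
        have "?U1 \<subseteq> U" using C1(2) unfolding K1_def by blast
        then have "emeasure lborel ?U1 \<le> emeasure lborel U" using U(1) by (intro emeasure_mono) auto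
        then show "emeasure lborel ?U1 \<le> emeasure lebesgue U" using U(1) by simp
      qed simp
      also have "\<dots> \<le> ennreal u * (emeasure lebesgue S + ennreal e)"
      proof (intro mult_left_mono)
        have "emeasure lebesgue U \<le> emeasure lebesgue S + emeasure lebesgue (U - S)"
          using emeasure_subadditive[of S lebesgue "U - S"] S U(2,3) by (auto simp: fmeasurable_def Un_absorb1)
        also have "\<dots> \<le> emeasure lebesgue S + ennreal e" using U(4) by (intro add_left_mono) auto
        finally show "emeasure lebesgue U \<le> emeasure lebesgue S + ennreal e" .
      qed simp
      finally show ?thesis .
    qed
    have *: "v * measure lebesgue S \<le> u * measure lebesgue S + u * e" if "e > 0" for e
      using le[OF that] u uv that S
      by (simp add: emeasure_eq_measure2 fmeasurableD ennreal_mult'[symmetric] ennreal_plus[symmetric] distrib_left del: ennreal_plus)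
    have "v * measure lebesgue S \<le> u * measure lebesgue S"
    proof (rule field_le_epsilon)
      fix d :: real assume "0 < d"
      then have "0 < d / u" using u by simp
      from *[OF this] have "v * measure lebesgue S \<le> u * measure lebesgue S + u * (d / u)" .
      also have "u * (d / u) = d" using u by simp
      finally show "v * measure lebesgue S \<le> u * measure lebesgue S + d" .
    qed
    then have "\<not> 0 < measure lebesgue S" using mult_strict_right_mono[OF uv] by (meson not_le)
    then have "measure lebesgue S = 0" using measure_nonneg[of lebesgue S] by linarith
    then show ?thesis using S unfolding S_def[symmetric] by (simp add: negligible_iff_measure)
  qed
  then have "negligible (E \<inter> cbox a b)" for a b
    by (rule negligible_subset[of "E \<inter> cbox (- max \<bar>a\<bar> \<bar>b\<bar>) (max \<bar>a\<bar> \<bar>b\<bar>)"]) auto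
  then show ?thesis unfolding E_def[symmetric] using negligible_on_intervals[of E] by blast
qed


text \<open>
  If no two rationals separate arbitrarily short straddling intervals of smaller slope from those
  of larger slope, the slopes converge to the supremum p of the values that they exceed
  arbitrarily close to t.
\<close>
lemma differentiable_if_straddling_slopes_agree:
  fixes F :: "real \<Rightarrow> real"
  assumes cont: "continuous_on UNIV F" and lip: "\<And>x y. x \<le> y \<Longrightarrow> F x \<le> F y \<and> F y - F x \<le> L * (y - x)"
    and t: "\<And>u v. u \<in> \<rat> \<Longrightarrow> v \<in> \<rat> \<Longrightarrow> u < v \<Longrightarrow> t \<notin> straddle F (\<lambda>d l. d < u * l) \<inter> straddle F (\<lambda>d l. v * l < d)"
  shows "F differentiable (at t)"
proof -
  define A where "A = {u. t \<in> straddle F (\<lambda>d l. u * l < d)}"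
  have "-1 \<in> A"
  proof -
    have "\<exists>a b. a < t \<and> t < b \<and> b - a < \<epsilon> \<and> - 1 * (b - a) < F b - F a" if "\<epsilon> > 0" for \<epsilon>
    proof (intro exI conjI)
      show "- 1 * (t + \<epsilon>/4 - (t - \<epsilon>/4)) < F (t + \<epsilon>/4) - F (t - \<epsilon>/4)"
        using lip[of "t - \<epsilon>/4" "t + \<epsilon>/4"] that by (auto simp: field_simps)
    qed (use that in auto)
    then show ?thesis unfolding A_def straddle_def by blast
  qed
  have bnd: "u \<le> L" if "u \<in> A" for u
  proof (rule ccontr)
    assume "\<not> u \<le> L"
    from that obtain a b where "a < t" "t < b" "u * (b - a) < F b - F a"
      unfolding A_def straddle_def using zero_less_one by blast
    moreover from this have "L * (b - a) < u * (b - a)" using \<open>\<not> u \<le> L\<close> by (intro mult_strict_right_mono) auto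
    ultimately show False using lip[of a b] by linarith
  qed
  have bdd: "bdd_above A" using bnd by (auto simp: bdd_above_def)
  define p where "p = Sup A"
  have up: "\<exists>\<epsilon>>0. \<forall>a b. a < t \<and> t < b \<and> b - a < \<epsilon> \<longrightarrow> F b - F a \<le> (p + e) * (b - a)" if "e > 0" for e
  proof -
    have "p + e \<notin> A" using cSup_upper[OF _ bdd, of "p + e"] that unfolding p_def by auto
    then show ?thesis unfolding A_def straddle_def mem_Collect_eq by (meson not_less)
  qed
  have dn: "\<exists>\<epsilon>>0. \<forall>a b. a < t \<and> t < b \<and> b - a < \<epsilon> \<longrightarrow> (p - e) * (b - a) \<le> F b - F a" if "e > 0" for e
  proof -
    obtain u where u: "u \<in> \<rat>" "p - e < u" "u < p - e/2" using Rats_dense_in_real[of "p - e" "p - e/2"] \<open>e > 0\<close> by auto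
    obtain v where v: "v \<in> \<rat>" "p - e/2 < v" "v < p" using Rats_dense_in_real[of "p - e/2" p] \<open>e > 0\<close> by auto
    obtain v' where v': "v' \<in> A" "v < v'" using less_cSup_iff[of A v] bdd \<open>-1 \<in> A\<close> v(3) unfolding p_def by auto
    have "t \<in> straddle F (\<lambda>d l. v * l < d)" unfolding straddle_def
    proof safe
      fix \<epsilon> :: real assume "\<epsilon> > 0"
      then obtain a b where "a < t" "t < b" "b - a < \<epsilon>" "v' * (b - a) < F b - F a"
        using v'(1) unfolding A_def straddle_def by blast
      moreover have "v * (b - a) \<le> v' * (b - a)" using v'(2) calculation by (intro mult_right_mono) auto
      ultimately show "\<exists>a b. a < t \<and> t < b \<and> b - a < \<epsilon> \<and> v * (b - a) < F b - F a"
        using order.strict_trans1 by blast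
    qed
    then have "t \<notin> straddle F (\<lambda>d l. d < u * l)" using t[of u v] u v by auto
    then obtain \<epsilon> where \<epsilon>: "\<epsilon> > 0" "\<And>a b. a < t \<Longrightarrow> t < b \<Longrightarrow> b - a < \<epsilon> \<Longrightarrow> u * (b - a) \<le> F b - F a"
      unfolding straddle_def mem_Collect_eq by (meson not_less)
    have "(p - e) * (b - a) \<le> F b - F a" if "a < t" "t < b" "b - a < \<epsilon>" for a b
    proof -
      have "(p - e) * (b - a) \<le> u * (b - a)" using u that by (intro mult_right_mono) auto
      then show ?thesis using \<epsilon>(2)[OF that] by linarith
    qed
    then show ?thesis using \<epsilon>(1) by blast
  qed
  have "(F has_real_derivative p) (at t)"
    unfolding has_field_derivative_def has_derivative_at_alt
  proof (intro conjI allI impI)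
    show "bounded_linear ((*) p)" by (rule bounded_linear_mult_right)
    fix e :: real assume "e > 0"
    obtain e1 where e1: "e1 > 0" "\<And>a b. a < t \<Longrightarrow> t < b \<Longrightarrow> b - a < e1 \<Longrightarrow> F b - F a \<le> (p + e) * (b - a)"
      using up[OF \<open>e > 0\<close>] by blast
    obtain e2 where e2: "e2 > 0" "\<And>a b. a < t \<Longrightarrow> t < b \<Longrightarrow> b - a < e2 \<Longrightarrow> (p - e) * (b - a) \<le> F b - F a"
      using dn[OF \<open>e > 0\<close>] by blast
    \<comment> \<open>An interval that ends at t is the limit of the straddling intervals from a - eta to b + eta.\<close>
    have cl: "(p - e) * (b - a) \<le> F b - F a \<and> F b - F a \<le> (p + e) * (b - a)"
      if "a \<le> t" "t \<le> b" "b - a < min e1 e2" for a b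
    proof -
      define \<eta> where "\<eta> n = (min e1 e2 - (b - a)) / 3 * inverse (real (Suc n))" for n
      have \<eta>: "\<eta> n > 0" "\<eta> n \<le> (min e1 e2 - (b - a)) / 3" for n
        using that unfolding \<eta>_def by (auto intro!: mult_left_le inverse_le_1_iff[THEN iffD2] simp del: of_nat_Suc)
      have "\<eta> \<longlonglongrightarrow> (min e1 e2 - (b - a)) / 3 * 0" unfolding \<eta>_def
        by (intro tendsto_mult tendsto_const LIMSEQ_inverse_real_of_nat)
      then have \<eta>0: "\<eta> \<longlonglongrightarrow> 0" by simp
      have la: "(\<lambda>n. a - \<eta> n) \<longlonglongrightarrow> a" and lb: "(\<lambda>n. b + \<eta> n) \<longlonglongrightarrow> b"
        using tendsto_diff[OF tendsto_const \<eta>0, of a] tendsto_add[OF tendsto_const \<eta>0, of b] by auto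
      have lF: "(\<lambda>n. F (b + \<eta> n) - F (a - \<eta> n)) \<longlonglongrightarrow> F b - F a"
        using cont by (intro tendsto_diff isCont_tendsto_compose[OF _ la] isCont_tendsto_compose[OF _ lb])
          (auto simp: continuous_on_eq_continuous_at)
      have ll: "(\<lambda>n. c * ((b + \<eta> n) - (a - \<eta> n))) \<longlonglongrightarrow> c * (b - a)" for c
        by (intro tendsto_mult tendsto_diff tendsto_const la lb)
      have n: "a - \<eta> n < t" "t < b + \<eta> n" "(b + \<eta> n) - (a - \<eta> n) < e1" "(b + \<eta> n) - (a - \<eta> n) < e2" for n
        using that \<eta>[of n] by auto
      show ?thesis
        using LIMSEQ_le[OF ll lF] LIMSEQ_le[OF lF ll] e1(2)[OF n(1,2,3)] e2(2)[OF n(1,2,4)] by blast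
    qed
    show "\<exists>d>0. \<forall>y. norm (y - t) < d \<longrightarrow> norm (F y - F t - p * (y - t)) \<le> e * norm (y - t)"
    proof (intro exI conjI allI impI)
      show "0 < min e1 e2" using e1 e2 by auto
      fix y assume "norm (y - t) < min e1 e2"
      then show "norm (F y - F t - p * (y - t)) \<le> e * norm (y - t)"
        using cl[of t y] cl[of y t] by (cases "t \<le> y") (auto simp: abs_le_iff algebra_simps)
    qed
  qed
  then show ?thesis using real_differentiable_def by blast
qed

lemma lipschitz_differentiable_AE:
  fixes \<phi> :: "real \<Rightarrow> real"
  assumes lip: "\<And>x y. \<bar>\<phi> x - \<phi> y\<bar> \<le> L * \<bar>x - y\<bar>"
  shows "negligible {t. \<not> \<phi> differentiable (at t)}"
proof -
  \<comment> \<open>The added linear function makes the sum monotone.\<close>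
  define F where "F t = \<phi> t + L * t" for t
  have F: "F x \<le> F y" "F y - F x \<le> (2 * L) * (y - x)" if "x \<le> y" for x y
    using lip[of y x] that unfolding F_def by (auto simp: abs_le_iff algebra_simps)
  have L: "L \<ge> 0" using lip[of 1 0] abs_ge_zero[of "\<phi> 1 - \<phi> 0"] by auto
  have "continuous_on UNIV \<phi>"
    by (rule lipschitz_on_continuous_on[of L]) (use lip L in \<open>auto simp: lipschitz_on_def dist_real_def\<close>)
  then have cont: "continuous_on UNIV F" unfolding F_def by (intro continuous_intros)
  let ?E = "\<lambda>(u, v). straddle F (\<lambda>d l. d < u * l) \<inter> straddle F (\<lambda>d l. v * l < d)"
  have "negligible (\<Union> (?E ` {p. p \<in> \<rat> \<times> \<rat> \<and> fst p < snd p}))"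
  proof (rule negligible_countable_Union)
    show "countable (?E ` {p. p \<in> \<rat> \<times> \<rat> \<and> fst p < snd p})"
      by (intro countable_image countable_Collect countable_SIGMA countable_rat)
    show "negligible S" if "S \<in> ?E ` {p. p \<in> \<rat> \<times> \<rat> \<and> fst p < snd p}" for S
      using that monotone_straddle_negligible[OF F(1) cont] by auto
  qed
  moreover have "{t. \<not> \<phi> differentiable (at t)} \<subseteq> \<Union> (?E ` {p. p \<in> \<rat> \<times> \<rat> \<and> fst p < snd p})"
  proof
    fix t assume "t \<in> {t. \<not> \<phi> differentiable (at t)}"
    then have nd: "\<not> \<phi> differentiable (at t)" by simp
    have "\<not> F differentiable (at t)"
    proof
      assume "F differentiable (at t)"
      then have "(\<lambda>t. F t - L * t) differentiable (at t)" by (intro derivative_intros) auto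
      then show False using nd unfolding F_def by simp
    qed
    then obtain u v where "u \<in> \<rat>" "v \<in> \<rat>" "u < v" "t \<in> straddle F (\<lambda>d l. d < u * l) \<inter> straddle F (\<lambda>d l. v * l < d)"
      using differentiable_if_straddling_slopes_agree[OF cont, of "2 * L" t] F by metis
    then show "t \<in> \<Union> (?E ` {p. p \<in> \<rat> \<times> \<rat> \<and> fst p < snd p})"
      by (intro UnionI[of "?E (u, v)"]) auto
  qed
  ultimately show ?thesis by (rule negligible_subset)
qed


section \<open>Absolutely continuous curves\<close>

lemma absolutely_continuous_curveE:
  assumes "absolutely_continuous_curve I \<gamma>" "0 < \<epsilon>"
  obtains \<delta> where "\<delta> > 0" "\<forall>D :: (real \<times> real) set.
        finite D \<longrightarrow> (\<forall>(u, v)\<in>D. u \<le> v \<and> {u..v} \<subseteq> I) \<longrightarrow>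
        pairwise (\<lambda>p q. {fst p<..<snd p} \<inter> {fst q<..<snd q} = {}) D \<longrightarrow>
        (\<Sum>(u, v)\<in>D. v - u) < \<delta> \<longrightarrow> (\<Sum>(u, v)\<in>D. norm (\<gamma> v - \<gamma> u)) < \<epsilon>"
proof -
  from assms obtain \<delta> where \<delta>: "\<delta> > 0" and *: "\<forall>D :: (real \<times> real) set.
        finite D \<and> (\<forall>(u, v)\<in>D. u \<le> v \<and> {u..v} \<subseteq> I) \<and>
        pairwise (\<lambda>p q. {fst p<..<snd p} \<inter> {fst q<..<snd q} = {}) D \<and>
        (\<Sum>(u, v)\<in>D. v - u) < \<delta>
        \<longrightarrow> (\<Sum>(u, v)\<in>D. norm (\<gamma> v - \<gamma> u)) < \<epsilon>"
    unfolding absolutely_continuous_curve_def by meson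
  show ?thesis by (rule that[OF \<delta>]) (use * in blast)
qed

lemma negligible_open_superset:
  fixes Z :: "'a::euclidean_space set"
  assumes "negligible Z" "0 < \<delta>"
  obtains U where "open U" "Z \<subseteq> U" "emeasure lebesgue U < ennreal \<delta>"
proof -
  have "Z \<in> sets lebesgue" using assms(1) by (simp add: negligible_imp_sets)
  then obtain U where U: "open U" "Z \<subseteq> U" "emeasure lebesgue (U - Z) < ennreal \<delta>"
    using \<open>0 < \<delta>\<close> by (rule sets_lebesgue_outer_open) (rule that)
  have "(U - Z) \<union> Z = U" using U(2) by blast
  then have "emeasure lebesgue U = emeasure lebesgue ((U - Z) \<union> Z)" by simp
  also have "\<dots> = emeasure lebesgue (U - Z)"
    using assms(1) U(1) by (intro emeasure_Un_null_set) (auto simp: negligible_iff_null_sets negligible_imp_sets)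
  finally show ?thesis using that U by simp
qed

text \<open>
  Riemann sums are compared with increments. Differentiability controls the intervals whose tag lies
  outside Z. The intervals whose tag lies in Z are contained in an open set of small measure, where
  absolute continuity bounds the sum of the increments.
\<close>
theorem absolutely_continuous_FTC:
  fixes \<gamma> :: "real \<Rightarrow> 'a::banach"
  assumes ab: "a \<le> b" and AC: "absolutely_continuous_curve {a..b} \<gamma>" and Z: "negligible Z"
    and deriv: "\<And>t. t \<in> {a..b} - Z \<Longrightarrow> (\<gamma> has_vector_derivative g t) (at t within {a..b})"
  shows "(g has_integral (\<gamma> b - \<gamma> a)) {a..b}"
proof -
  \<comment> \<open>With the value 0 on Z, an interval with tag in Z contributes only its increment.\<close>
  define f where "f t = (if t \<in> Z then 0 else g t)" for t
  have "(f has_integral (\<gamma> b - \<gamma> a)) (cbox a b)"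
    unfolding has_integral
  proof (intro allI impI)
    fix e :: real assume "e > 0"
    define e' where "e' = e / (2 * (b - a + 1))"
    have "e' > 0" and e'le: "e' * (b - a) < e / 2" using \<open>e > 0\<close> ab unfolding e'_def by (auto simp: field_simps)
    obtain \<delta> where \<delta>: "\<delta> > 0" "\<forall>D :: (real \<times> real) set.
        finite D \<longrightarrow> (\<forall>(u, v)\<in>D. u \<le> v \<and> {u..v} \<subseteq> {a..b}) \<longrightarrow>
        pairwise (\<lambda>p q. {fst p<..<snd p} \<inter> {fst q<..<snd q} = {}) D \<longrightarrow>
        (\<Sum>(u, v)\<in>D. v - u) < \<delta> \<longrightarrow> (\<Sum>(u, v)\<in>D. norm (\<gamma> v - \<gamma> u)) < e / 2"
      by (rule absolutely_continuous_curveE[OF AC half_gt_zero[OF \<open>e > 0\<close>]]) (rule that)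
    obtain U where U: "open U" "Z \<subseteq> U" and mU: "emeasure lebesgue U < ennreal \<delta>"
      by (rule negligible_open_superset[OF Z \<open>\<delta> > 0\<close>]) (rule that)
    have "\<exists>d>0. (t \<in> Z \<longrightarrow> ball t d \<subseteq> U) \<and> (t \<in> {a..b} - Z \<longrightarrow>
         (\<forall>y\<in>{a..b}. norm (y - t) < d \<longrightarrow> norm (\<gamma> y - \<gamma> t - (y - t) *\<^sub>R g t) \<le> e' * norm (y - t)))" for t
    proof (cases "t \<in> Z")
      case True then show ?thesis using U(1,2) by (meson open_contains_ball subsetD DiffD2)
    next
      case False then show ?thesis
        using deriv[of t] \<open>e' > 0\<close> zero_less_one
        unfolding has_vector_derivative_def has_derivative_within_alt by blast
    qed
    then obtain d where d: "\<And>t. d t > 0" "\<And>t. t \<in> Z \<Longrightarrow> ball t (d t) \<subseteq> U"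
      "\<And>t y. t \<in> {a..b} - Z \<Longrightarrow> y \<in> {a..b} \<Longrightarrow> norm (y - t) < d t \<Longrightarrow> norm (\<gamma> y - \<gamma> t - (y - t) *\<^sub>R g t) \<le> e' * norm (y - t)"
      by metis
    show "\<exists>G. gauge G \<and> (\<forall>p. p tagged_division_of cbox a b \<and> G fine p \<longrightarrow>
        norm ((\<Sum>(x, K)\<in>p. Henstock_Kurzweil_Integration.content K *\<^sub>R f x) - (\<gamma> b - \<gamma> a)) < e)"
    proof (rule exI, safe)
      show "gauge (\<lambda>x. ball x (d x))" using d(1) gauge_ball_dependent by blast
      fix p assume ptag: "p tagged_division_of cbox a b" and finep: "(\<lambda>x. ball x (d x)) fine p"
      have finp: "finite p" using ptag by blast
      have pK: "Inf K \<le> x" "x \<le> Sup K" "K = {Inf K..Sup K}" "{Inf K..Sup K} \<subseteq> {a..b}" "K \<subseteq> ball x (d x)" if "(x, K) \<in> p" for x K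
      proof -
        note pq = tagged_division_ofD[OF ptag]
        obtain u v where K: "K = cbox u v" using pq(4)[OF \<open>(x, K) \<in> p\<close>] by blast
        have "x \<in> K" "K \<subseteq> cbox a b" using pq(2,3)[OF \<open>(x, K) \<in> p\<close>] by simp_all
        then show "Inf K \<le> x" "x \<le> Sup K" "K = {Inf K..Sup K}" "{Inf K..Sup K} \<subseteq> {a..b}" using K by auto
        show "K \<subseteq> ball x (d x)" using finep that by blast
      qed
      define B where "B = {q \<in> p. fst q \<in> Z}"
      have "finite B" "B \<subseteq> p" using finp unfolding B_def by auto
      define c where "c q = (case q of (x, K) \<Rightarrow> Henstock_Kurzweil_Integration.content K *\<^sub>R f x - (\<gamma> (Sup K) - \<gamma> (Inf K)))" for q
      have "(\<Sum>(x, K)\<in>p. Henstock_Kurzweil_Integration.content K *\<^sub>R f x) - (\<gamma> b - \<gamma> a) = sum c p"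
        using additive_tagged_division_1[OF ab ptag[unfolded box_real], of \<gamma>]
        by (simp add: c_def split_def sum_subtractf)
      also have "\<dots> = sum c (p - B) + sum c B" using finp \<open>B \<subseteq> p\<close> by (simp add: sum.subset_diff)
      finally have split: "(\<Sum>(x, K)\<in>p. Henstock_Kurzweil_Integration.content K *\<^sub>R f x) - (\<gamma> b - \<gamma> a) = sum c (p - B) + sum c B" .
      have "norm (sum c (p - B)) \<le> (\<Sum>q\<in>p - B. e' * (Sup (snd q) - Inf (snd q)))"
      proof (rule sum_norm_le)
        fix q assume "q \<in> p - B"
        obtain x K where q: "q = (x, K)" by (metis surj_pair)
        then have xK: "(x, K) \<in> p" "x \<notin> Z" using \<open>q \<in> p - B\<close> unfolding B_def by auto
        define u v where "u = Inf K" and "v = Sup K"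
        note k = pK[OF xK(1), folded u_def v_def]
        have xab: "x \<in> {a..b} - Z" using k xK(2) by auto
        have uin: "u \<in> {u..v}" and vin: "v \<in> {u..v}" using k(1,2) by simp_all
        have sub: "{u..v} \<subseteq> ball x (d x)" using k(5) unfolding k(3) .
        note uv = subsetD[OF k(4) uin] subsetD[OF k(4) vin] subsetD[OF sub uin] subsetD[OF sub vin]
        have "Henstock_Kurzweil_Integration.content K = Henstock_Kurzweil_Integration.content {u..v}"
          by (rule arg_cong[OF k(3)])
        also have "\<dots> = v - u" using k(1,2) by (intro content_real) linarith
        finally have cK: "Henstock_Kurzweil_Integration.content K = v - u" .
        have "c q = (\<gamma> u - \<gamma> x - (u - x) *\<^sub>R g x) - (\<gamma> v - \<gamma> x - (v - x) *\<^sub>R g x)"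
          by (simp add: c_def q f_def xK(2) cK u_def[symmetric] v_def[symmetric] algebra_simps)
        also have "norm \<dots> \<le> norm (\<gamma> u - \<gamma> x - (u - x) *\<^sub>R g x) + norm (\<gamma> v - \<gamma> x - (v - x) *\<^sub>R g x)"
          by (rule norm_triangle_ineq4)
        also have "\<dots> \<le> e' * norm (u - x) + e' * norm (v - x)"
          using d(3)[OF xab uv(1)] d(3)[OF xab uv(2)] uv(3,4) by (intro add_mono) (auto simp: dist_norm norm_minus_commute)
        also have "\<dots> = e' * (v - u)" using k by (auto simp: algebra_simps)
        finally show "norm (c q) \<le> e' * (Sup (snd q) - Inf (snd q))" by (simp add: q u_def v_def)
      qed
      also have "\<dots> \<le> (\<Sum>q\<in>p. e' * (Sup (snd q) - Inf (snd q)))"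
        using finp \<open>e' > 0\<close> pK by (intro sum_mono2) (auto intro!: mult_nonneg_nonneg, force)
      also have "\<dots> = e' * (b - a)"
        using additive_tagged_division_1[OF ab ptag[unfolded box_real], of "\<lambda>x. x"]
        by (simp add: sum_distrib_left[symmetric] split_def)
      finally have good: "norm (sum c (p - B)) < e / 2" using e'le by simp
      \<comment> \<open>Without the degenerate intervals, the map to pairs of end points is injective.\<close>
      define B' where "B' = {q \<in> B. Inf (snd q) < Sup (snd q)}"
      define E where "E q = (Inf (snd q), Sup (snd q))" for q :: "real \<times> real set"
      have "finite B'" "B' \<subseteq> p" using \<open>finite B\<close> \<open>B \<subseteq> p\<close> unfolding B'_def by auto
      have disj: "{Inf (snd q)<..<Sup (snd q)} \<inter> {Inf (snd r)<..<Sup (snd r)} = {}" if "q \<in> p" "r \<in> p" "q \<noteq> r" for q r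
      proof -
        have "interior (snd q) \<inter> interior (snd r) = {}"
          using tagged_division_ofD(5)[OF ptag, of "fst q" "snd q" "fst r" "snd r"] that by simp
        moreover have "interior (snd q) = {Inf (snd q)<..<Sup (snd q)}" if "q \<in> p" for q
        proof -
          have "(fst q, snd q) \<in> p" using that by simp
          then show ?thesis
            by (rule trans[OF arg_cong[OF pK(3), of _ _ interior] interior_atLeastAtMost_real])
        qed
        ultimately show ?thesis using that by simp
      qed
      have injE: "inj_on E B'"
      proof (rule inj_onI, rule ccontr)
        fix q r assume qr: "q \<in> B'" "r \<in> B'" "E q = E r" "q \<noteq> r"
        then have "{Inf (snd q)<..<Sup (snd q)} = {}" using disj[of q r] \<open>B' \<subseteq> p\<close> by (auto simp: E_def)
        then show False using qr(1) by (simp add: B'_def)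
      qed
      have nn: "0 \<le> Sup (snd q) - Inf (snd q)" if "q \<in> B'" for q using that by (simp add: B'_def)
      have bad: "(\<Sum>(u, v)\<in>E ` B'. norm (\<gamma> v - \<gamma> u)) < e / 2"
      proof (rule \<delta>(2)[rule_format])
        show "finite (E ` B')" using \<open>finite B'\<close> by simp
        show "case q of (u, v) \<Rightarrow> u \<le> v \<and> {u..v} \<subseteq> {a..b}" if "q \<in> E ` B'" for q
          using that
        proof safe
          fix u v x K assume "(x, K) \<in> B'" "(u, v) = E (x, K)"
          then show "u \<le> v" using pK[of x K] \<open>B' \<subseteq> p\<close> by (auto simp: E_def)
        next
          fix u v x K y assume "(x, K) \<in> B'" "(u, v) = E (x, K)" "y \<in> {u..v}"
          then show "y \<in> {a..b}" using pK(4)[of x K] \<open>B' \<subseteq> p\<close> by (auto simp: E_def)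
        qed
        show "pairwise (\<lambda>p q. {fst p<..<snd p} \<inter> {fst q<..<snd q} = {}) (E ` B')"
          unfolding pairwise_def using disj \<open>B' \<subseteq> p\<close> by (fastforce simp: E_def)
        have "(\<Sum>q\<in>B'. ennreal (Sup (snd q) - Inf (snd q))) = (\<Sum>q\<in>B'. emeasure lebesgue {Inf (snd q)<..<Sup (snd q)})"
          by (intro sum.cong) (auto simp: B'_def)
        also have "\<dots> = emeasure lebesgue (\<Union>q\<in>B'. {Inf (snd q)<..<Sup (snd q)})"
        proof (rule sum_emeasure)
          show "disjoint_family_on (\<lambda>q. {Inf (snd q)<..<Sup (snd q)}) B'"
            unfolding disjoint_family_on_def using disj \<open>B' \<subseteq> p\<close> by blast
        qed (use \<open>finite B'\<close> in auto)
        also have "\<dots> \<le> emeasure lebesgue U"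
        proof (rule emeasure_mono)
          show "(\<Union>q\<in>B'. {Inf (snd q)<..<Sup (snd q)}) \<subseteq> U"
          proof safe
            fix x K y assume q: "(x, K) \<in> B'" "y \<in> {Inf (snd (x, K))<..<Sup (snd (x, K))}"
            then have "y \<in> {Inf K..Sup K}" "(x, K) \<in> p" "x \<in> Z" using \<open>B' \<subseteq> p\<close> by (auto simp: B'_def B_def)
            then show "y \<in> U" using pK(3,5)[of x K] d(2)[of x] by blast
          qed
        qed (use U(1) in simp)
        also note mU
        finally have "(\<Sum>q\<in>B'. ennreal (Sup (snd q) - Inf (snd q))) < ennreal \<delta>" .
        moreover have "(\<Sum>q\<in>B'. ennreal (Sup (snd q) - Inf (snd q))) = ennreal (\<Sum>q\<in>B'. Sup (snd q) - Inf (snd q))"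
          by (rule sum_ennreal) (rule nn)
        moreover have "0 \<le> (\<Sum>q\<in>B'. Sup (snd q) - Inf (snd q))" by (rule sum_nonneg) (rule nn)
        ultimately have "(\<Sum>q\<in>B'. Sup (snd q) - Inf (snd q)) < \<delta>" by (simp only: ennreal_less_iff)
        then show "(\<Sum>(u, v)\<in>E ` B'. v - u) < \<delta>"
          unfolding sum.reindex[OF injE] by (simp add: E_def)
      qed
      have "norm (sum c B) \<le> (\<Sum>q\<in>B. norm (\<gamma> (Sup (snd q)) - \<gamma> (Inf (snd q))))"
        by (rule sum_norm_le) (auto simp: c_def B_def f_def norm_minus_commute)
      also have "\<dots> = (\<Sum>q\<in>B'. norm (\<gamma> (Sup (snd q)) - \<gamma> (Inf (snd q))))"
      proof (rule sum.mono_neutral_right)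
        show "\<forall>q\<in>B - B'. norm (\<gamma> (Sup (snd q)) - \<gamma> (Inf (snd q))) = 0"
        proof
          fix q assume "q \<in> B - B'"
          then have "\<not> Inf (snd q) < Sup (snd q)" "(fst q, snd q) \<in> p" using \<open>B \<subseteq> p\<close> by (auto simp: B'_def)
          then have "Inf (snd q) = Sup (snd q)" using pK(1,2)[of "fst q" "snd q"] by linarith
          then show "norm (\<gamma> (Sup (snd q)) - \<gamma> (Inf (snd q))) = 0" by simp
        qed
      qed (use \<open>finite B\<close> in \<open>auto simp: B'_def\<close>)
      also have "\<dots> = (\<Sum>(u, v)\<in>E ` B'. norm (\<gamma> v - \<gamma> u))"
        unfolding sum.reindex[OF injE] by (simp add: E_def)
      finally have "norm (sum c B) < e / 2" using bad by simp
      with good show "norm ((\<Sum>(x, K)\<in>p. Henstock_Kurzweil_Integration.content K *\<^sub>R f x) - (\<gamma> b - \<gamma> a)) < e"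
        unfolding split using norm_triangle_ineq[of "sum c (p - B)" "sum c B"] by linarith
    qed
  qed
  then show ?thesis
    by (intro has_integral_spike[OF Z, of "{a..b}" g f]) (auto simp: f_def)
qed

lemma absolutely_continuous_curve_subset:
  assumes "absolutely_continuous_curve I \<gamma>" "J \<subseteq> I" shows "absolutely_continuous_curve J \<gamma>"
  unfolding absolutely_continuous_curve_def
proof (intro allI impI)
  fix \<epsilon> :: real assume "0 < \<epsilon>"
  with assms(1) obtain \<delta> where "\<delta> > 0" and *: "\<forall>D :: (real \<times> real) set.
        finite D \<and> (\<forall>(u, v)\<in>D. u \<le> v \<and> {u..v} \<subseteq> I) \<and>
        pairwise (\<lambda>p q. {fst p<..<snd p} \<inter> {fst q<..<snd q} = {}) D \<and>
        (\<Sum>(u, v)\<in>D. v - u) < \<delta>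
        \<longrightarrow> (\<Sum>(u, v)\<in>D. norm (\<gamma> v - \<gamma> u)) < \<epsilon>"
    unfolding absolutely_continuous_curve_def by meson
  show "\<exists>\<delta>>0. \<forall>D :: (real \<times> real) set.
        finite D \<and> (\<forall>(u, v)\<in>D. u \<le> v \<and> {u..v} \<subseteq> J) \<and>
        pairwise (\<lambda>p q. {fst p<..<snd p} \<inter> {fst q<..<snd q} = {}) D \<and>
        (\<Sum>(u, v)\<in>D. v - u) < \<delta>
        \<longrightarrow> (\<Sum>(u, v)\<in>D. norm (\<gamma> v - \<gamma> u)) < \<epsilon>"
  proof (intro exI[of _ \<delta>] conjI allI impI \<open>\<delta> > 0\<close>)
    fix D :: "(real \<times> real) set"
    assume D: "finite D \<and> (\<forall>(u, v)\<in>D. u \<le> v \<and> {u..v} \<subseteq> J) \<and>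
        pairwise (\<lambda>p q. {fst p<..<snd p} \<inter> {fst q<..<snd q} = {}) D \<and> (\<Sum>(u, v)\<in>D. v - u) < \<delta>"
    then have "\<forall>(u, v)\<in>D. u \<le> v \<and> {u..v} \<subseteq> I" using assms(2) by fastforce
    with D * show "(\<Sum>(u, v)\<in>D. norm (\<gamma> v - \<gamma> u)) < \<epsilon>" by blast
  qed
qed

text \<open>
  On an interval shorter than the delta that belongs to 1 in the definition of absolute continuity,
  the indefinite integral of g has variation at most 1, which makes g absolutely integrable there.
  Finitely many such intervals cover the given one.
\<close>
theorem absolutely_continuous_derivative_integrable:
  fixes \<gamma> :: "real \<Rightarrow> 'a::euclidean_space"
  assumes AC: "absolutely_continuous_curve {a..b} \<gamma>" and Z: "negligible Z"
    and deriv: "\<And>t. t \<in> {a..b} - Z \<Longrightarrow> (\<gamma> has_vector_derivative g t) (at t within {a..b})"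
  shows "g absolutely_integrable_on {a..b}"
proof -
  obtain \<delta> where \<delta>: "\<delta> > 0" "\<forall>D :: (real \<times> real) set.
        finite D \<longrightarrow> (\<forall>(u, v)\<in>D. u \<le> v \<and> {u..v} \<subseteq> {a..b}) \<longrightarrow>
        pairwise (\<lambda>p q. {fst p<..<snd p} \<inter> {fst q<..<snd q} = {}) D \<longrightarrow>
        (\<Sum>(u, v)\<in>D. v - u) < \<delta> \<longrightarrow> (\<Sum>(u, v)\<in>D. norm (\<gamma> v - \<gamma> u)) < 1"
    by (rule absolutely_continuous_curveE[OF AC zero_less_one]) (rule that)
  have int: "(g has_integral (\<gamma> v - \<gamma> u)) {u..v}" if "u \<le> v" "{u..v} \<subseteq> {a..b}" for u v
    by (rule absolutely_continuous_FTC[OF that(1) absolutely_continuous_curve_subset[OF AC that(2)] Z])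
       (use deriv that(2) in \<open>blast intro: has_vector_derivative_within_subset\<close>)
  have short: "g absolutely_integrable_on {u..v}" if uv: "u \<le> v" "{u..v} \<subseteq> {a..b}" "v - u < \<delta>" for u v
  proof -
    have "g absolutely_integrable_on cbox u v"
    proof (rule bounded_variation_absolutely_integrable_interval[where B = 1])
      show "g integrable_on cbox u v" using int[OF uv(1,2)] by (auto simp: integrable_on_def)
      fix d assume d: "d division_of cbox u v"
      have K: "K = {Inf K..Sup K}" "Inf K \<le> Sup K" "{Inf K..Sup K} \<subseteq> {u..v}" if "K \<in> d" for K
      proof -
        have "\<exists>x y. K = cbox x y" "K \<noteq> {}" "K \<subseteq> cbox u v" using division_ofD[OF d] that by auto
        then show "K = {Inf K..Sup K}" "Inf K \<le> Sup K" "{Inf K..Sup K} \<subseteq> {u..v}" by auto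
      qed
      have fin: "finite d" using d by blast
      let ?E = "\<lambda>K. (Inf K, Sup K)"
      have inj: "inj_on ?E d" using K(1) by (intro inj_onI) (metis Pair_inject)
      have "(\<Sum>K\<in>d. norm (integral K g)) = (\<Sum>(u, v)\<in>?E ` d. norm (\<gamma> v - \<gamma> u))"
      proof -
        have "integral K g = \<gamma> (Sup K) - \<gamma> (Inf K)" if "K \<in> d" for K
        proof -
          have "{Inf K..Sup K} \<subseteq> {a..b}" using K(3)[OF that] uv(2) by blast
          from int[OF K(2)[OF that] this] show ?thesis using K(1)[OF that] by (simp add: integral_unique)
        qed
        then show ?thesis by (simp add: sum.reindex[OF inj])
      qed
      also have "\<dots> < 1"
      proof (rule \<delta>(2)[rule_format])
        show "finite (?E ` d)" using fin by simp
        show "case q of (u, v) \<Rightarrow> u \<le> v \<and> {u..v} \<subseteq> {a..b}" if "q \<in> ?E ` d" for q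
          using that K uv(2) by fastforce
        show "pairwise (\<lambda>p q. {fst p<..<snd p} \<inter> {fst q<..<snd q} = {}) (?E ` d)"
          unfolding pairwise_def
        proof (intro ballI impI)
          fix p q assume "p \<in> ?E ` d" "q \<in> ?E ` d" "p \<noteq> q"
          then obtain K K' where *: "K \<in> d" "K' \<in> d" "K \<noteq> K'" "p = ?E K" "q = ?E K'" by blast
          have "interior K \<inter> interior K' = {}" using division_ofD(5)[OF d *(1,2,3)] .
          moreover have "interior K = {Inf K<..<Sup K}"
            by (rule trans[OF arg_cong[OF K(1)[OF *(1)], of interior] interior_atLeastAtMost_real])
          moreover have "interior K' = {Inf K'<..<Sup K'}"
            by (rule trans[OF arg_cong[OF K(1)[OF *(2)], of interior] interior_atLeastAtMost_real])
          ultimately show "{fst p<..<snd p} \<inter> {fst q<..<snd q} = {}" unfolding *(4,5) by simp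
        qed
        have "(\<Sum>(u, v)\<in>?E ` d. v - u) = (\<Sum>K\<in>d. Henstock_Kurzweil_Integration.content K)"
        proof -
          have "Henstock_Kurzweil_Integration.content K = Sup K - Inf K" if "K \<in> d" for K
            using K(1,2)[OF that] content_real by metis
          then show ?thesis by (simp add: sum.reindex[OF inj])
        qed
        also have "\<dots> = v - u" using additive_content_division[OF d] uv(1) by simp
        finally show "(\<Sum>(u, v)\<in>?E ` d. v - u) < \<delta>" using uv(3) by simp
      qed
      finally show "(\<Sum>K\<in>d. norm (integral K g)) \<le> 1" by simp
    qed
    then show ?thesis by simp
  qed
  have "g absolutely_integrable_on {a..min b (a + real n * (\<delta> / 2))}" for n
  proof (induction n)
    case 0
    show ?case
    proof (cases "a \<le> b")
      case True then show ?thesis using short[of a a] \<delta>(1) by simp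
    qed simp
  next
    case (Suc n)
    define l where "l = a + real n * (\<delta> / 2)"
    have l': "a + real (Suc n) * (\<delta> / 2) = l + \<delta> / 2" unfolding l_def by (simp add: algebra_simps)
    have "a \<le> l" unfolding l_def using \<delta>(1) by simp
    let ?m = "min b l" and ?m' = "min b (l + \<delta> / 2)"
    show ?case
    proof (cases "a \<le> b")
      case True
      have "a \<le> ?m" "?m \<le> ?m'" "?m' \<le> b" "?m' - ?m < \<delta>" using True \<delta>(1) \<open>a \<le> l\<close> by auto
      moreover have "g absolutely_integrable_on {?m..?m'}"
        using calculation by (intro short) auto
      ultimately have "g absolutely_integrable_on {a..?m} \<union> {?m..?m'}"
        using Suc[folded l_def] absolutely_integrable_Un by blast
      moreover have "{a..?m} \<union> {?m..?m'} = {a..?m'}"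
        by (rule ivl_disj_un_two_touch(4)) (use \<open>a \<le> ?m\<close> \<open>?m \<le> ?m'\<close> in auto)
      ultimately show ?thesis unfolding l' by simp
    qed simp
  qed
  moreover obtain n where "(b - a) / (\<delta> / 2) < real n" using reals_Archimedean2 by blast
  then have "min b (a + real n * (\<delta> / 2)) = b" using \<delta>(1) by (auto simp: field_simps min_def)
  ultimately show ?thesis by metis
qed


lemma lipschitz_absolutely_continuous:
  assumes lip: "\<And>x y. x \<in> I \<Longrightarrow> y \<in> I \<Longrightarrow> norm (\<gamma> x - \<gamma> y) \<le> L * \<bar>x - y\<bar>" and L: "0 \<le> L"
  shows "absolutely_continuous_curve I \<gamma>"
  unfolding absolutely_continuous_curve_def
proof (intro allI impI)
  fix \<epsilon> :: real assume "0 < \<epsilon>"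
  show "\<exists>\<delta>>0. \<forall>D :: (real \<times> real) set.
        finite D \<and> (\<forall>(u, v)\<in>D. u \<le> v \<and> {u..v} \<subseteq> I) \<and>
        pairwise (\<lambda>p q. {fst p<..<snd p} \<inter> {fst q<..<snd q} = {}) D \<and>
        (\<Sum>(u, v)\<in>D. v - u) < \<delta>
        \<longrightarrow> (\<Sum>(u, v)\<in>D. norm (\<gamma> v - \<gamma> u)) < \<epsilon>"
  proof (intro exI[of _ "\<epsilon> / (L + 1)"] conjI allI impI)
    show "0 < \<epsilon> / (L + 1)" using \<open>0 < \<epsilon>\<close> L by simp
    fix D :: "(real \<times> real) set"
    assume D: "finite D \<and> (\<forall>(u, v)\<in>D. u \<le> v \<and> {u..v} \<subseteq> I) \<and>
        pairwise (\<lambda>p q. {fst p<..<snd p} \<inter> {fst q<..<snd q} = {}) D \<and> (\<Sum>(u, v)\<in>D. v - u) < \<epsilon> / (L + 1)"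
    have "(\<Sum>(u, v)\<in>D. norm (\<gamma> v - \<gamma> u)) \<le> (\<Sum>p\<in>D. (L + 1) * (case p of (u, v) \<Rightarrow> v - u))"
    proof (rule sum_mono)
      fix p assume "p \<in> D"
      obtain u v where p: "p = (u, v)" by (metis surj_pair)
      have "\<forall>(u, v)\<in>D. u \<le> v \<and> {u..v} \<subseteq> I" using D by blast
      from bspec[OF this \<open>p \<in> D\<close>] have uv: "u \<le> v" "{u..v} \<subseteq> I" by (simp_all add: p)
      then have "norm (\<gamma> v - \<gamma> u) \<le> L * \<bar>v - u\<bar>" by (intro lip) auto
      also have "\<dots> \<le> (L + 1) * (v - u)" using uv(1) L by (simp add: mult_right_mono)
      finally show "(case p of (u, v) \<Rightarrow> norm (\<gamma> v - \<gamma> u)) \<le> (L + 1) * (case p of (u, v) \<Rightarrow> v - u)" by (simp add: p)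
    qed
    also have "\<dots> = (L + 1) * (\<Sum>(u, v)\<in>D. v - u)" by (simp add: sum_distrib_left)
    also have "\<dots> < (L + 1) * (\<epsilon> / (L + 1))" using D L by (intro mult_strict_left_mono) auto
    also have "\<dots> = \<epsilon>" using L by simp
    finally show "(\<Sum>(u, v)\<in>D. norm (\<gamma> v - \<gamma> u)) < \<epsilon>" .
  qed
qed

section \<open>A steep point with tame increments\<close>

text \<open>
  The value 0 at points without derivative makes a Lipschitz constant a bound everywhere.
\<close>
definition rderiv :: "(real \<Rightarrow> real) \<Rightarrow> real \<Rightarrow> real" where
  "rderiv \<phi> t = (if \<phi> differentiable (at t) then deriv \<phi> t else 0)"

lemma rderiv_bound:
  assumes lip: "\<And>x y. \<bar>\<phi> x - \<phi> y\<bar> \<le> L * \<bar>x - y\<bar>"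
  shows "\<bar>rderiv \<phi> t\<bar> \<le> L"
proof (cases "\<phi> differentiable (at t)")
  case True
  then have "(\<phi> has_field_derivative deriv \<phi> t) (at t)"
    using DERIV_deriv_iff_real_differentiable by blast
  then have "((\<lambda>h. \<bar>(\<phi> (t + h) - \<phi> t) / h\<bar>) \<longlongrightarrow> \<bar>deriv \<phi> t\<bar>) (at 0)"
    unfolding DERIV_def by (intro tendsto_rabs)
  moreover have "eventually (\<lambda>h. \<bar>(\<phi> (t + h) - \<phi> t) / h\<bar> \<le> L) (at 0)"
    using lip[of "t + _" t] by (auto simp: eventually_at_filter abs_divide divide_le_eq)
  ultimately have "\<bar>deriv \<phi> t\<bar> \<le> L" by (rule tendsto_upperbound) simp
  then show ?thesis using True by (simp add: rderiv_def)
next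
  case False then show ?thesis using lip[of 1 0] abs_ge_zero[of "\<phi> 1 - \<phi> 0"] by (simp add: rderiv_def)
qed

lemma rderiv_has_integral:
  assumes lip: "\<And>x y. \<bar>\<phi> x - \<phi> y\<bar> \<le> L * \<bar>x - y\<bar>" and "a \<le> b"
  shows "(rderiv \<phi> has_integral (\<phi> b - \<phi> a)) {a..b}"
proof (rule absolutely_continuous_FTC[OF \<open>a \<le> b\<close> _ lipschitz_differentiable_AE[OF lip]])
  have "L \<ge> 0" using lip[of 1 0] abs_ge_zero[of "\<phi> 1 - \<phi> 0"] by simp
  then show "absolutely_continuous_curve {a..b} \<phi>"
    using lip by (intro lipschitz_absolutely_continuous[of _ _ L]) auto
  fix t assume "t \<in> {a..b} - {t. \<not> \<phi> differentiable (at t)}"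
  then have "(\<phi> has_field_derivative rderiv \<phi> t) (at t)"
    using DERIV_deriv_iff_real_differentiable by (auto simp: rderiv_def)
  then show "(\<phi> has_vector_derivative rderiv \<phi> t) (at t within {a..b})"
    using has_real_derivative_iff_has_vector_derivative has_vector_derivative_at_within by blast
qed

lemma rderiv_abs_integrable:
  assumes lip: "\<And>x y. \<bar>\<phi> x - \<phi> y\<bar> \<le> L * \<bar>x - y\<bar>"
  shows "(\<lambda>t. \<bar>rderiv \<phi> t\<bar>) integrable_on {a..b}"
proof (cases "a \<le> b")
  case True
  have "rderiv \<phi> absolutely_integrable_on {a..b}"
  proof (rule absolutely_integrable_integrable_bound[where g = "\<lambda>_. L"])
    show "rderiv \<phi> integrable_on {a..b}" using rderiv_has_integral[OF lip True] by (auto simp: integrable_on_def)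
    show "norm (rderiv \<phi> x) \<le> L" for x unfolding real_norm_def by (rule rderiv_bound[OF lip])
    show "(\<lambda>_. L) integrable_on {a..b}" by (rule integrable_const_ivl)
  qed
  then show ?thesis by (simp add: absolutely_integrable_on_def)
next
  case False then show ?thesis by (simp add: integrable_on_empty)
qed

lemma increment_le_integral_rderiv:
  assumes lip: "\<And>x y. \<bar>\<phi> x - \<phi> y\<bar> \<le> L * \<bar>x - y\<bar>" and "a \<le> b"
  shows "\<bar>\<phi> b - \<phi> a\<bar> \<le> integral {a..b} (\<lambda>t. \<bar>rderiv \<phi> t\<bar>)"
proof -
  have "norm (integral {a..b} (rderiv \<phi>)) \<le> integral {a..b} (\<lambda>t. \<bar>rderiv \<phi> t\<bar>)"
    using rderiv_has_integral[OF lip \<open>a \<le> b\<close>] rderiv_abs_integrable[OF lip]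
    by (intro integral_norm_bound_integral) (auto simp: integrable_on_def)
  then show ?thesis using rderiv_has_integral[OF lip \<open>a \<le> b\<close>] by (simp add: integral_unique)
qed

text \<open>
  A superlevel set of the maximal difference quotient over increments of all sizes.
\<close>
definition steep_set :: "(real \<Rightarrow> real) \<Rightarrow> real \<Rightarrow> real set" where
  "steep_set \<phi> \<mu> = {t. \<exists>u. \<mu> * \<bar>u\<bar> < \<bar>\<phi> (t + u) - \<phi> t\<bar>}"

lemma open_steep_set:
  assumes "continuous_on UNIV \<phi>" shows "open (steep_set \<phi> \<mu>)"
proof -
  have "steep_set \<phi> \<mu> = (\<Union>u. {t. \<mu> * \<bar>u\<bar> < \<bar>\<phi> (t + u) - \<phi> t\<bar>})" unfolding steep_set_def by auto
  moreover have "open {t. \<mu> * \<bar>u\<bar> < \<bar>\<phi> (t + u) - \<phi> t\<bar>}" for u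
  proof (rule open_Collect_less)
    have "continuous_on UNIV (\<lambda>t. \<phi> (t + u))"
      by (rule continuous_on_compose2[OF assms]) (auto intro!: continuous_intros)
    then show "continuous_on UNIV (\<lambda>t. \<bar>\<phi> (t + u) - \<phi> t\<bar>)" by (intro continuous_intros assms)
  qed (intro continuous_intros)
  ultimately show ?thesis by auto
qed

text \<open>
  The weak type (1,1) estimate for the maximal difference quotient. Over an interval whose increment
  exceeds mu times its length, |phi'| has integral at least mu times the length. The covering
  lemma selects disjoint intervals of this kind whose fivefold enlargements cover the set. As phi
  vanishes outside [-s, s], the intervals can be cut off there.
\<close>
lemma steep_set_measure:
  fixes \<phi> :: "real \<Rightarrow> real"
  assumes lip: "\<And>x y. \<bar>\<phi> x - \<phi> y\<bar> \<le> L * \<bar>x - y\<bar>" and zero: "\<And>t. s \<le> \<bar>t\<bar> \<Longrightarrow> \<phi> t = 0"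
    and "0 < s" "0 < \<mu>"
  shows "steep_set \<phi> \<mu> \<inter> {-s..s} \<in> lmeasurable"
    and "measure lebesgue (steep_set \<phi> \<mu> \<inter> {-s..s}) \<le> 5 * integral {-s..s} (\<lambda>t. \<bar>rderiv \<phi> t\<bar>) / \<mu>"
proof -
  have L: "L \<ge> 0" using lip[of 1 0] abs_ge_zero[of "\<phi> 1 - \<phi> 0"] by simp
  have cont: "continuous_on UNIV \<phi>"
    by (rule lipschitz_on_continuous_on[of L]) (use lip L in \<open>auto simp: lipschitz_on_def dist_real_def\<close>)
  show meas: "steep_set \<phi> \<mu> \<inter> {-s..s} \<in> lmeasurable"
    using open_steep_set[OF cont]
    by (intro bounded_set_imp_lmeasurable) (auto simp: bounded_Int)
  define A where "A t = \<bar>rderiv \<phi> t\<bar>" for t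
  define I where "I = integral {-s..s} A"
  have intA: "A integrable_on {a..b}" for a b unfolding A_def by (rule rderiv_abs_integrable[OF lip])
  have key: "\<mu> * (y - x) \<le> integral ({x..y} \<inter> {-s..s}) A" if "x < y" "\<mu> * (y - x) < \<bar>\<phi> y - \<phi> x\<bar>" for x y
  proof -
    \<comment> \<open>Moving an end point into [-s, s] does not change the value of phi.\<close>
    define cl where "cl t = max (-s) (min s t)" for t
    have cl: "\<phi> (cl t) = \<phi> t" for t using zero[of t] zero[of "cl t"] \<open>0 < s\<close> unfolding cl_def by (cases "\<bar>t\<bar> < s") auto
    have "cl x \<le> cl y" using that(1) unfolding cl_def by auto
    moreover have "cl x \<noteq> cl y"
    proof
      assume "cl x = cl y"
      then have "\<phi> x = \<phi> y" using cl by metis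
      moreover have "0 < \<mu> * (y - x)" using that(1) \<open>0 < \<mu>\<close> by (intro mult_pos_pos) auto
      ultimately show False using that(2) by simp
    qed
    ultimately have lt: "cl x < cl y" by simp
    then have eq: "{x..y} \<inter> {-s..s} = {cl x..cl y}" unfolding cl_def by auto
    have "\<bar>\<phi> (cl y) - \<phi> (cl x)\<bar> \<le> integral {cl x..cl y} A"
      unfolding A_def using lt by (intro increment_le_integral_rderiv[OF lip]) simp
    then show ?thesis unfolding eq cl using that(2) by linarith
  qed
  have bound: "\<mu> * \<bar>y - x\<bar> \<le> 2 * (L * s)" if "\<mu> * \<bar>y - x\<bar> < \<bar>\<phi> y - \<phi> x\<bar>" for x y
  proof -
    have "\<bar>\<phi> t\<bar> \<le> L * s" for t
    proof (cases "\<bar>t\<bar> < s")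
      case True
      have "\<bar>\<phi> t - \<phi> s\<bar> \<le> L * \<bar>t - s\<bar> \<and> \<bar>\<phi> t - \<phi> (-s)\<bar> \<le> L * \<bar>t + s\<bar>" using lip[of t s] lip[of t "-s"] by simp
      moreover have "\<phi> s = 0" "\<phi> (-s) = 0" using zero \<open>0 < s\<close> by auto
      moreover have "\<bar>t - s\<bar> \<le> s \<or> \<bar>t + s\<bar> \<le> s" using True by auto
      moreover have "L * \<bar>t - s\<bar> \<le> L * s \<or> L * \<bar>t + s\<bar> \<le> L * s"
        using calculation(4) mult_left_mono[OF _ L] by blast
      ultimately show ?thesis by linarith
    next
      case False then show ?thesis using zero[of t] L \<open>0 < s\<close> by simp
    qed
    from this[of x] this[of y] show ?thesis using that by linarith
  qed
  define K where "K = {(x, y). x < y \<and> \<mu> * (y - x) < \<bar>\<phi> y - \<phi> x\<bar>}"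
  let ?m = "\<lambda>p::real \<times> real. (fst p + snd p) / 2" and ?r = "\<lambda>p::real \<times> real. (snd p - fst p) / 2"
  have cov: "steep_set \<phi> \<mu> \<inter> {-s..s} \<subseteq> (\<Union>p\<in>K. cball (?m p) (?r p))"
  proof
    fix t assume "t \<in> steep_set \<phi> \<mu> \<inter> {-s..s}"
    then obtain u where u: "\<mu> * \<bar>u\<bar> < \<bar>\<phi> (t + u) - \<phi> t\<bar>" unfolding steep_set_def by auto
    then have "u \<noteq> 0" by auto
    define x y where "x = min t (t + u)" and "y = max t (t + u)"
    have xy: "x < y" "y - x = \<bar>u\<bar>" "\<bar>\<phi> y - \<phi> x\<bar> = \<bar>\<phi> (t + u) - \<phi> t\<bar>" "t \<in> {x..y}"
      using \<open>u \<noteq> 0\<close> unfolding x_def y_def by (auto simp: min_def max_def)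
    then have "(x, y) \<in> K" using u unfolding K_def by simp
    moreover have "t \<in> cball (?m (x, y)) (?r (x, y))" using closed_interval_cball[of x y] xy by simp
    ultimately show "t \<in> (\<Union>p\<in>K. cball (?m p) (?r p))" by blast
  qed
  have rad: "0 < ?r p \<and> ?r p \<le> L * s / \<mu>" if "p \<in> K" for p
  proof -
    have p: "fst p < snd p" "\<mu> * (snd p - fst p) < \<bar>\<phi> (snd p) - \<phi> (fst p)\<bar>" using that unfolding K_def by auto
    then have "\<mu> * \<bar>snd p - fst p\<bar> \<le> 2 * (L * s)" by (intro bound) simp
    then have "\<mu> * ((snd p - fst p) / 2) \<le> L * s" using p(1) by simp
    then show ?thesis using p(1) \<open>0 < \<mu>\<close> by (simp add: pos_le_divide_eq mult.commute)
  qed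
  obtain C where C: "countable C" "C \<subseteq> K"
     "pairwise (\<lambda>i j. disjnt (cball (?m i) (?r i)) (cball (?m j) (?r j))) C"
     "steep_set \<phi> \<mu> \<inter> {-s..s} \<subseteq> (\<Union>i\<in>C. cball (?m i) (5 * ?r i))"
    by (rule Vitali_covering_lemma_cballs[OF cov rad], assumption) (rule that)
  have fin: "measure lebesgue (\<Union>i\<in>C'. cball (?m i) (5 * ?r i)) \<le> 5 * I / \<mu>" if C': "C' \<subseteq> C" "finite C'" for C'
  proof -
    have "measure lebesgue (\<Union>i\<in>C'. cball (?m i) (5 * ?r i)) \<le> (\<Sum>i\<in>C'. measure lebesgue (cball (?m i) (5 * ?r i)))"
      by (rule measure_UNION_le) (use C' in auto)
    also have "\<dots> \<le> (\<Sum>i\<in>C'. 5 / \<mu> * integral ({fst i..snd i} \<inter> {-s..s}) A)"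
    proof (rule sum_mono)
      fix i assume "i \<in> C'"
      then have i: "fst i < snd i" "\<mu> * (snd i - fst i) < \<bar>\<phi> (snd i) - \<phi> (fst i)\<bar>" using C' C(2) unfolding K_def by auto
      have "measure lebesgue (cball (?m i) (5 * ?r i)) = 5 * (snd i - fst i)"
        using i(1) by (simp add: cball_eq_atLeastAtMost field_simps)
      also have "\<dots> = 5 / \<mu> * (\<mu> * (snd i - fst i))" using \<open>0 < \<mu>\<close> by simp
      also have "\<dots> \<le> 5 / \<mu> * integral ({fst i..snd i} \<inter> {-s..s}) A"
        using key[OF i] \<open>0 < \<mu>\<close> by (intro mult_left_mono) auto
      finally show "measure lebesgue (cball (?m i) (5 * ?r i)) \<le> 5 / \<mu> * integral ({fst i..snd i} \<inter> {-s..s}) A" .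
    qed
    also have "\<dots> = 5 / \<mu> * (\<Sum>i\<in>C'. integral {-s..s} (\<lambda>t. if t \<in> {fst i..snd i} then A t else 0))"
      unfolding sum_distrib_left integral_restrict_Int by (simp only: Int_commute)
    also have "(\<Sum>i\<in>C'. integral {-s..s} (\<lambda>t. if t \<in> {fst i..snd i} then A t else 0))
        = integral {-s..s} (\<lambda>t. \<Sum>i\<in>C'. if t \<in> {fst i..snd i} then A t else 0)"
      using C'(2) intA
      by (intro Henstock_Kurzweil_Integration.integral_sum[symmetric])
         (simp_all only: integrable_restrict_Int Int_atLeastAtMost)
    also have "\<dots> \<le> I"
      unfolding I_def
    proof (rule integral_le)
      show "(\<lambda>t. \<Sum>i\<in>C'. if t \<in> {fst i..snd i} then A t else 0) integrable_on {-s..s}"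
        using C'(2) intA
        by (intro Henstock_Kurzweil_Integration.integrable_sum) (simp_all only: integrable_restrict_Int Int_atLeastAtMost)
      show "A integrable_on {-s..s}" by (rule intA)
      fix t
      show "(\<Sum>i\<in>C'. if t \<in> {fst i..snd i} then A t else 0) \<le> A t"
      proof (cases "\<exists>i\<in>C'. t \<in> {fst i..snd i}")
        case True
        then obtain i where i: "i \<in> C'" "t \<in> {fst i..snd i}" by blast
        have "t \<notin> {fst j..snd j}" if "j \<in> C'" "j \<noteq> i" for j
        proof
          assume j: "t \<in> {fst j..snd j}"
          have "cball (?m i) (?r i) = {fst i..snd i}" "cball (?m j) (?r j) = {fst j..snd j}"
            using i j by (auto intro!: closed_interval_cball)
          moreover have "disjnt (cball (?m i) (?r i)) (cball (?m j) (?r j))"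
            by (rule pairwiseD[OF C(3)]) (use C' i that in auto)
          ultimately show False using i j unfolding disjnt_def by blast
        qed
        then have "(\<Sum>j\<in>C'. if t \<in> {fst j..snd j} then A t else 0) = (\<Sum>j\<in>C'. if j = i then A t else 0)"
          using i by (intro sum.cong) auto
        then show ?thesis using i(1) C'(2) by simp
      next
        case False
        then have "(\<Sum>i\<in>C'. if t \<in> {fst i..snd i} then A t else 0) = 0" by (intro sum.neutral) auto
        then show ?thesis by (simp add: A_def)
      qed
    qed
    finally show ?thesis using \<open>0 < \<mu>\<close> by (simp add: divide_right_mono mult_left_mono)
  qed
  have "measure lebesgue (steep_set \<phi> \<mu> \<inter> {-s..s}) \<le> measure lebesgue (\<Union>i\<in>C. cball (?m i) (5 * ?r i))"
    using C(4) meas fmeasurable_UN_bound[OF C(1) _ fin] by (intro measure_mono_fmeasurable) (auto intro: fmeasurableD)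
  also have "\<dots> \<le> 5 * I / \<mu>" by (rule measure_UN_bound[OF C(1) _ fin]) auto
  finally show "measure lebesgue (steep_set \<phi> \<mu> \<inter> {-s..s}) \<le> 5 * integral {-s..s} (\<lambda>t. \<bar>rderiv \<phi> t\<bar>) / \<mu>"
    unfolding I_def A_def .
qed

text \<open>
  A bump of height d on [-s, s] has slope of order d / s somewhere. The claim is that a point of such
  slope g exists from which the increments at every scale are of order sqrt (L g) only. If not,
  every point whose slope lies between L / 4^(k+1) and L / 4^k is in the steep set of level
  mu k = 40 L / 2^k, which has measure at most 5 I / mu k, where I >= 2 d is the integral of
  |phi'|. The positive part of phi' integrates over these points to at most
  (I / 8) (1 + 1/2 + 1/4 + ...) = I / 4. Points of slope below d / (16 s) and points within
  d / (16 L) of the ends contribute at most d / 8 each. Altogether this is less than I / 2, the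
  integral of the positive part of phi'.
\<close>
theorem steep_but_tame_point:
  fixes \<phi> :: "real \<Rightarrow> real"
  assumes lip: "\<And>x y. \<bar>\<phi> x - \<phi> y\<bar> \<le> L * \<bar>x - y\<bar>" and zero: "\<And>t. s \<le> \<bar>t\<bar> \<Longrightarrow> \<phi> t = 0"
    and d: "0 < d" "d \<le> \<bar>\<phi> \<zeta>\<bar>" and F: "finite F"
  obtains \<tau> g where "\<bar>\<tau>\<bar> \<le> s - d / (16 * L)" "\<tau> \<notin> F" "(\<phi> has_real_derivative g) (at \<tau>)"
    "d / (16 * s) \<le> g" "\<And>u. \<bar>\<phi> (\<tau> + u) - \<phi> \<tau>\<bar> \<le> 80 * sqrt (L * g) * \<bar>u\<bar>"
proof (rule ccontr)
  note point = that
  assume nothesis: "\<not> thesis"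
  have \<zeta>: "\<bar>\<zeta>\<bar> < s" using zero[of \<zeta>] d by fastforce
  then have s: "0 < s" by linarith
  have L: "0 < L"
  proof -
    have "d \<le> L * \<bar>\<zeta> - s\<bar>" using lip[of \<zeta> s] zero[of s] d s by simp
    then show ?thesis using d mult_nonpos_nonneg[of L "\<bar>\<zeta> - s\<bar>"] by (cases "0 < L") auto
  qed
  define c0 where "c0 = d / (16 * s)"
  define \<sigma> where "\<sigma> = d / (16 * L)"
  have c0: "c0 > 0" and \<sigma>: "\<sigma> > 0" using d s L by (auto simp: c0_def \<sigma>_def)
  define D where "D = rderiv \<phi>"
  define I where "I = integral {-s..s} (\<lambda>t. \<bar>D t\<bar>)"
  have intA: "(\<lambda>t. \<bar>D t\<bar>) integrable_on {a..b}" for a b unfolding D_def by (rule rderiv_abs_integrable[OF lip])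
  have intD: "(D has_integral (\<phi> b - \<phi> a)) {a..b}" if "a \<le> b" for a b unfolding D_def by (rule rderiv_has_integral[OF lip that])
  have DL: "\<bar>D t\<bar> \<le> L" for t unfolding D_def by (rule rderiv_bound[OF lip])
  have I: "2 * d \<le> I"
  proof -
    have "\<bar>\<phi> \<zeta> - \<phi> (-s)\<bar> \<le> integral {-s..\<zeta>} (\<lambda>t. \<bar>D t\<bar>)" "\<bar>\<phi> s - \<phi> \<zeta>\<bar> \<le> integral {\<zeta>..s} (\<lambda>t. \<bar>D t\<bar>)"
    proof -
      have z: "-s \<le> \<zeta>" "\<zeta> \<le> s" using \<zeta> by auto
      show "\<bar>\<phi> \<zeta> - \<phi> (-s)\<bar> \<le> integral {-s..\<zeta>} (\<lambda>t. \<bar>D t\<bar>)"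
        unfolding D_def by (rule increment_le_integral_rderiv[OF lip z(1)])
      show "\<bar>\<phi> s - \<phi> \<zeta>\<bar> \<le> integral {\<zeta>..s} (\<lambda>t. \<bar>D t\<bar>)"
        unfolding D_def by (rule increment_le_integral_rderiv[OF lip z(2)])
    qed
    moreover have "integral {-s..\<zeta>} (\<lambda>t. \<bar>D t\<bar>) + integral {\<zeta>..s} (\<lambda>t. \<bar>D t\<bar>) = I"
      unfolding I_def using \<zeta> intA by (intro Henstock_Kurzweil_Integration.integral_combine) auto
    moreover have "\<phi> s = 0" "\<phi> (-s) = 0" using zero s by auto
    ultimately show ?thesis using d(2) by linarith
  qed
  \<comment> \<open>The positive part of the derivative, whose integral is I / 2 because the integral of D vanishes.\<close>
  define h where "h t = (\<bar>D t\<bar> + D t) / 2" for t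
  have hint: "(h has_integral (I / 2)) {-s..s}"
  proof -
    have "((\<lambda>t. \<bar>D t\<bar>) has_integral I) {-s..s}" unfolding I_def using intA by (rule integrable_integral)
    from has_integral_add[OF this intD[of "-s" s]] have "((\<lambda>t. \<bar>D t\<bar> + D t) has_integral I) {-s..s}"
      using zero s by simp
    from has_integral_divide[OF this, of 2] show ?thesis unfolding h_def .
  qed
  obtain m where m: "(1/4)^m < c0 / L" using real_arch_pow_inv[of "c0 / L" "1/4"] c0 L by auto
  define \<mu> where "\<mu> k = 40 * L * (1/2)^k" for k :: nat
  have \<mu>: "\<mu> k > 0" for k unfolding \<mu>_def using L by simp
  define B where "B k = steep_set \<phi> (\<mu> k) \<inter> {-s..s}" for k
  have B: "B k \<in> lmeasurable" "measure lebesgue (B k) \<le> 5 * I / \<mu> k" for k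
    using steep_set_measure[OF lip zero s \<mu>, of k] unfolding B_def I_def D_def by auto
  define ends where "ends = {-s..-s+\<sigma>} \<union> {s-\<sigma>..s}"
  define Z where "Z = {t. \<not> \<phi> differentiable (at t)} \<union> F"
  have "negligible Z" unfolding Z_def by (rule negligible_Un[OF lipschitz_differentiable_AE[OF lip] negligible_finite[OF F]])
  \<comment> \<open>A bound for the positive part: slopes below c0, the two ends, and the steep sets by dyadic level.\<close>
  define R where "R t = c0 + L * indicat_real ends t + (\<Sum>k<m. L * (1/4)^k * indicat_real (B k) t)" for t
  have hR: "h t \<le> R t" if t: "t \<in> {-s..s} - Z" for t
  proof -
    have nn: "0 \<le> (\<Sum>k<m. L * (1/4)^k * indicat_real (B k) t)" using L by (intro sum_nonneg) auto
    consider "D t \<le> c0" | "t \<in> ends" | "D t > c0" "t \<notin> ends" by linarith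
    then show ?thesis
    proof cases
      case 1
      then have "h t \<le> c0" unfolding h_def using c0 by auto
      then show ?thesis using nn L unfolding R_def by (simp add: add_increasing2)
    next
      case 2
      have "h t \<le> L" unfolding h_def using DL[of t] abs_ge_self[of "D t"] by (simp add: field_simps)
      then show ?thesis using nn c0 2 unfolding R_def by simp
    next
      case 3
      have df: "(\<phi> has_real_derivative D t) (at t)"
        using t DERIV_deriv_iff_real_differentiable unfolding Z_def D_def by (auto simp: rderiv_def)
      have "\<bar>t\<bar> \<le> s - d / (16 * L)" using t 3(2) unfolding ends_def \<sigma>_def by auto
      moreover have "t \<notin> F" using t unfolding Z_def by blast
      moreover have "d / (16 * s) \<le> D t" using 3(1) unfolding c0_def by simp
      ultimately obtain u where u: "80 * sqrt (L * D t) * \<bar>u\<bar> < \<bar>\<phi> (t + u) - \<phi> t\<bar>"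
        using point[OF _ _ df] nothesis not_le by blast
      define k where "k = (LEAST k. L * (1/4)^(k+1) \<le> D t)"
      have "0 < m" using m c0 3(1) DL[of t] L by (cases m) (auto simp: field_simps)
      have ex: "L * (1/4)^(m - 1 + 1) \<le> D t"
      proof -
        have "L * (1/4)^m < c0" using m L by (simp add: pos_less_divide_eq mult.commute)
        then show ?thesis using \<open>0 < m\<close> 3(1) by simp
      qed
      have k1: "L * (1/4)^(k+1) \<le> D t" unfolding k_def by (rule LeastI[of "\<lambda>k. L * (1/4)^(k+1) \<le> D t", OF ex])
      have "k \<le> m - 1" unfolding k_def by (rule Least_le) (rule ex)
      then have km: "k < m" using \<open>0 < m\<close> by linarith
      have k2: "D t \<le> L * (1/4)^k"
      proof (cases k)
        case 0 then show ?thesis using DL[of t] by simp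
      next
        case (Suc j)
        then have "\<not> L * (1/4)^(j+1) \<le> D t"
          using not_less_Least[of j "\<lambda>k. L * (1/4)^(k+1) \<le> D t"] k_def by simp
        then show ?thesis using Suc by simp
      qed
      have "\<mu> k = 80 * sqrt (L * (L * (1/4)^(k+1)))"
      proof -
        have "L * (L * (1/4)^(k+1)) = (L * (1/2)^(k+1))\<^sup>2"
          by (simp add: power2_eq_square power_mult_distrib[symmetric] mult.assoc mult.left_commute)
        then show ?thesis unfolding \<mu>_def using L by (simp add: real_sqrt_unique)
      qed
      also have "\<dots> \<le> 80 * sqrt (L * D t)" using k1 L by simp
      finally have "\<mu> k * \<bar>u\<bar> < \<bar>\<phi> (t + u) - \<phi> t\<bar>" using u by (meson abs_ge_zero le_less_trans mult_right_mono)
      then have "t \<in> B k" using t unfolding B_def steep_set_def by auto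
      then have "L * (1/4)^k \<le> (\<Sum>k<m. L * (1/4)^k * indicat_real (B k) t)"
        using km L member_le_sum[of k "{..<m}" "\<lambda>k. L * (1/4)^k * indicat_real (B k) t"] by auto
      moreover have "h t = D t" unfolding h_def using 3 c0 by simp
      ultimately show ?thesis using k2 c0 L unfolding R_def by (simp add: add_increasing)
    qed
  qed
  have endsm: "ends \<inter> {-s..s} \<in> lmeasurable" "measure lebesgue (ends \<inter> {-s..s}) \<le> 2 * \<sigma>"
  proof -
    show "ends \<inter> {-s..s} \<in> lmeasurable" unfolding ends_def by (intro bounded_set_imp_lmeasurable) (auto simp: bounded_Int)
    have "measure lebesgue (ends \<inter> {-s..s}) \<le> measure lebesgue ends"
      unfolding ends_def by (intro measure_mono_fmeasurable) (auto intro!: fmeasurable.Un)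
    also have "\<dots> \<le> measure lebesgue {-s..-s+\<sigma>} + measure lebesgue {s-\<sigma>..s}"
      unfolding ends_def by (intro measure_Un_le) auto
    finally show "measure lebesgue (ends \<inter> {-s..s}) \<le> 2 * \<sigma>" using \<sigma> by simp
  qed
  have BI: "B k \<inter> {-s..s} = B k" for k unfolding B_def by auto
  have Rint: "(R has_integral (2 * s * c0 + L * measure lebesgue (ends \<inter> {-s..s})
      + (\<Sum>k<m. L * (1/4)^k * measure lebesgue (B k)))) {-s..s}"
    unfolding R_def
  proof (intro has_integral_add has_integral_sum has_integral_mult_right)
    show "((\<lambda>t. c0) has_integral 2 * s * c0) {-s..s}" using has_integral_const_real[of c0 "-s" s] s by simp
    show "(indicat_real ends has_integral measure lebesgue (ends \<inter> {-s..s})) {-s..s}"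
      using integrable_on_indicator[of ends "{-s..s}"] endsm(1) Equivalence_Lebesgue_Henstock_Integration.integral_indicator[OF endsm(1)]
      by (metis integrable_integral)
    show "(indicat_real (B k) has_integral measure lebesgue (B k)) {-s..s}" for k
      using integrable_on_indicator[of "B k" "{-s..s}"] B(1)[of k] Equivalence_Lebesgue_Henstock_Integration.integral_indicator[of "B k" "{-s..s}"] BI[of k]
      by (metis integrable_integral)
  qed simp
  have "((\<lambda>t. if t \<in> Z then R t else h t) has_integral (I / 2)) {-s..s}"
    by (rule has_integral_spike[OF \<open>negligible Z\<close> _ hint]) auto
  from has_integral_le[OF this Rint] hR
  have "I / 2 \<le> 2 * s * c0 + L * measure lebesgue (ends \<inter> {-s..s}) + (\<Sum>k<m. L * (1/4)^k * measure lebesgue (B k))"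
    by (simp split: if_splits)
  moreover have "2 * s * c0 = d / 8" unfolding c0_def using s by simp
  moreover have "L * measure lebesgue (ends \<inter> {-s..s}) \<le> d / 8"
  proof -
    have "L * measure lebesgue (ends \<inter> {-s..s}) \<le> L * (2 * \<sigma>)" using endsm(2) L by (intro mult_left_mono) auto
    also have "\<dots> = d / 8" unfolding \<sigma>_def using L by simp
    finally show ?thesis .
  qed
  moreover have "(\<Sum>k<m. L * (1/4)^k * measure lebesgue (B k)) \<le> I / 4"
  proof -
    have "I \<ge> 0" using I d by linarith
    have "(\<Sum>k<m. L * (1/4)^k * measure lebesgue (B k)) \<le> (\<Sum>k<m. (I / 8) * (1/2)^k)"
    proof (rule sum_mono)
      fix k
      have "L * (1/4)^k * measure lebesgue (B k) \<le> L * (1/4)^k * (5 * I / \<mu> k)" using B(2)[of k] L by (intro mult_left_mono) auto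
      also have "\<dots> = (I / 8) * (1/2)^k"
      proof -
        have "(1/4::real)^k = (1/2)^k * (1/2)^k" by (simp add: power_mult_distrib[symmetric])
        then show ?thesis unfolding \<mu>_def using L by (simp add: field_simps)
      qed
      finally show "L * (1/4)^k * measure lebesgue (B k) \<le> (I / 8) * (1/2)^k" .
    qed
    also have "\<dots> = (I / 8) * (\<Sum>k<m. (1/2)^k)" by (simp add: sum_distrib_left)
    also have "\<dots> \<le> (I / 8) * 2" using \<open>I \<ge> 0\<close> by (intro mult_left_mono) (simp_all add: geometric_sum)
    finally show ?thesis by simp
  qed
  ultimately show False using I d by linarith
qed


section \<open>Horizontal curves and the Carnot-Caratheodory distance\<close>

text \<open>
  A point is split into its horizontal part z in R^2n and its vertical part c. With rot the
  multiplication by i on R^2n = C^n and sform the standard symplectic form, the group law becomes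
  (z, c) (z', c') = (z + z', c + c' - 2 sform z z').
\<close>
type_synonym 'n hvec = "(real^'n) \<times> (real^'n)"

abbreviation hmul :: "('n::finite) heis \<Rightarrow> 'n heis \<Rightarrow> 'n heis" (infixl "\<odot>" 70) where
  "x \<odot> y \<equiv> heis_mult x y"

definition mk :: "('n::finite) hvec \<Rightarrow> real \<Rightarrow> 'n heis" where "mk z c = (fst z, snd z, c)"
definition hpart :: "('n::finite) heis \<Rightarrow> 'n hvec" where "hpart x = (fst x, fst (snd x))"
definition vpart :: "('n::finite) heis \<Rightarrow> real" where "vpart x = snd (snd x)"
abbreviation hor :: "('n::finite) hvec \<Rightarrow> 'n heis" where "hor v \<equiv> mk v 0"
definition rot :: "('n::finite) hvec \<Rightarrow> 'n hvec" where "rot z = (- snd z, fst z)"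
definition sform :: "('n::finite) hvec \<Rightarrow> 'n hvec \<Rightarrow> real" where "sform z w = rot z \<bullet> w"

lemma mk_parts [simp]: "hpart (mk z c) = z" "vpart (mk z c) = c" "mk (hpart x) (vpart x) = x"
  by (simp_all add: mk_def hpart_def vpart_def)

lemma parts_zero [simp]: "hpart 0 = 0" "vpart 0 = 0"
  by (simp_all add: hpart_def vpart_def zero_prod_def)

lemma mk_inject [simp]: "mk z c = mk z' c' \<longleftrightarrow> z = z' \<and> c = c'"
  by (auto simp: mk_def prod_eq_iff)

lemma sform_simps:
  "sform (z + z') w = sform z w + sform z' w" "sform z (w + w') = sform z w + sform z w'"
  "sform (z - z') w = sform z w - sform z' w" "sform z (w - w') = sform z w - sform z w'"
  "sform (- z) w = - sform z w" "sform z (- w) = - sform z w"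
  "sform (r *\<^sub>R z) w = r * sform z w" "sform z (r *\<^sub>R w) = r * sform z w"
  "sform 0 w = 0" "sform z 0 = 0" "sform z z = 0"
  by (simp_all add: sform_def rot_def inner_prod_def inner_add_left inner_add_right inner_diff_left inner_diff_right algebra_simps inner_commute)

lemma sform_swap: "sform z w = - sform w z"
  by (simp add: sform_def rot_def inner_prod_def inner_commute)

lemma norm_rot [simp]: "norm (rot z) = norm z"
  by (simp add: rot_def norm_prod_def add.commute)

lemma sform_rot: "sform z (rot w) = z \<bullet> w"
  by (simp add: sform_def rot_def inner_prod_def)

lemma abs_sform_le: "\<bar>sform z w\<bar> \<le> norm z * norm w"
  unfolding sform_def using Cauchy_Schwarz_ineq2[of "rot z" w] by simp

lemma mk_mult [simp]: "mk z c \<odot> mk z' c' = mk (z + z') (c + c' - 2 * sform z z')"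
  by (simp add: mk_def sform_def rot_def inner_prod_def)

lemma inv_mk [simp]: "heis_inv (mk z c) = mk (- z) (- c)"
  by (simp add: mk_def)

lemma mk_zero: "mk 0 0 = 0" by (simp add: mk_def zero_prod_def)

lemma mult_zero_right [simp]: "x \<odot> 0 = x" by (rule heis_mult_zero)

lemma inv_mult_cancel [simp]: "heis_inv x \<odot> (x \<odot> y) = y" "x \<odot> (heis_inv x \<odot> y) = y"
  by (simp_all add: heis_mult_assoc[symmetric] heis_mult_inv heis_mult_zero)

lemma mult_mk: "x \<odot> mk z c = mk (hpart x + z) (vpart x + c - 2 * sform (hpart x) z)"
  using mk_mult[of "hpart x" "vpart x" z c] by simp

lemma hpart_mult [simp]: "hpart (x \<odot> y) = hpart x + hpart y"
  using mult_mk[of x "hpart y" "vpart y"] by simp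

lemma hpart_inv [simp]: "hpart (heis_inv x) = - hpart x"
  using inv_mk[of "hpart x" "vpart x"] by simp

lemma bounded_linear_hpart: "bounded_linear hpart"
  unfolding hpart_def
  by (intro bounded_linear_Pair bounded_linear_fst bounded_linear_compose[OF bounded_linear_fst bounded_linear_snd])

lemma bounded_linear_vpart: "bounded_linear vpart"
  unfolding vpart_def
  by (intro bounded_linear_compose[OF bounded_linear_snd bounded_linear_snd])

lemma continuous_on_hpart [continuous_intros]: "continuous_on S g \<Longrightarrow> continuous_on S (\<lambda>t. hpart (g t))"
  using bounded_linear.continuous_on[OF bounded_linear_hpart] .
lemma continuous_on_vpart [continuous_intros]: "continuous_on S g \<Longrightarrow> continuous_on S (\<lambda>t. vpart (g t))"
  using bounded_linear.continuous_on[OF bounded_linear_vpart] .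
lemma continuous_on_mk [continuous_intros]:
  "continuous_on S g \<Longrightarrow> continuous_on S h \<Longrightarrow> continuous_on S (\<lambda>t. mk (g t) (h t))"
  unfolding mk_def by (intro continuous_intros)
lemma continuous_on_rot [continuous_intros]: "continuous_on S g \<Longrightarrow> continuous_on S (\<lambda>t. rot (g t))"
  unfolding rot_def by (intro continuous_intros)
lemma continuous_on_sform [continuous_intros]:
  "continuous_on S g \<Longrightarrow> continuous_on S h \<Longrightarrow> continuous_on S (\<lambda>t. sform (g t) (h t))"
  unfolding sform_def by (intro continuous_intros)
lemma continuous_on_hmul [continuous_intros]:
  assumes "continuous_on S g" "continuous_on S h" shows "continuous_on S (\<lambda>t. g t \<odot> h t)"
proof -
  have "g t \<odot> h t = mk (hpart (g t) + hpart (h t)) (vpart (g t) + vpart (h t) - 2 * sform (hpart (g t)) (hpart (h t)))" for t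
    using mult_mk[of "g t" "hpart (h t)" "vpart (h t)"] by simp
  then show ?thesis by (simp, intro continuous_intros assms)
qed

lemma norm_mk_le: "norm (mk z c) \<le> norm z + \<bar>c\<bar>"
proof -
  have "mk z c = mk z 0 + mk 0 c" by (simp add: mk_def)
  then have "norm (mk z c) = norm (mk z 0 + mk 0 c)" by (rule arg_cong)
  also have "\<dots> \<le> norm (mk z 0) + norm (mk 0 c :: 'a heis)" by (rule norm_triangle_ineq)
  also have "norm (mk z 0) = norm z" by (simp add: mk_def norm_prod_def)
  also have "norm (mk 0 c :: 'a heis) = \<bar>c\<bar>" by (simp add: mk_def norm_prod_def)
  finally show ?thesis .
qed

text \<open>
  In split form, a curve (z, c) is horizontal if c' = -2 sform z z', and z' is its control.
\<close>
lemma horizontal_field_sum: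
  fixes h :: "('n::finite) hvec"
  shows "(\<Sum>i\<in>UNIV. (fst h $ i) *\<^sub>R heis_X i x + (snd h $ i) *\<^sub>R heis_Y i x) = mk h (- 2 * sform (hpart x) h)"
proof -
  obtain a b c where x: "x = (a, b, c)" by (metis surj_pair)
  have e: "(\<Sum>i\<in>UNIV. (v $ i) *\<^sub>R axis i 1) = v" for v :: "real^'n"
    using basis_expansion[of v] by (simp add: scalar_mult_eq_scaleR)
  have "(\<Sum>i\<in>UNIV. (fst h $ i) *\<^sub>R heis_X i x + (snd h $ i) *\<^sub>R heis_Y i x)
     = (\<Sum>i\<in>UNIV. ((fst h $ i) *\<^sub>R axis i 1, (snd h $ i) *\<^sub>R axis i 1, 2 * (fst h $ i * b $ i) - 2 * (snd h $ i * a $ i)))"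
    by (intro sum.cong) (auto simp: x)
  also have "\<dots> = (fst h, snd h, 2 * (fst h \<bullet> b) - 2 * (snd h \<bullet> a))"
    by (simp add: sum_prod e inner_vec_def sum_subtractf sum_distrib_left)
  also have "\<dots> = mk h (- 2 * sform (hpart x) h)"
    by (simp add: mk_def sform_def rot_def hpart_def x inner_prod_def inner_commute)
  finally show ?thesis .
qed

definition cc_curve :: "('n::finite) heis \<Rightarrow> 'n heis \<Rightarrow> real \<Rightarrow> bool" where
  "cc_curve x y l \<longleftrightarrow> (\<exists>\<gamma> h s t. l = horizontal_length {s..t} h \<and>
     s \<le> t \<and> absolutely_continuous_curve {s..t} \<gamma> \<and> horizontal_control {s..t} \<gamma> h \<and> \<gamma> s = x \<and> \<gamma> t = y)"

lemma cc_curveI: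
  assumes "s \<le> t" "absolutely_continuous_curve {s..t} \<gamma>" "horizontal_control {s..t} \<gamma> h"
    "\<gamma> s = x" "\<gamma> t = y" "l = horizontal_length {s..t} h"
  shows "cc_curve x y l"
  unfolding cc_curve_def using assms by blast

lemma cc_dist_eq: "cc_dist x y = Inf {l. cc_curve x y l}"
  unfolding cc_dist_def cc_curve_def by (rule arg_cong[of _ _ Inf]) blast

lemma smooth_cc_curve:
  fixes z z' :: "real \<Rightarrow> ('n::finite) hvec" and c :: "real \<Rightarrow> real"
  assumes z: "\<And>t. (z has_vector_derivative z' t) (at t)" and z': "continuous_on UNIV z'"
    and c: "\<And>t. (c has_vector_derivative (- 2 * sform (z t) (z' t))) (at t)"
  shows "cc_curve (mk (z 0) (c 0)) (mk (z 1) (c 1)) (horizontal_length {0..1} z')"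
proof -
  let ?\<gamma> = "\<lambda>t. mk (z t) (c t)" and ?d = "\<lambda>t. mk (z' t) (- 2 * sform (z t) (z' t))"
  have d: "(?\<gamma> has_vector_derivative ?d t) (at t)" for t
    unfolding mk_def
    using bounded_linear.has_vector_derivative[OF bounded_linear_fst z[of t]]
      bounded_linear.has_vector_derivative[OF bounded_linear_snd z[of t]] c[of t]
    by (intro has_vector_derivative_Pair) auto
  have "continuous_on UNIV z"
    using z by (meson continuous_at_imp_continuous_on has_vector_derivative_continuous)
  then have zc: "continuous_on {0..1} z" "continuous_on {0..1} z'"
    using z' by (auto intro: continuous_on_subset)
  have "continuous_on {0..1} ?d"
    by (intro continuous_on_mk continuous_on_mult continuous_on_const continuous_on_sform zc)
  then have "bounded (?d ` {0..1})" by (intro compact_imp_bounded compact_continuous_image) auto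
  then obtain B where "0 < B" and B': "\<forall>y\<in>?d ` {0..1}. norm y \<le> B" unfolding bounded_pos by blast
  then have B: "B \<ge> 0" "\<And>t. t \<in> {0..1} \<Longrightarrow> norm (?d t) \<le> B" by auto
  have "absolutely_continuous_curve {0..1} ?\<gamma>"
  proof (rule lipschitz_absolutely_continuous[OF _ B(1)])
    fix u v :: real assume uv: "u \<in> {0..1}" "v \<in> {0..1}"
    have "norm (?\<gamma> u - ?\<gamma> v) \<le> B * norm (u - v)"
    proof (rule differentiable_bound[of "{0..1}" ?\<gamma> "\<lambda>t h. h *\<^sub>R ?d t"])
      show "(?\<gamma> has_derivative (\<lambda>h. h *\<^sub>R ?d t)) (at t within {0..1})" for t
        using d[of t] has_derivative_at_withinI unfolding has_vector_derivative_def by blast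
      show "onorm (\<lambda>h. h *\<^sub>R ?d t) \<le> B" if "t \<in> {0..1}" for t
        using B(2)[OF that] B(1)
        by (intro onorm_le) (auto simp: mult.commute[of B] intro: mult_left_mono)
    qed (use uv in auto)
    then show "norm (?\<gamma> u - ?\<gamma> v) \<le> B * \<bar>u - v\<bar>" by simp
  qed
  moreover have "horizontal_control {0..1} ?\<gamma> z'"
    unfolding horizontal_control_def horizontal_field_sum
    using d by (auto intro: has_vector_derivative_at_within)
  ultimately show ?thesis by (intro cc_curveI[of 0 1 ?\<gamma> z']) simp_all
qed

lemma cc_curve_hor: "cc_curve x (x \<odot> hor v) (norm v)"
proof -
  have "cc_curve (mk (hpart x + 0 *\<^sub>R v) (vpart x - 2 * 0 * sform (hpart x) v)) (mk (hpart x + 1 *\<^sub>R v) (vpart x - 2 * 1 * sform (hpart x) v))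
      (horizontal_length {0..1} (\<lambda>_. v))"
    by (rule smooth_cc_curve[where z = "\<lambda>t. hpart x + t *\<^sub>R v" and c = "\<lambda>t. vpart x - 2 * t * sform (hpart x) v"])
       (auto intro!: derivative_eq_intros simp: sform_simps)
  moreover have "horizontal_length {0..1} (\<lambda>_. v) = norm v"
    unfolding horizontal_length_def by (subst set_lebesgue_integral_eq_integral) (auto intro!: absolutely_integrable_on_const)
  ultimately show ?thesis by (simp add: mult_mk)
qed

lemma exists_unit_hvec: obtains e :: "('n::finite) hvec" where "norm e = 1"
proof -
  have "norm ((axis undefined 1, 0) :: 'n hvec) = 1" by (simp add: norm_prod_def norm_axis_1)
  then show ?thesis by (rule that)
qed

text \<open>
  The vertical displacement along a lift of a plane curve is determined by the symplectic area that
  the curve sweeps out, and polynomial curves sweep out any prescribed area. This makes the infimum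
  in the definition of the distance one of a nonempty set, without which no lower bound could be
  proved.
\<close>
lemma cc_curve_exists:
  fixes x :: "('n::finite) heis" shows "\<exists>l. cc_curve x (x \<odot> mk w c) l"
proof (cases "w = 0")
  case False
  \<comment> \<open>The arc w t + (t - t^2) k has vertical displacement (2/3) sform w k.\<close>
  define k where "k = (3 * c / (2 * (norm w)\<^sup>2)) *\<^sub>R rot w"
  define z where "z t = hpart x + t *\<^sub>R w + (t - t\<^sup>2) *\<^sub>R k" for t
  define z' where "z' t = w + (1 - 2 * t) *\<^sub>R k" for t
  define q where "q t = vpart x - 2 * (t * sform (hpart x) w + (t - t\<^sup>2) * sform (hpart x) k - t^3 / 3 * sform w k)" for t
  have wk: "sform w k = 3 * c / 2"
    using False by (simp add: k_def sform_simps sform_rot power2_norm_eq_inner[symmetric])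
  have "cc_curve (mk (z 0) (q 0)) (mk (z 1) (q 1)) (horizontal_length {0..1} z')"
  proof (rule smooth_cc_curve)
    show "(z has_vector_derivative z' t) (at t)" for t
      unfolding z_def z'_def by (auto intro!: derivative_eq_intros simp: power2_eq_square algebra_simps)
    show "continuous_on UNIV z'" unfolding z'_def by (intro continuous_intros)
    have sy: "sform (z t) (z' t) = sform (hpart x) w + (1 - 2 * t) * sform (hpart x) k - t\<^sup>2 * sform w k" for t
      unfolding z_def z'_def using sform_swap[of k w]
      by (simp add: sform_simps power2_eq_square) (simp add: algebra_simps)
    show "(q has_vector_derivative - 2 * sform (z t) (z' t)) (at t)" for t
      unfolding q_def sy has_real_derivative_iff_has_vector_derivative[symmetric]
      by (auto intro!: derivative_eq_intros simp: power2_eq_square algebra_simps)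
  qed
  moreover have "mk (z 0) (q 0) = x" by (simp add: z_def q_def)
  moreover have "mk (z 1) (q 1) = x \<odot> mk w c" by (simp add: z_def q_def mult_mk wk)
  ultimately show ?thesis by metis
next
  case True
  obtain e :: "'n hvec" where e: "norm e = 1" using exists_unit_hvec by blast
  \<comment> \<open>The loop (t - t^2) e + (t^2 - t^3) g has vertical displacement - sform e g / 15.\<close>
  define g where "g = (- 15 * c) *\<^sub>R rot e"
  define z where "z t = hpart x + (t - t\<^sup>2) *\<^sub>R e + (t\<^sup>2 - t^3) *\<^sub>R g" for t
  define z' where "z' t = (1 - 2 * t) *\<^sub>R e + (2 * t - 3 * t\<^sup>2) *\<^sub>R g" for t
  define q where "q t = vpart x - 2 * ((t - t\<^sup>2) * sform (hpart x) e + (t\<^sup>2 - t^3) * sform (hpart x) g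
      + (t^3 / 3 - t^4 / 2 + t^5 / 5) * sform e g)" for t
  have eg: "sform e g = - 15 * c"
    using e by (simp add: g_def sform_simps sform_rot power2_norm_eq_inner[symmetric] dot_square_norm)
  have "cc_curve (mk (z 0) (q 0)) (mk (z 1) (q 1)) (horizontal_length {0..1} z')"
  proof (rule smooth_cc_curve)
    show "(z has_vector_derivative z' t) (at t)" for t
      unfolding z_def z'_def by (auto intro!: derivative_eq_intros simp: power2_eq_square algebra_simps)
    show "continuous_on UNIV z'" unfolding z'_def by (intro continuous_intros)
    have sy: "sform (z t) (z' t) = (1 - 2 * t) * sform (hpart x) e + (2 * t - 3 * t\<^sup>2) * sform (hpart x) g + (t\<^sup>2 - 2 * t^3 + t^4) * sform e g" for t
      unfolding z_def z'_def using sform_swap[of g e]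
      by (simp add: sform_simps power2_eq_square) (simp add: algebra_simps power_numeral_reduce)
    show "(q has_vector_derivative - 2 * sform (z t) (z' t)) (at t)" for t
      unfolding q_def sy has_real_derivative_iff_has_vector_derivative[symmetric]
      by (auto intro!: derivative_eq_intros simp: power2_eq_square algebra_simps power_numeral_reduce)
  qed
  moreover have "mk (z 0) (q 0) = x" by (simp add: z_def q_def)
  moreover have "mk (z 1) (q 1) = x \<odot> mk w c" by (simp add: z_def q_def mult_mk eg True sform_simps)
  ultimately show ?thesis by metis
qed

text \<open>
  The control integrates to the horizontal displacement. The vertical displacement, seen from x, is
  the integral of -2 sform (z - z0) z', where both |z - z0| and the integral of |z'| are at most
  the length.
\<close>
lemma cc_curve_length_bounds:
  fixes x :: "('n::finite) heis"
  assumes "cc_curve x (x \<odot> mk w c) l"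
  shows "norm w \<le> l" "\<bar>c\<bar> \<le> 2 * l\<^sup>2"
proof -
  let ?y = "x \<odot> mk w c"
  obtain \<gamma> h s t where l: "l = horizontal_length {s..t} h" and st: "s \<le> t"
    and AC: "absolutely_continuous_curve {s..t} \<gamma>" and ctrl: "horizontal_control {s..t} \<gamma> h"
    and ends: "\<gamma> s = x" "\<gamma> t = ?y"
    using assms unfolding cc_curve_def by blast
  define g where "g u = mk (h u) (- 2 * sform (hpart (\<gamma> u)) (h u))" for u
  have "AE u in lebesgue. u \<in> {s..t} \<longrightarrow> (\<gamma> has_vector_derivative g u) (at u within {s..t})"
    using ctrl unfolding horizontal_control_def horizontal_field_sum g_def .
  from AE_E[OF this] obtain Z where sub: "{u \<in> space lebesgue. \<not> (u \<in> {s..t} \<longrightarrow> (\<gamma> has_vector_derivative g u) (at u within {s..t}))} \<subseteq> Z"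
    and "emeasure lebesgue Z = 0" "Z \<in> sets lebesgue" by blast
  then have Z: "negligible Z" by (auto simp: negligible_iff_null_sets)
  have deriv: "(\<gamma> has_vector_derivative g u) (at u within {s..t})" if "u \<in> {s..t} - Z" for u
    using that sub by auto
  have gint: "(g has_integral (\<gamma> v - x)) {s..v}" if "v \<in> {s..t}" for v
    unfolding ends(1)[symmetric]
  proof (rule absolutely_continuous_FTC[OF _ _ Z])
    show "s \<le> v" using that by simp
    have sub: "{s..v} \<subseteq> {s..t}" using that by auto
    show "absolutely_continuous_curve {s..v} \<gamma>" by (rule absolutely_continuous_curve_subset[OF AC sub])
    show "(\<gamma> has_vector_derivative g u) (at u within {s..v})" if "u \<in> {s..v} - Z" for u
      using deriv[of u] that sub has_vector_derivative_within_subset by blast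
  qed
  have hg: "hpart \<circ> g = h" by (auto simp: g_def)
  have gabs: "g absolutely_integrable_on {s..t}" by (rule absolutely_continuous_derivative_integrable[OF AC Z deriv])
  have habs: "h absolutely_integrable_on {s..t}"
    using absolutely_integrable_linear[OF gabs bounded_linear_hpart] unfolding hg .
  then have nint: "(\<lambda>u. norm (h u)) integrable_on {s..t}" by (simp add: absolutely_integrable_on_def)
  have l': "l = integral {s..t} (\<lambda>u. norm (h u))"
    unfolding l horizontal_length_def
    using absolutely_integrable_norm[OF habs] by (intro set_lebesgue_integral_eq_integral(2)) (simp add: comp_def)
  have hint: "(h has_integral (hpart (\<gamma> v) - hpart x)) {s..v}" if "v \<in> {s..t}" for v
    using has_integral_linear[OF gint[OF that] bounded_linear_hpart]
    unfolding hg by (simp add: bounded_linear_hpart bounded_linear.linear linear_diff)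
  have hle: "norm (hpart (\<gamma> v) - hpart x) \<le> l" if "v \<in> {s..t}" for v
  proof -
    have sub: "{s..v} \<subseteq> {s..t}" using that by auto
    have nv: "(\<lambda>u. norm (h u)) integrable_on {s..v}" using integrable_on_subinterval[OF nint sub] .
    have "norm (integral {s..v} h) \<le> integral {s..v} (\<lambda>u. norm (h u))"
      using hint[OF that] nv by (intro integral_norm_bound_integral) (auto simp: integrable_on_def)
    also have "\<dots> \<le> integral {s..t} (\<lambda>u. norm (h u))"
      by (rule integral_subset_le[OF sub nv nint]) simp
    finally show ?thesis using hint[OF that] l' by (simp add: integral_unique)
  qed
  from hle[of t] st show "norm w \<le> l" unfolding ends by (simp add: mult_mk)
  define k where "k u = vpart (g u) + 2 * sform (hpart x) (h u)" for u
  have "((\<lambda>u. vpart (g u)) has_integral (vpart (?y - x))) {s..t}"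
    using has_integral_linear[OF gint[of t] bounded_linear_vpart] st unfolding ends by (simp add: comp_def)
  moreover have "((\<lambda>u. 2 * sform (hpart x) (h u)) has_integral 2 * sform (hpart x) w) {s..t}"
  proof -
    have "bounded_linear (sform (hpart x))" unfolding sform_def by (rule bounded_linear_inner_right)
    from has_integral_linear[OF hint[of t] this] st
    have "((\<lambda>u. sform (hpart x) (h u)) has_integral sform (hpart x) w) {s..t}"
      unfolding ends by (simp add: comp_def mult_mk)
    then show ?thesis by (rule has_integral_mult_right)
  qed
  ultimately have "(k has_integral (vpart (?y - x) + 2 * sform (hpart x) w)) {s..t}"
    unfolding k_def by (rule has_integral_add)
  moreover have "vpart (?y - x) + 2 * sform (hpart x) w = c"
    unfolding linear_diff[OF bounded_linear.linear[OF bounded_linear_vpart]] by (simp add: mult_mk)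
  ultimately have kint: "(k has_integral c) {s..t}" by simp
  have "norm (integral {s..t} k) \<le> integral {s..t} (\<lambda>u. 2 * l * norm (h u))"
  proof (rule integral_norm_bound_integral)
    show "k integrable_on {s..t}" using kint by (auto simp: integrable_on_def)
    show "(\<lambda>u. 2 * l * norm (h u)) integrable_on {s..t}" by (rule integrable_on_mult_right[OF nint])
    fix u assume u: "u \<in> {s..t}"
    have "k u = - 2 * sform (hpart (\<gamma> u) - hpart x) (h u)" by (simp add: k_def g_def sform_simps)
    then have "norm (k u) = 2 * \<bar>sform (hpart (\<gamma> u) - hpart x) (h u)\<bar>" by (simp add: abs_mult)
    also have "\<dots> \<le> 2 * (norm (hpart (\<gamma> u) - hpart x) * norm (h u))" by (intro mult_left_mono abs_sform_le) auto
    also have "\<dots> \<le> 2 * (l * norm (h u))" using hle[OF u] by (intro mult_left_mono mult_right_mono) auto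
    finally show "norm (k u) \<le> 2 * l * norm (h u)" by simp
  qed
  also have "\<dots> = 2 * l * l" unfolding l' by simp
  finally show "\<bar>c\<bar> \<le> 2 * l\<^sup>2" using kint by (simp add: integral_unique power2_eq_square)
qed

lemma cc_dist_hor_le: "cc_dist x (x \<odot> hor v) \<le> norm v"
proof -
  have "bdd_below {l. cc_curve x (x \<odot> hor v) l}"
  proof (rule bdd_belowI[of _ 0])
    fix l assume "l \<in> {l. cc_curve x (x \<odot> hor v) l}"
    then have "norm v \<le> l" using cc_curve_length_bounds(1)[of x v 0 l] by simp
    with norm_ge_zero[of v] show "0 \<le> l" by linarith
  qed
  then show ?thesis unfolding cc_dist_eq using cc_curve_hor[of x v] by (intro cInf_lower) auto
qed

lemma cc_dist_ge: "norm w + sqrt \<bar>c\<bar> \<le> 3 * cc_dist x (x \<odot> mk w c)"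
proof -
  have "(norm w + sqrt \<bar>c\<bar>) / 3 \<le> cc_dist x (x \<odot> mk w c)"
    unfolding cc_dist_eq
  proof (rule cInf_greatest)
    show "{l. cc_curve x (x \<odot> mk w c) l} \<noteq> {}" using cc_curve_exists[of x w c] by auto
    fix l assume "l \<in> {l. cc_curve x (x \<odot> mk w c) l}"
    then have l: "norm w \<le> l" "\<bar>c\<bar> \<le> 2 * l\<^sup>2" using cc_curve_length_bounds[of x w c l] by auto
    then have "0 \<le> l" using norm_ge_zero[of w] by linarith
    have "\<bar>c\<bar> \<le> (2 * l)\<^sup>2" using l(2) by (simp add: power_mult_distrib)
    then have "sqrt \<bar>c\<bar> \<le> 2 * l" using \<open>0 \<le> l\<close> by (intro real_le_lsqrt) auto
    then show "(norm w + sqrt \<bar>c\<bar>) / 3 \<le> l" using l(1) by simp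
  qed
  then show ?thesis by simp
qed

text \<open>
  The normalised Lipschitz condition. The factor 2 arises because a vertical displacement c is the
  commutator of two horizontal ones of length sqrt |c| / 2, hence a path of length 2 sqrt |c|.
\<close>
definition hlip :: "(('n::finite) heis \<Rightarrow> real) \<Rightarrow> bool" where
  "hlip f \<longleftrightarrow> (\<forall>x z c. \<bar>f (x \<odot> mk z c) - f x\<bar> \<le> norm z + 2 * sqrt \<bar>c\<bar>)"

lemma hlipD: "hlip f \<Longrightarrow> \<bar>f (x \<odot> mk z c) - f x\<bar> \<le> norm z + 2 * sqrt \<bar>c\<bar>"
  unfolding hlip_def by blast

lemma hlip_hor: "hlip f \<Longrightarrow> \<bar>f (x \<odot> hor v) - f x\<bar> \<le> norm v"
  using hlipD[of f x v 0] by simp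

lemma hlip_of_heis_lipschitz:
  fixes f :: "('n::finite) heis \<Rightarrow> real"
  assumes "heis_lipschitz f"
  obtains C where "C > 0" "hlip (\<lambda>x. f x / C)"
proof -
  obtain C0 where C0: "C0 \<ge> 0" "\<And>x y. \<bar>f x - f y\<bar> \<le> C0 * cc_dist x y" using assms unfolding heis_lipschitz_def by blast
  define C where "C = C0 + 1"
  have C: "C > 0" using C0 unfolding C_def by simp
  have step: "\<bar>f (x \<odot> hor v) - f x\<bar> \<le> C * norm v" for x v
  proof -
    have "\<bar>f (x \<odot> hor v) - f x\<bar> \<le> C0 * cc_dist x (x \<odot> hor v)" using C0(2)[of x "x \<odot> hor v"] by (simp add: abs_minus_commute)
    also have "\<dots> \<le> C0 * norm v" using cc_dist_hor_le[of x v] C0(1) by (intro mult_left_mono) auto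
    also have "\<dots> \<le> C * norm v" unfolding C_def by (intro mult_right_mono) auto
    finally show ?thesis .
  qed
  obtain e :: "'n hvec" where e: "norm e = 1" using exists_unit_hvec by blast
  have "\<bar>f (x \<odot> mk z c) - f x\<bar> \<le> C * (norm z + 2 * sqrt \<bar>c\<bar>)" for x z c
  proof -
    \<comment> \<open>The commutator of X and Y is the vertical element -4 sform X Y.\<close>
    define a where "a = sqrt \<bar>c\<bar> / 2"
    have a: "a \<ge> 0" "4 * (a * a) = \<bar>c\<bar>" unfolding a_def by auto
    define X where "X = a *\<^sub>R e"
    define Y where "Y = (- sgn c * a) *\<^sub>R rot e"
    have XY: "norm X = a" "norm Y \<le> a" using e a unfolding X_def Y_def by (auto simp: abs_mult abs_sgn_eq)
    have "- 4 * sform X Y = c"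
    proof -
      have "- 4 * sform X Y = sgn c * (4 * (a * a))"
        using e unfolding X_def Y_def by (simp add: sform_simps sform_rot dot_square_norm)
      then show ?thesis unfolding a(2) by (simp add: sgn_mult_abs)
    qed
    then have eq: "x \<odot> hor z \<odot> hor X \<odot> hor Y \<odot> hor (- X) \<odot> hor (- Y) = x \<odot> mk z c"
      using sform_swap[of Y X] by (simp add: mult_mk sform_simps algebra_simps)
    have "\<bar>f (x \<odot> hor z) - f x\<bar> \<le> C * norm z" by (rule step)
    moreover have "\<bar>f (x \<odot> hor z \<odot> hor X) - f (x \<odot> hor z)\<bar> \<le> C * norm X" by (rule step)
    moreover have "\<bar>f (x \<odot> hor z \<odot> hor X \<odot> hor Y) - f (x \<odot> hor z \<odot> hor X)\<bar> \<le> C * norm Y" by (rule step)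
    moreover have "\<bar>f (x \<odot> hor z \<odot> hor X \<odot> hor Y \<odot> hor (- X)) - f (x \<odot> hor z \<odot> hor X \<odot> hor Y)\<bar> \<le> C * norm (- X)" by (rule step)
    moreover have "\<bar>f (x \<odot> hor z \<odot> hor X \<odot> hor Y \<odot> hor (- X) \<odot> hor (- Y)) - f (x \<odot> hor z \<odot> hor X \<odot> hor Y \<odot> hor (- X))\<bar> \<le> C * norm (- Y)" by (rule step)
    ultimately have "\<bar>f (x \<odot> mk z c) - f x\<bar> \<le> C * norm z + C * norm X + C * norm Y + C * norm X + C * norm Y"
      unfolding eq norm_minus_cancel by linarith
    moreover have "C * norm Y \<le> C * a" using XY C by (intro mult_left_mono) auto
    moreover have "C * (norm z + 2 * sqrt \<bar>c\<bar>) = C * norm z + 4 * (C * a)" unfolding a_def by (simp add: algebra_simps)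
    ultimately show ?thesis using XY(1) by simp
  qed
  then have "hlip (\<lambda>x. f x / C)"
    using C unfolding hlip_def by (auto simp: diff_divide_distrib[symmetric] abs_divide divide_le_eq mult.commute)
  with C that show ?thesis by blast
qed

text \<open>
  The map z -> xi . z of the horizontal part is H-linear, and the distance from x to x (z, c)
  dominates r = |z| + sqrt |c|, for which (z, c) lies in the box |z| <= r, |c| <= r^2.
\<close>
lemma pansu_differentiable_if_box_approximation:
  fixes f :: "('n::finite) heis \<Rightarrow> real" and x :: "'n heis" and \<xi> :: "'n hvec"
  assumes C: "C > 0"
    and lin: "\<And>\<epsilon>. \<epsilon> > 0 \<Longrightarrow> \<exists>r0>0. \<forall>r z c. 0 < r \<longrightarrow> r < r0 \<longrightarrow> norm z \<le> r \<longrightarrow> \<bar>c\<bar> \<le> r\<^sup>2 \<longrightarrow>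
        \<bar>f (x \<odot> mk z c) / C - f x / C - \<xi> \<bullet> z\<bar> \<le> \<epsilon> * r"
  shows "pansu_differentiable_at f x"
  unfolding pansu_differentiable_at_def
proof (intro exI conjI)
  let ?L = "\<lambda>y. C * (\<xi> \<bullet> hpart y)"
  have hd: "hpart (heis_dilation r y) = r *\<^sub>R hpart y" for r and y :: "'n heis"
    by (cases y) (simp add: hpart_def)
  show "heis_linear ?L" unfolding heis_linear_def by (simp add: hd inner_add_right algebra_simps)
  let ?q = "\<lambda>y. heis_inv x \<odot> y"
  let ?r = "\<lambda>y. norm (hpart (?q y)) + sqrt \<bar>vpart (?q y)\<bar>"
  have cont: "continuous_on UNIV ?r" by (intro continuous_intros)
  have r0: "?r x = 0" by (simp add: heis_mult_inv)
  show "((\<lambda>y. \<bar>f y - f x - ?L (?q y)\<bar> / cc_dist x y) \<longlongrightarrow> 0) (at x)"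
  proof (rule tendstoI)
    fix e :: real assume "e > 0"
    define \<epsilon> where "\<epsilon> = e / (6 * C)"
    have "\<epsilon> > 0" using \<open>e > 0\<close> C unfolding \<epsilon>_def by simp
    from lin[OF this] obtain \<rho> where \<rho>: "\<rho> > 0" "\<And>r z c. 0 < r \<Longrightarrow> r < \<rho> \<Longrightarrow> norm z \<le> r \<Longrightarrow> \<bar>c\<bar> \<le> r\<^sup>2 \<Longrightarrow>
        \<bar>f (x \<odot> mk z c) / C - f x / C - \<xi> \<bullet> z\<bar> \<le> \<epsilon> * r" by blast
    have "isCont ?r x" using cont continuous_on_eq_continuous_at[OF open_UNIV, of ?r] by blast
    then have "(?r \<longlongrightarrow> 0) (at x)" unfolding isCont_def r0 .
    then have "\<forall>\<^sub>F y in at x. ?r y < \<rho>" using \<rho>(1) by (rule order_tendstoD(2))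
    moreover have "\<forall>\<^sub>F y in at x. y \<noteq> x" by (simp add: eventually_at_filter)
    ultimately show "\<forall>\<^sub>F y in at x. dist (\<bar>f y - f x - ?L (?q y)\<bar> / cc_dist x y) 0 < e"
    proof eventually_elim
      case (elim y)
      define z where "z = hpart (?q y)"
      define c where "c = vpart (?q y)"
      have y: "y = x \<odot> mk z c" unfolding z_def c_def by (simp del: hpart_mult)
      define r where "r = norm z + sqrt \<bar>c\<bar>"
      have "z \<noteq> 0 \<or> c \<noteq> 0"
      proof (rule ccontr)
        assume "\<not> (z \<noteq> 0 \<or> c \<noteq> 0)"
        then have "y = x" using y by (simp add: mk_zero)
        then show False using elim(2) by simp
      qed
      then have "r > 0" unfolding r_def by (auto simp: add_pos_nonneg add_nonneg_pos)
      have "\<bar>c\<bar> = (sqrt \<bar>c\<bar>)\<^sup>2" by simp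
      also have "\<dots> \<le> r\<^sup>2" unfolding r_def by (intro power_mono) auto
      finally have "\<bar>f (x \<odot> mk z c) / C - f x / C - \<xi> \<bullet> z\<bar> \<le> \<epsilon> * r"
        using \<rho>(2)[of r z c] \<open>r > 0\<close> elim(1) unfolding r_def z_def c_def by simp
      then have "C * \<bar>f y / C - f x / C - \<xi> \<bullet> z\<bar> \<le> C * (\<epsilon> * r)" unfolding y using C by (intro mult_left_mono) auto
      moreover have "C * \<bar>f y / C - f x / C - \<xi> \<bullet> z\<bar> = \<bar>f y - f x - C * (\<xi> \<bullet> z)\<bar>"
      proof -
        have "f y - f x - C * (\<xi> \<bullet> z) = C * (f y / C - f x / C - \<xi> \<bullet> z)" using C by (simp add: field_simps)
        then show ?thesis using C by (simp add: abs_mult)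
      qed
      moreover have "C * (\<epsilon> * r) = e / 6 * r" unfolding \<epsilon>_def using C by simp
      ultimately have num: "\<bar>f y - f x - ?L (?q y)\<bar> \<le> e / 6 * r" unfolding z_def by simp
      have den: "r \<le> 3 * cc_dist x y" unfolding y r_def by (rule cc_dist_ge)
      then have "cc_dist x y > 0" using \<open>r > 0\<close> by linarith
      moreover have "e / 6 * r \<le> e / 6 * (3 * cc_dist x y)" using den \<open>e > 0\<close> by (intro mult_left_mono) auto
      moreover have "e / 6 * (3 * cc_dist x y) < e * cc_dist x y" using \<open>e > 0\<close> calculation(1) by simp
      ultimately have "\<bar>f y - f x - ?L (?q y)\<bar> / cc_dist x y < e" using num by (simp add: pos_divide_less_eq)
      then show ?case using \<open>cc_dist x y > 0\<close> by simp
    qed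
  qed
qed

lemma hlip_continuous:
  assumes "hlip f" shows "continuous_on UNIV f"
proof -
  have "(f \<longlongrightarrow> f x) (at x)" for x
  proof -
    let ?q = "\<lambda>y. heis_inv x \<odot> y"
    let ?r = "\<lambda>y. norm (hpart (?q y)) + 2 * sqrt \<bar>vpart (?q y)\<bar>"
    have cont: "continuous_on UNIV ?r" by (intro continuous_intros)
    have r0: "?r x = 0" by (simp add: heis_mult_inv)
    have "isCont ?r x" using cont continuous_on_eq_continuous_at[OF open_UNIV, of ?r] by blast
    then have lim: "(?r \<longlongrightarrow> 0) (at x)" unfolding isCont_def r0 .
    have *: "norm (f y - f x) \<le> ?r y" for y
      using hlipD[OF assms, of x "hpart (?q y)" "vpart (?q y)"] by (simp del: hpart_mult)
    have "\<forall>\<^sub>F y in at x. norm (f y - f x) \<le> ?r y" by (rule always_eventually, rule allI, rule *)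
    from Lim_null_comparison[OF this lim] have "((\<lambda>y. f y - f x) \<longlongrightarrow> 0) (at x)" .
    then show ?thesis by (simp add: LIM_zero_iff)
  qed
  then show ?thesis by (simp add: continuous_on_def)
qed


section \<open>Directional derivatives and closeness of increments\<close>

definition incr :: "(('n::finite) heis \<Rightarrow> real) \<Rightarrow> 'n heis \<Rightarrow> 'n hvec \<Rightarrow> real \<Rightarrow> real" where
  "incr f x v t = f (x \<odot> hor (t *\<^sub>R v)) - f x"

definition dird :: "(('n::finite) heis \<Rightarrow> real) \<Rightarrow> 'n heis \<Rightarrow> 'n hvec \<Rightarrow> real \<Rightarrow> bool" where
  "dird f x v p \<longleftrightarrow> ((\<lambda>t. f (x \<odot> hor (t *\<^sub>R v))) has_real_derivative p) (at 0)"

text \<open>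
  Weighting by |t| makes this a condition at every scale: in particular it bounds the difference of
  the derivatives at x and y in direction v.
\<close>
definition close_incr :: "(('n::finite) heis \<Rightarrow> real) \<Rightarrow> 'n hvec \<Rightarrow> 'n heis \<Rightarrow> 'n heis \<Rightarrow> real \<Rightarrow> bool" where
  "close_incr f v x y c \<longleftrightarrow> (\<forall>t. \<bar>t\<bar> \<le> 1 \<longrightarrow> \<bar>incr f y v t - incr f x v t\<bar> \<le> c * \<bar>t\<bar>)"

lemma close_incr_refl: "0 \<le> c \<Longrightarrow> close_incr f v x x c"
  by (simp add: close_incr_def)

lemma close_incr_mono: "close_incr f v x y c \<Longrightarrow> c \<le> c' \<Longrightarrow> close_incr f v x y c'"
  unfolding close_incr_def by (meson abs_ge_zero mult_right_mono order_trans)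

lemma dird_iff:
  "dird f x v p \<longleftrightarrow> (\<forall>\<epsilon>>0. \<exists>\<Delta>>0. \<forall>t. \<bar>t\<bar> < \<Delta> \<longrightarrow> \<bar>incr f x v t - p * t\<bar> \<le> \<epsilon> * \<bar>t\<bar>)"
  unfolding dird_def has_field_derivative_def has_derivative_at_alt incr_def
  by (simp add: bounded_linear_mult_right mk_zero)

lemma abs_dird_le:
  assumes "hlip f" "dird f x v p" shows "\<bar>p\<bar> \<le> norm v"
proof (rule field_le_epsilon)
  fix \<epsilon> :: real assume "0 < \<epsilon>"
  then obtain \<Delta> where \<Delta>: "\<Delta> > 0" "\<And>t. \<bar>t\<bar> < \<Delta> \<Longrightarrow> \<bar>incr f x v t - p * t\<bar> \<le> \<epsilon> * \<bar>t\<bar>"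
    using assms(2) unfolding dird_iff by blast
  define t where "t = \<Delta> / 2"
  have t: "t > 0" "\<bar>t\<bar> < \<Delta>" using \<Delta>(1) unfolding t_def by auto
  have "\<bar>incr f x v t\<bar> \<le> norm v * t" using hlip_hor[OF assms(1), of x "t *\<^sub>R v"] t(1) unfolding incr_def by (simp add: mult.commute)
  moreover have "\<bar>p * t\<bar> = \<bar>p\<bar> * t" using t(1) by (simp add: abs_mult)
  ultimately have "\<bar>p\<bar> * t \<le> (norm v + \<epsilon>) * t" using \<Delta>(2)[OF t(2)] t(1) by (simp add: distrib_right)
  then show "\<bar>p\<bar> \<le> norm v + \<epsilon>" using t(1) by simp
qed

text \<open>
  The end points for w and v differ by the horizontal vector t (w - v) and a vertical displacement
  of order t^2 |w - v|, whence the square root.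
\<close>
lemma incr_direction_change:
  assumes "hlip f" "norm v \<le> 2" "norm (w - v) \<le> 1"
  shows "\<bar>incr f x w t - incr f x v t\<bar> \<le> 5 * sqrt (norm (w - v)) * \<bar>t\<bar>"
proof -
  define m where "m = norm (w - v)"
  define c where "c = 2 * (t * (t * sform v (w - v)))"
  have eq: "x \<odot> hor (t *\<^sub>R v) \<odot> mk (t *\<^sub>R (w - v)) c = x \<odot> hor (t *\<^sub>R w)"
    unfolding heis_mult_assoc mk_mult c_def by (simp add: sform_simps algebra_simps)
  have "\<bar>sform v (w - v)\<bar> \<le> norm v * norm (w - v)" by (rule abs_sform_le)
  also have "\<dots> \<le> 2 * m" unfolding m_def using assms(2) by (intro mult_right_mono) auto
  finally have sf: "\<bar>sform v (w - v)\<bar> \<le> 2 * m" .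
  have "\<bar>c\<bar> = 2 * (t * t) * \<bar>sform v (w - v)\<bar>" unfolding c_def by (simp add: abs_mult)
  also have "\<dots> \<le> 2 * (t * t) * (2 * m)" by (rule mult_left_mono[OF sf]) simp
  also have "\<dots> = 4 * m * t\<^sup>2" by (simp add: power2_eq_square)
  finally have "sqrt \<bar>c\<bar> \<le> sqrt (4 * m * t\<^sup>2)" by simp
  also have "\<dots> = 2 * (sqrt m * \<bar>t\<bar>)" by (simp add: real_sqrt_mult)
  finally have "2 * sqrt \<bar>c\<bar> \<le> 4 * (sqrt m * \<bar>t\<bar>)" by linarith
  moreover have "norm (t *\<^sub>R (w - v)) \<le> sqrt m * \<bar>t\<bar>"
  proof -
    have "m * m \<le> m * 1" unfolding m_def by (intro mult_left_mono assms(3)) auto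
    then have "m \<le> sqrt m" by (intro real_le_rsqrt) (simp add: power2_eq_square)
    then show ?thesis unfolding m_def by (simp add: mult.commute mult_left_mono)
  qed
  moreover have "\<bar>f (x \<odot> hor (t *\<^sub>R w)) - f (x \<odot> hor (t *\<^sub>R v))\<bar> \<le> norm (t *\<^sub>R (w - v)) + 2 * sqrt \<bar>c\<bar>"
    using hlipD[OF assms(1), of "x \<odot> hor (t *\<^sub>R v)" "t *\<^sub>R (w - v)" c] unfolding eq .
  moreover have "5 * sqrt m * \<bar>t\<bar> = 5 * (sqrt m * \<bar>t\<bar>)" by simp
  ultimately show ?thesis unfolding incr_def m_def[symmetric] by linarith
qed

lemma segment_values_uniformly_continuous:
  fixes f :: "('n::finite) heis \<Rightarrow> real"
  assumes "hlip f" "\<eta> > 0"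
  obtains \<delta> where "\<delta> > 0" "\<And>x' v' t. dist x' x < \<delta> \<Longrightarrow> dist v' v < \<delta> \<Longrightarrow> \<bar>t\<bar> \<le> T \<Longrightarrow>
     \<bar>f (x' \<odot> hor (t *\<^sub>R v')) - f (x \<odot> hor (t *\<^sub>R v))\<bar> < \<eta>"
proof -
  let ?S = "cball x 1 \<times> (cball v 1 \<times> {-T..T})"
  let ?g = "\<lambda>p. f (fst p \<odot> hor (snd (snd p) *\<^sub>R fst (snd p)))"
  have "continuous_on ?S ?g"
    by (rule continuous_on_compose2[OF hlip_continuous[OF assms(1)]]) (auto intro!: continuous_intros)
  moreover have "compact ?S" by (intro compact_Times) auto
  ultimately have "uniformly_continuous_on ?S ?g" by (rule compact_uniformly_continuous)
  then obtain d where d: "d > 0" "\<And>p q. p \<in> ?S \<Longrightarrow> q \<in> ?S \<Longrightarrow> dist q p < d \<Longrightarrow> dist (?g q) (?g p) < \<eta>"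
    unfolding uniformly_continuous_on_def using assms(2) by meson
  show ?thesis
  proof (rule that[of "min 1 (d / 2)"])
    show "0 < min 1 (d / 2)" using d(1) by simp
    fix x' v' t assume a: "dist x' x < min 1 (d / 2)" "dist v' v < min 1 (d / 2)" "\<bar>t\<bar> \<le> T"
    have "dist (x', (v', t)) (x, (v, t)) \<le> dist x' x + dist v' v"
      by (simp add: dist_Pair_Pair sqrt_sum_squares_le_sum)
    also have "\<dots> < d" using a by simp
    finally have "dist (?g (x', (v', t))) (?g (x, (v, t))) < \<eta>"
      using a by (intro d(2)) (auto simp: dist_commute)
    then show "\<bar>f (x' \<odot> hor (t *\<^sub>R v')) - f (x \<odot> hor (t *\<^sub>R v))\<bar> < \<eta>" by (simp add: dist_real_def)
  qed
qed

text \<open>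
  Closeness to x in direction v follows from closeness to x in direction v of x' and closeness to x'
  in direction v' of y. For small t the increments at x and x' are replaced by the derivatives p and
  p'; for other t, y is so close to x' that nothing changes. Each of the two regimes sees only one
  of the constants c1 and c2, so that they enter through their maximum instead of their sum. This is
  what allows infinitely many transitions.
\<close>
lemma close_incr_trans:
  fixes f :: "('n::finite) heis \<Rightarrow> real"
  assumes f: "hlip f" and p: "dird f x v p" and p': "dird f x' v' p'" and c1: "close_incr f v x x' c1"
    and v: "norm v' \<le> 2" "norm (v - v') \<le> 1" and "\<epsilon> > 0"
  obtains \<delta> where "\<delta> > 0" "\<And>y c c2. dist y x' < \<delta> \<Longrightarrow> close_incr f v' x' y c2 \<Longrightarrow> c1 + \<epsilon> \<le> c \<Longrightarrow>
      5 * sqrt (norm (v - v')) + \<bar>p' - p\<bar> + c2 + \<epsilon> \<le> c \<Longrightarrow> close_incr f v x y c"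
proof -
  obtain \<Delta>1 where \<Delta>1: "\<Delta>1 > 0" "\<And>t. \<bar>t\<bar> < \<Delta>1 \<Longrightarrow> \<bar>incr f x v t - p * t\<bar> \<le> \<epsilon> / 2 * \<bar>t\<bar>"
    using p \<open>\<epsilon> > 0\<close> unfolding dird_iff by (meson half_gt_zero)
  obtain \<Delta>2 where \<Delta>2: "\<Delta>2 > 0" "\<And>t. \<bar>t\<bar> < \<Delta>2 \<Longrightarrow> \<bar>incr f x' v' t - p' * t\<bar> \<le> \<epsilon> / 2 * \<bar>t\<bar>"
    using p' \<open>\<epsilon> > 0\<close> unfolding dird_iff by (meson half_gt_zero)
  define \<Delta> where "\<Delta> = min \<Delta>1 \<Delta>2"
  have "\<epsilon> * \<Delta> / 2 > 0" using \<open>\<epsilon> > 0\<close> \<Delta>1(1) \<Delta>2(1) unfolding \<Delta>_def by simp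
  then obtain \<delta> where \<delta>: "\<delta> > 0" "\<And>y v' t. dist y x' < \<delta> \<Longrightarrow> dist v' v < \<delta> \<Longrightarrow> \<bar>t\<bar> \<le> 1 \<Longrightarrow>
     \<bar>f (y \<odot> hor (t *\<^sub>R v')) - f (x' \<odot> hor (t *\<^sub>R v))\<bar> < \<epsilon> * \<Delta> / 2"
    using segment_values_uniformly_continuous[OF f, of "\<epsilon> * \<Delta> / 2" x' v 1] by blast
  show ?thesis
  proof (rule that[OF \<delta>(1)])
    fix y c c2 assume y: "dist y x' < \<delta>" and c2: "close_incr f v' x' y c2" and c: "c1 + \<epsilon> \<le> c"
      "5 * sqrt (norm (v - v')) + \<bar>p' - p\<bar> + c2 + \<epsilon> \<le> c"
    show "close_incr f v x y c" unfolding close_incr_def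
    proof (intro allI impI)
      fix t :: real assume t: "\<bar>t\<bar> \<le> 1"
      show "\<bar>incr f y v t - incr f x v t\<bar> \<le> c * \<bar>t\<bar>"
      proof (cases "\<bar>t\<bar> < \<Delta>")
        case True
        have "\<bar>incr f y v t - incr f y v' t\<bar> \<le> 5 * sqrt (norm (v - v')) * \<bar>t\<bar>"
          by (rule incr_direction_change[OF f v])
        moreover have "\<bar>incr f y v' t - incr f x' v' t\<bar> \<le> c2 * \<bar>t\<bar>" using c2 t unfolding close_incr_def by blast
        moreover have "\<bar>incr f x' v' t - p' * t\<bar> \<le> \<epsilon> / 2 * \<bar>t\<bar>" "\<bar>incr f x v t - p * t\<bar> \<le> \<epsilon> / 2 * \<bar>t\<bar>"
          using \<Delta>1(2) \<Delta>2(2) True unfolding \<Delta>_def by auto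
        moreover have "\<bar>p' * t - p * t\<bar> = \<bar>p' - p\<bar> * \<bar>t\<bar>" by (simp add: left_diff_distrib[symmetric] abs_mult)
        moreover have "\<bar>a - g\<bar> \<le> A + B + C + D + E"
          if "\<bar>a - b\<bar> \<le> A" "\<bar>b - c\<bar> \<le> B" "\<bar>c - d\<bar> \<le> C" "\<bar>g - e\<bar> \<le> D" "\<bar>d - e\<bar> = E"
          for a b c d e g A B C D E :: real using that by linarith
        ultimately have "\<bar>incr f y v t - incr f x v t\<bar> \<le> 5 * sqrt (norm (v - v')) * \<bar>t\<bar> + c2 * \<bar>t\<bar>
            + \<epsilon> / 2 * \<bar>t\<bar> + \<epsilon> / 2 * \<bar>t\<bar> + \<bar>p' - p\<bar> * \<bar>t\<bar>"
          by blast
        also have "\<dots> = (5 * sqrt (norm (v - v')) + \<bar>p' - p\<bar> + c2 + \<epsilon>) * \<bar>t\<bar>" by (simp add: field_simps)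
        also have "\<dots> \<le> c * \<bar>t\<bar>" using c(2) by (intro mult_right_mono) auto
        finally show ?thesis .
      next
        case False
        have "\<bar>f (y \<odot> hor (t *\<^sub>R v)) - f (x' \<odot> hor (t *\<^sub>R v))\<bar> < \<epsilon> * \<Delta> / 2" using \<delta>(2)[OF y _ t, of v] \<delta>(1) by simp
        moreover have "\<bar>f y - f x'\<bar> < \<epsilon> * \<Delta> / 2" using \<delta>(2)[OF y, of v 0] \<delta>(1) by (simp add: mk_zero)
        moreover have "\<bar>incr f x' v t - incr f x v t\<bar> \<le> c1 * \<bar>t\<bar>" using c1 t unfolding close_incr_def by blast
        moreover have "\<epsilon> * \<Delta> \<le> \<epsilon> * \<bar>t\<bar>" using False \<open>\<epsilon> > 0\<close> by (intro mult_left_mono) auto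
        moreover have "c1 * \<bar>t\<bar> + \<epsilon> * \<bar>t\<bar> \<le> c * \<bar>t\<bar>"
          unfolding distrib_right[symmetric] using c(1) by (intro mult_right_mono) auto
        moreover have "\<bar>(a - b) - h\<bar> \<le> E" if "\<bar>a - a'\<bar> < A / 2" "\<bar>b - b'\<bar> < A / 2" "\<bar>(a' - b') - h\<bar> \<le> B" "A \<le> D" "B + D \<le> E"
          for a b a' b' h A B D E :: real using that by linarith
        ultimately show ?thesis unfolding incr_def by blast
      qed
    qed
  qed
qed

section \<open>Almost maximal directional derivatives\<close>

text \<open>
  How far the increments of a competitor may deviate if its value exceeds the current one by g. The
  fourth root is what detours achieve: directions within kappa of v cost sqrt kappa in increments
  and gain at least of order kappa^2. The summand g absorbs a change of the derivative by g,
  see om_add.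
\<close>
definition om :: "real \<Rightarrow> real \<Rightarrow> real" where "om K g = K * sqrt (sqrt g) + g"

lemma om_mono: "0 \<le> K \<Longrightarrow> g \<le> g' \<Longrightarrow> om K g \<le> om K g'"
  unfolding om_def by (intro add_mono mult_left_mono) auto

lemma om_add: "0 \<le> K \<Longrightarrow> 0 \<le> g1 \<Longrightarrow> 0 \<le> g2 \<Longrightarrow> om K g2 + g1 \<le> om K (g1 + g2)"
proof -
  assume a: "0 \<le> K" "0 \<le> g1" "0 \<le> g2"
  have "K * sqrt (sqrt g2) \<le> K * sqrt (sqrt (g1 + g2))" using a by (intro mult_left_mono) auto
  then show ?thesis unfolding om_def by simp
qed

lemma om_zero [simp]: "om K 0 = 0" by (simp add: om_def)

lemma tendsto_om: "(g \<longlongrightarrow> l) F \<Longrightarrow> ((\<lambda>n. om K (g n)) \<longlongrightarrow> om K l) F"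
  unfolding om_def by (intro tendsto_intros)

text \<open>
  The weight of the penalty of step k, the deviation of increments tolerated at step k, and the
  precision of the maximisation at step k. The latter is chosen such that a direction with penalty
  wt k |w - v|^2 at most tol k has sqrt |w - v| at most slack k / 400, by which it can affect
  increments only slightly.
\<close>
definition wt :: "nat \<Rightarrow> real" where "wt k = (1/2)^k"
definition slack :: "nat \<Rightarrow> real" where "slack k = (1/4)^k"
definition tol :: "nat \<Rightarrow> real" where "tol k = wt k * (slack k / 400)^4"

lemma wt_pos: "0 < wt k" and slack_pos: "0 < slack k" and tol_pos: "0 < tol k"
  by (simp_all add: wt_def slack_def tol_def)

lemma slack_Suc: "slack (Suc k) = slack k / 4" by (simp add: slack_def)
lemma slack_le_1: "slack k \<le> 1" by (simp add: slack_def power_le_one)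
lemma sum_wt: "(\<Sum>k<n. wt k) \<le> 2" unfolding wt_def by (simp add: geometric_sum)

lemma slack_tendsto: "slack \<longlonglongrightarrow> 0" unfolding slack_def by (intro LIMSEQ_power_zero) auto
lemma tol_tendsto: "tol \<longlonglongrightarrow> 0"
proof -
  have "wt \<longlonglongrightarrow> 0" unfolding wt_def by (intro LIMSEQ_power_zero) auto
  from tendsto_mult[OF this tendsto_power[OF tendsto_divide[OF slack_tendsto tendsto_const[of 400]], of 4]]
  show ?thesis unfolding tol_def by simp
qed

lemma Cauchy_if_dist_le_null_sequence:
  fixes F :: "nat \<Rightarrow> 'a::metric_space"
  assumes F: "\<And>n m. n < m \<Longrightarrow> dist (F m) (F n) \<le> r n" and r: "r \<longlonglongrightarrow> (0::real)"
  shows "Cauchy F"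
proof (rule metric_CauchyI)
  fix \<epsilon> :: real assume "0 < \<epsilon>"
  then obtain N where N: "r N < \<epsilon> / 2" using order_tendstoD(2)[OF r, of "\<epsilon> / 2"] by (auto simp: eventually_sequentially)
  have "dist (F m) (F n) < \<epsilon>" if "N < m" "N < n" for m n
    using dist_triangle2[of "F m" "F n" "F N"] F[OF that(1)] F[OF that(2)] N by linarith
  then show "\<exists>M. \<forall>m\<ge>M. \<forall>n\<ge>M. dist (F m) (F n) < \<epsilon>" by (intro exI[of _ "Suc N"]) auto
qed

text \<open>
  The search for an almost maximal directional derivative at points of the intersection of the open
  sets G n. A state (x, v, p, delta, theta) consists of a point x of the intersection, a direction
  v, the derivative p of f at x in direction v, a radius delta and the penalty theta accumulated so
  far.
\<close>
locale direction_search =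
  fixes f :: "('n::finite) heis \<Rightarrow> real" and G :: "nat \<Rightarrow> 'n heis set" and e :: "'n hvec"
    and K :: real and x00 :: "'n heis" and p00 :: real
  assumes hf: "hlip f" and openG: "\<And>n. open (G n)" and norm_e: "norm e = 1" and K: "0 \<le> K"
    and start: "x00 \<in> (\<Inter>n. G n)" "dird f x00 e p00"
begin

definition adm :: "'n heis \<Rightarrow> 'n hvec \<Rightarrow> real \<Rightarrow> bool" where
  "adm y w q \<longleftrightarrow> y \<in> (\<Inter>n. G n) \<and> dird f y w q"

definition pen :: "nat \<Rightarrow> 'n hvec \<Rightarrow> ('n hvec \<Rightarrow> real) \<Rightarrow> 'n hvec \<Rightarrow> real" where
  "pen n v \<theta> w = \<theta> w + wt n * (norm (w - v))\<^sup>2"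

lemma pen_self [simp]: "pen n v \<theta> v = \<theta> v" by (simp add: pen_def)
lemma pen_ge: "\<theta> w \<le> pen n v \<theta> w" using wt_pos[of n] by (simp add: pen_def)

text \<open>
  The competitors of a state. Their penalised value is at least the current one, and their increments
  in the current direction v deviate little from those at x. The tolerance grows with the excess of
  the value. The margin epsilon keeps the inequality strict, so that it can be passed on to the
  competitors of a competitor.
\<close>
definition nearby :: "nat \<Rightarrow> 'n heis \<times> 'n hvec \<times> real \<times> real \<times> ('n hvec \<Rightarrow> real) \<Rightarrow> real \<Rightarrow> 'n heis \<Rightarrow> 'n hvec \<Rightarrow> real \<Rightarrow> bool" where
  "nearby n s \<epsilon> y w q \<longleftrightarrow> (case s of (x, v, p, \<delta>, \<theta>) \<Rightarrow> adm y w q \<and> dist y x < \<delta> \<and> p - \<theta> v \<le> q - pen n v \<theta> w \<and>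
     close_incr f v x y (slack n - \<epsilon> + om K (q - pen n v \<theta> w - (p - \<theta> v))))"

text \<open>
  The penalty of the initial state keeps all directions within 1/2 of e (see near_e), and the
  Lipschitz constant on that ball stays bounded because the weights are summable.
\<close>
definition nice :: "nat \<Rightarrow> ('n hvec \<Rightarrow> real) \<Rightarrow> bool" where
  "nice n \<theta> \<longleftrightarrow> continuous_on UNIV \<theta> \<and> (\<forall>w. 16 * (norm (w - e))\<^sup>2 \<le> \<theta> w) \<and>
     (\<forall>v w. norm (v - e) \<le> 1/2 \<longrightarrow> norm (w - e) \<le> 1/2 \<longrightarrow> \<bar>\<theta> v - \<theta> w\<bar> \<le> (4 * (16 + (\<Sum>k<n. wt k))) * norm (v - w))"

text \<open>
  The state is almost maximal among its own competitors, in terms of the penalty without the summand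
  centred at v; the lower bound -2 is what near_e needs.
\<close>
definition good :: "nat \<Rightarrow> 'n heis \<times> 'n hvec \<times> real \<times> real \<times> ('n hvec \<Rightarrow> real) \<Rightarrow> bool" where
  "good n s \<longleftrightarrow> (case s of (x, v, p, \<delta>, \<theta>) \<Rightarrow> adm x v p \<and> 0 < \<delta> \<and> nice n \<theta> \<and> -2 \<le> p - \<theta> v \<and>
     (\<forall>\<epsilon> y w q. 0 < \<epsilon> \<longrightarrow> nearby n s \<epsilon> y w q \<longrightarrow> q - \<theta> w \<le> p - \<theta> v + tol n))"

text \<open>
  The last two conditions express almost maximality of the new state among the competitors of the old
  one, and that competitors of the new state are competitors of the old one.
\<close>
definition next_state :: "nat \<Rightarrow> 'n heis \<times> 'n hvec \<times> real \<times> real \<times> ('n hvec \<Rightarrow> real) \<Rightarrow> 'n heis \<times> 'n hvec \<times> real \<times> real \<times> ('n hvec \<Rightarrow> real) \<Rightarrow> bool" where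
  "next_state n s s' \<longleftrightarrow> (case s of (x, v, p, \<delta>, \<theta>) \<Rightarrow> case s' of (x', v', p', \<delta>', \<theta>') \<Rightarrow>
     (\<exists>\<epsilon>>0. nearby n s \<epsilon> x' v' p') \<and> \<theta>' = pen n v \<theta> \<and> \<delta>' \<le> \<delta> / 2 \<and> dist x' x + \<delta>' < \<delta> \<and> cball x' \<delta>' \<subseteq> G n \<and>
     (\<forall>\<epsilon> y w q. 0 < \<epsilon> \<longrightarrow> nearby n s \<epsilon> y w q \<longrightarrow> q - \<theta>' w \<le> p' - \<theta>' v' + tol (Suc n)) \<and>
     (\<exists>\<epsilon>'>0. \<forall>\<epsilon> y w q. 0 < \<epsilon> \<longrightarrow> nearby (Suc n) s' \<epsilon> y w q \<longrightarrow> nearby n s \<epsilon>' y w q))"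

text \<open>
  A derivative in direction w is at most |w|, which the penalty outweighs away from e.
\<close>
lemma near_e:
  assumes "adm y w q" "-2 \<le> q - \<theta> w" "nice n \<theta>"
  shows "norm (w - e) \<le> 1/2"
proof (rule ccontr)
  assume "\<not> norm (w - e) \<le> 1/2"
  then have r: "1/2 < norm (w - e)" by simp
  have "\<bar>q\<bar> \<le> norm w" using assms(1) abs_dird_le[OF hf] unfolding adm_def by blast
  also have "\<dots> \<le> norm e + norm (w - e)" by (metis add.commute diff_add_cancel norm_triangle_ineq)
  finally have "q \<le> 1 + norm (w - e)" using norm_e by simp
  moreover have "16 * (norm (w - e))\<^sup>2 \<le> \<theta> w" using assms(3) unfolding nice_def by blast
  moreover have "8 * norm (w - e) < 16 * (norm (w - e))\<^sup>2"
  proof -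
    have "norm (w - e) * 1 < norm (w - e) * (2 * norm (w - e))" using r by (intro mult_strict_left_mono) auto
    then show ?thesis by (simp add: power2_eq_square)
  qed
  ultimately show False using assms(2) r by linarith
qed

lemma norm_square_diff_le:
  assumes "norm (a - e) \<le> 1/2" "norm (b - e) \<le> 1/2" "norm (v - e) \<le> 1/2"
  shows "\<bar>(norm (a - v))\<^sup>2 - (norm (b - v))\<^sup>2\<bar> \<le> 4 * norm (a - b)"
proof -
  have "(norm (a - v))\<^sup>2 - (norm (b - v))\<^sup>2 = (norm (a - v) - norm (b - v)) * (norm (a - v) + norm (b - v))"
    by (simp add: power2_eq_square algebra_simps)
  moreover have "\<bar>norm (a - v) + norm (b - v)\<bar> = norm (a - v) + norm (b - v)" by simp
  ultimately have "\<bar>(norm (a - v))\<^sup>2 - (norm (b - v))\<^sup>2\<bar> = \<bar>norm (a - v) - norm (b - v)\<bar> * (norm (a - v) + norm (b - v))"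
    by (simp only: abs_mult)
  also have "\<dots> \<le> norm (a - b) * 4"
  proof (rule mult_mono)
    show "\<bar>norm (a - v) - norm (b - v)\<bar> \<le> norm (a - b)" using norm_triangle_ineq3[of "a - v" "b - v"] by simp
    have "norm (a - v) \<le> norm (a - e) + norm (v - e)" "norm (b - v) \<le> norm (b - e) + norm (v - e)"
      using norm_triangle_ineq4[of "a - e" "v - e"] norm_triangle_ineq4[of "b - e" "v - e"] by auto
    then show "norm (a - v) + norm (b - v) \<le> 4" using assms by linarith
  qed auto
  finally show ?thesis by simp
qed

lemma nice_pen:
  assumes "nice n \<theta>" "norm (v - e) \<le> 1/2" shows "nice (Suc n) (pen n v \<theta>)"
proof -
  have "\<bar>pen n v \<theta> a - pen n v \<theta> b\<bar> \<le> (4 * (16 + (\<Sum>k<Suc n. wt k))) * norm (a - b)"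
    if ab: "norm (a - e) \<le> 1/2" "norm (b - e) \<le> 1/2" for a b
  proof -
    have "wt n * \<bar>(norm (a - v))\<^sup>2 - (norm (b - v))\<^sup>2\<bar> \<le> wt n * (4 * norm (a - b))"
      using norm_square_diff_le[OF ab assms(2)] wt_pos[of n] by (intro mult_left_mono) auto
    moreover have "\<bar>\<theta> a - \<theta> b\<bar> \<le> (4 * (16 + (\<Sum>k<n. wt k))) * norm (a - b)"
      using assms(1) ab unfolding nice_def by blast
    moreover have "pen n v \<theta> a - pen n v \<theta> b = (\<theta> a - \<theta> b) + wt n * ((norm (a - v))\<^sup>2 - (norm (b - v))\<^sup>2)"
      by (simp add: pen_def algebra_simps)
    then have "\<bar>pen n v \<theta> a - pen n v \<theta> b\<bar> \<le> \<bar>\<theta> a - \<theta> b\<bar> + wt n * \<bar>(norm (a - v))\<^sup>2 - (norm (b - v))\<^sup>2\<bar>"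
      using wt_pos[of n] abs_triangle_ineq by (metis abs_mult abs_of_pos)
    ultimately show ?thesis by (simp add: algebra_simps)
  qed
  moreover have "continuous_on UNIV (pen n v \<theta>)"
    using assms(1) unfolding nice_def pen_def by (intro continuous_intros) auto
  moreover have "16 * (norm (w - e))\<^sup>2 \<le> pen n v \<theta> w" for w
    using assms(1) pen_ge[of \<theta> w n v] order_trans unfolding nice_def by blast
  ultimately show ?thesis unfolding nice_def by blast
qed

text \<open>
  The state is maximal up to tol n, so a competitor cannot afford a penalty wt n |w - v|^2 larger than
  tol n.
\<close>
lemma good_nearby_bounds:
  assumes "good n (x, v, p, \<delta>, \<theta>)" "nearby n (x, v, p, \<delta>, \<theta>) \<epsilon> y w q" "0 < \<epsilon>"
  shows "norm (v - e) \<le> 1/2" "norm (w - e) \<le> 1/2" "norm (w - v) \<le> (slack n / 400)\<^sup>2"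
    "\<bar>pen n v \<theta> w - pen n v \<theta> v\<bar> \<le> 72 * norm (w - v)" "0 \<le> q - pen n v \<theta> w - (p - \<theta> v)" "q - pen n v \<theta> w - (p - \<theta> v) \<le> tol n"
proof -
  have g: "adm x v p" "nice n \<theta>" "-2 \<le> p - \<theta> v"
    using assms(1) unfolding good_def prod.case by auto
  have g4: "q - \<theta> w \<le> p - \<theta> v + tol n"
    using assms unfolding good_def prod.case by blast
  note g = g g4
  have nb: "adm y w q" "p - \<theta> v \<le> q - pen n v \<theta> w" using assms(2) unfolding nearby_def by auto
  show v: "norm (v - e) \<le> 1/2" using near_e[OF g(1) g(3) g(2)] .
  have np: "nice (Suc n) (pen n v \<theta>)" by (rule nice_pen[OF g(2) v])
  show w: "norm (w - e) \<le> 1/2" using near_e[OF nb(1) _ np] nb(2) g(3) by linarith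
  show "0 \<le> q - pen n v \<theta> w - (p - \<theta> v)" using nb(2) by simp
  show "q - pen n v \<theta> w - (p - \<theta> v) \<le> tol n" using g(4) pen_ge[of \<theta> w n v] by linarith
  have "wt n * (norm (w - v))\<^sup>2 \<le> tol n" using nb(2) g(4) unfolding pen_def by linarith
  then have "(norm (w - v))\<^sup>2 \<le> (slack n / 400)^4" unfolding tol_def using wt_pos[of n] by simp
  also have "\<dots> = ((slack n / 400)\<^sup>2)\<^sup>2" by (simp add: power2_eq_square power4_eq_xxxx)
  finally show "norm (w - v) \<le> (slack n / 400)\<^sup>2" by (rule power2_le_imp_le) simp
  have "\<bar>pen n v \<theta> w - pen n v \<theta> v\<bar> \<le> (4 * (16 + (\<Sum>k<Suc n. wt k))) * norm (w - v)"
    using np v w unfolding nice_def by blast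
  also have "\<dots> \<le> 72 * norm (w - v)" using sum_wt[of "Suc n"] by (intro mult_right_mono) auto
  finally show "\<bar>pen n v \<theta> w - pen n v \<theta> v\<bar> \<le> 72 * norm (w - v)" .
qed

text \<open>
  Competitors of a competitor are competitors, if they meet the smaller tolerance slack n / 4 of the
  next step. The increments are handled by close_incr_trans, which uses up part of the margin epsilon
  of the intermediate competitor.
\<close>
lemma nearby_trans:
  assumes good: "good n (x, v, p, \<delta>, \<theta>)" and nb: "nearby n (x, v, p, \<delta>, \<theta>) \<epsilon> x' v' p'" "0 < \<epsilon>"
  obtains \<epsilon>' \<delta>' where "\<epsilon>' > 0" "\<delta>' > 0"
    "\<And>y w q g. adm y w q \<Longrightarrow> dist y x' < \<delta>' \<Longrightarrow> 0 \<le> g \<Longrightarrow> g \<le> q - pen n v \<theta> w - (p' - pen n v \<theta> v') \<Longrightarrow>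
       close_incr f v' x' y (slack n / 4 + om K g) \<Longrightarrow> nearby n (x, v, p, \<delta>, \<theta>) \<epsilon>' y w q"
proof -
  note b = good_nearby_bounds[OF good nb]
  define g1 where "g1 = p' - pen n v \<theta> v' - (p - \<theta> v)"
  have g1: "0 \<le> g1" using b(5) unfolding g1_def .
  have n: "adm x' v' p'" "dist x' x < \<delta>" "close_incr f v x x' (slack n - \<epsilon> + om K g1)"
    using nb(1) unfolding nearby_def g1_def by auto
  have xp: "dird f x v p" using good unfolding good_def adm_def by simp
  have x'p: "dird f x' v' p'" using n(1) unfolding adm_def by simp
  define m where "m = norm (v' - v)"
  define \<sigma> where "\<sigma> = slack n"
  have \<sigma>: "0 < \<sigma>" "\<sigma> \<le> 1" unfolding \<sigma>_def using slack_pos slack_le_1 by auto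
  have m: "0 \<le> m" "m \<le> (\<sigma> / 400)\<^sup>2" using b(3) unfolding m_def \<sigma>_def by auto
  have sm: "sqrt m \<le> \<sigma> / 400" using m \<sigma> by (intro real_le_lsqrt) auto
  have "(\<sigma> / 400)\<^sup>2 \<le> \<sigma> / 400 * 1" unfolding power2_eq_square using \<sigma> by (intro mult_left_mono) auto
  then have m2: "m \<le> \<sigma> / 400" using m by linarith
  have "norm v' \<le> norm e + norm (v' - e)" by (metis add.commute diff_add_cancel norm_triangle_ineq)
  then have v'2: "norm v' \<le> 2" using b(2) norm_e by simp
  have vv': "norm (v - v') \<le> 1" using m2 \<sigma> unfolding m_def by (simp add: norm_minus_commute)
  define \<epsilon>' where "\<epsilon>' = min (\<epsilon> / 2) (\<sigma> / 8)"
  have \<epsilon>': "0 < \<epsilon>'" "\<epsilon>' \<le> \<epsilon> / 2" "\<epsilon>' \<le> \<sigma> / 8" using nb(2) \<sigma> unfolding \<epsilon>'_def by auto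
  obtain \<delta>1 where \<delta>1: "\<delta>1 > 0" "\<And>y c c2. dist y x' < \<delta>1 \<Longrightarrow> close_incr f v' x' y c2 \<Longrightarrow> (slack n - \<epsilon> + om K g1) + \<epsilon>' \<le> c \<Longrightarrow>
      5 * sqrt (norm (v - v')) + \<bar>p' - p\<bar> + c2 + \<epsilon>' \<le> c \<Longrightarrow> close_incr f v x y c"
    using close_incr_trans[OF hf xp x'p n(3) v'2 vv' \<epsilon>'(1)] by blast
  show ?thesis
  proof (rule that[OF \<epsilon>'(1), of "min \<delta>1 (\<delta> - dist x' x)"])
    show "0 < min \<delta>1 (\<delta> - dist x' x)" using \<delta>1(1) n(2) by simp
    fix y w q g assume y: "adm y w q" "dist y x' < min \<delta>1 (\<delta> - dist x' x)" "0 \<le> g"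
      "g \<le> q - pen n v \<theta> w - (p' - pen n v \<theta> v')" "close_incr f v' x' y (slack n / 4 + om K g)"
    define h where "h = q - pen n v \<theta> w - (p - \<theta> v)"
    have h: "g1 + g \<le> h" using y(4) unfolding h_def g1_def by linarith
    have omh: "om K g + g1 \<le> om K h" using om_add[OF K g1 y(3)] om_mono[OF K h] by linarith
    have omh1: "om K g1 \<le> om K h" by (rule om_mono[OF K]) (use h y(3) in linarith)
    have "close_incr f v x y (\<sigma> - \<epsilon>' + om K h)"
    proof (rule \<delta>1(2)[OF _ y(5)])
      show "dist y x' < \<delta>1" using y(2) by simp
      show "(slack n - \<epsilon> + om K g1) + \<epsilon>' \<le> \<sigma> - \<epsilon>' + om K h" using omh1 \<epsilon>' unfolding \<sigma>_def by linarith
      have "\<bar>p' - p\<bar> \<le> g1 + 72 * m" using b(4) g1 unfolding g1_def m_def by simp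
      then show "5 * sqrt (norm (v - v')) + \<bar>p' - p\<bar> + (slack n / 4 + om K g) + \<epsilon>' \<le> \<sigma> - \<epsilon>' + om K h"
        using sm m2 omh \<epsilon>'(3) \<sigma> unfolding m_def \<sigma>_def by (simp add: norm_minus_commute)
    qed
    moreover have "dist y x < \<delta>" using y(2) dist_triangle[of y x x'] by linarith
    moreover have "p - \<theta> v \<le> q - pen n v \<theta> w" using h g1 y(3) unfolding h_def by linarith
    ultimately show "nearby n (x, v, p, \<delta>, \<theta>) \<epsilon>' y w q"
      using y(1) unfolding nearby_def h_def \<sigma>_def by simp
  qed
qed

text \<open>
  The new state is a competitor whose value is within tol (Suc n) of the supremum.
\<close>
lemma step:
  assumes good: "good n s" shows "\<exists>s'. good (Suc n) s' \<and> next_state n s s'"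
proof -
  obtain x v p \<delta> \<theta> where s: "s = (x, v, p, \<delta>, \<theta>)" by (metis prod_cases5)
  note good = good[unfolded s]
  have g: "adm x v p" "0 < \<delta>" "nice n \<theta>" "-2 \<le> p - \<theta> v"
    "\<And>\<epsilon> y w q. 0 < \<epsilon> \<Longrightarrow> nearby n (x, v, p, \<delta>, \<theta>) \<epsilon> y w q \<Longrightarrow> q - \<theta> w \<le> p - \<theta> v + tol n"
    using good unfolding good_def by auto
  define S where "S = {r. \<exists>\<epsilon> y w q. 0 < \<epsilon> \<and> nearby n (x, v, p, \<delta>, \<theta>) \<epsilon> y w q \<and> r = q - pen n v \<theta> w}"
  have self: "nearby n (x, v, p, \<delta>, \<theta>) (slack n) x v p"
    using g(1,2) unfolding nearby_def by (simp add: close_incr_refl)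
  then have "S \<noteq> {}" unfolding S_def using slack_pos[of n] by blast
  have "bdd_above S"
  proof (rule bdd_aboveI[of _ "p - \<theta> v + tol n"])
    fix r assume "r \<in> S"
    then obtain \<epsilon> y w q where r: "0 < \<epsilon>" "nearby n (x, v, p, \<delta>, \<theta>) \<epsilon> y w q" "r = q - pen n v \<theta> w" unfolding S_def by blast
    show "r \<le> p - \<theta> v + tol n" using good_nearby_bounds(6)[OF good r(2,1)] r(3) by linarith
  qed
  have "\<exists>r\<in>S. Sup S - tol (Suc n) < r"
    using less_cSup_iff[OF \<open>S \<noteq> {}\<close> \<open>bdd_above S\<close>, of "Sup S - tol (Suc n)"] tol_pos[of "Suc n"] by simp
  then obtain \<epsilon> x' v' p' where nb: "0 < \<epsilon>" "nearby n (x, v, p, \<delta>, \<theta>) \<epsilon> x' v' p'" "Sup S - tol (Suc n) < p' - pen n v \<theta> v'"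
    unfolding S_def by blast
  have sup: "q - pen n v \<theta> w \<le> p' - pen n v \<theta> v' + tol (Suc n)" if "0 < \<epsilon>" "nearby n (x, v, p, \<delta>, \<theta>) \<epsilon> y w q" for \<epsilon> y w q
  proof -
    have "q - pen n v \<theta> w \<in> S" using that unfolding S_def by blast
    then show ?thesis using cSup_upper[OF _ \<open>bdd_above S\<close>] nb(3) by fastforce
  qed
  obtain \<epsilon>' \<delta>1 where tr: "\<epsilon>' > 0" "\<delta>1 > 0"
    "\<And>y w q g. adm y w q \<Longrightarrow> dist y x' < \<delta>1 \<Longrightarrow> 0 \<le> g \<Longrightarrow> g \<le> q - pen n v \<theta> w - (p' - pen n v \<theta> v') \<Longrightarrow>
       close_incr f v' x' y (slack n / 4 + om K g) \<Longrightarrow> nearby n (x, v, p, \<delta>, \<theta>) \<epsilon>' y w q"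
    using nearby_trans[OF good nb(2,1)] by blast
  have n: "adm x' v' p'" "dist x' x < \<delta>" "p - \<theta> v \<le> p' - pen n v \<theta> v'" using nb(2) unfolding nearby_def by auto
  have "x' \<in> G n" using n(1) unfolding adm_def by blast
  then obtain r where r: "r > 0" "cball x' r \<subseteq> G n" using openG open_contains_cball by blast
  define \<delta>' where "\<delta>' = min (min \<delta>1 r) (min (\<delta> / 2) ((\<delta> - dist x' x) / 2))"
  have \<delta>': "0 < \<delta>'" "\<delta>' \<le> \<delta>1" "\<delta>' \<le> r" "\<delta>' \<le> \<delta> / 2" "\<delta>' \<le> (\<delta> - dist x' x) / 2"
  proof -
    show "0 < \<delta>'" using tr(2) r(1) g(2) n(2) unfolding \<delta>'_def by simp
    show "\<delta>' \<le> \<delta>1" "\<delta>' \<le> r" "\<delta>' \<le> \<delta> / 2" "\<delta>' \<le> (\<delta> - dist x' x) / 2"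
      unfolding \<delta>'_def by (meson min.cobounded1 min.cobounded2 order_trans)+
  qed
  define s' where "s' = (x', v', p', \<delta>', pen n v \<theta>)"
  have sub: "nearby n (x, v, p, \<delta>, \<theta>) \<epsilon>' y w q" if "0 < \<epsilon>2" "nearby (Suc n) s' \<epsilon>2 y w q" for \<epsilon>2 y w q
  proof -
    define g where "g = q - pen (Suc n) v' (pen n v \<theta>) w - (p' - pen n v \<theta> v')"
    have nn: "adm y w q" "dist y x' < \<delta>'" "0 \<le> g" "close_incr f v' x' y (slack (Suc n) - \<epsilon>2 + om K g)"
      using that(2) unfolding nearby_def s'_def g_def by auto
    show ?thesis
    proof (rule tr(3)[OF nn(1) _ nn(3)])
      show "dist y x' < \<delta>1" using nn(2) \<delta>' by simp
      show "g \<le> q - pen n v \<theta> w - (p' - pen n v \<theta> v')" unfolding g_def using pen_ge[of "pen n v \<theta>" w "Suc n" v'] by linarith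
      show "close_incr f v' x' y (slack n / 4 + om K g)"
        by (rule close_incr_mono[OF nn(4)]) (use that(1) in \<open>simp add: slack_Suc\<close>)
    qed
  qed
  have "norm (v - e) \<le> 1/2" using good_nearby_bounds(1)[OF good nb(2,1)] .
  then have "nice (Suc n) (pen n v \<theta>)" by (rule nice_pen[OF g(3)])
  then have "good (Suc n) s'"
    unfolding good_def s'_def prod.case
  proof (intro conjI allI impI)
    fix \<epsilon>2 y w q assume "0 < \<epsilon>2" "nearby (Suc n) (x', v', p', \<delta>', pen n v \<theta>) \<epsilon>2 y w q"
    from sup[OF tr(1) sub[unfolded s'_def, OF this]]
    show "q - pen n v \<theta> w \<le> p' - pen n v \<theta> v' + tol (Suc n)" .
  qed (use n \<delta>'(1) g(4) in auto)
  moreover have "next_state n s s'"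
    unfolding next_state_def s s'_def
    unfolding prod.case
  proof (intro conjI allI impI)
    show "\<exists>\<epsilon>>0. nearby n (x, v, p, \<delta>, \<theta>) \<epsilon> x' v' p'" using nb(1,2) by blast
    show "dist x' x + \<delta>' < \<delta>" using \<delta>'(5) n(2) by (simp add: field_simps)
    show "cball x' \<delta>' \<subseteq> G n" using \<delta>'(3) r(2) by force
    show "\<exists>\<epsilon>'>0. \<forall>\<epsilon> y w q. 0 < \<epsilon> \<longrightarrow> nearby (Suc n) (x', v', p', \<delta>', pen n v \<theta>) \<epsilon> y w q \<longrightarrow> nearby n (x, v, p, \<delta>, \<theta>) \<epsilon>' y w q"
      using sub[unfolded s'_def] tr(1) by blast
  qed (use \<delta>'(4) sup in blast)+
  ultimately show ?thesis by blast
qed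

lemma initial: "\<exists>x v p. good 0 (x, v, p, 1, \<lambda>w. 16 * (norm (w - e))\<^sup>2)"
proof -
  let ?\<theta> = "\<lambda>w. 16 * (norm (w - e))\<^sup>2"
  define S where "S = {r. \<exists>y w q. adm y w q \<and> r = q - ?\<theta> w}"
  have "adm x00 e p00" using start unfolding adm_def by blast
  then have p00: "p00 \<in> S" unfolding S_def by (intro CollectI exI[of _ x00] exI[of _ e] exI[of _ p00]) simp
  have "bdd_above S"
  proof (rule bdd_aboveI[of _ 2])
    fix r assume "r \<in> S"
    then obtain y w q where r: "adm y w q" "r = q - ?\<theta> w" unfolding S_def by blast
    define a where "a = norm (w - e)"
    have "\<bar>q\<bar> \<le> norm w" using r(1) abs_dird_le[OF hf] unfolding adm_def by blast
    also have "\<dots> \<le> norm e + norm (w - e)" by (metis add.commute diff_add_cancel norm_triangle_ineq)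
    finally have "q \<le> 1 + a" using norm_e unfolding a_def by simp
    moreover have "a \<le> 1 + 16 * a\<^sup>2"
    proof -
      have "2 * a \<le> 1 + a\<^sup>2" using zero_le_power2[of "a - 1"] by (simp add: power2_eq_square algebra_simps)
      moreover have "0 \<le> a\<^sup>2" by simp
      ultimately show ?thesis by linarith
    qed
    ultimately show "r \<le> 2" using r(2) unfolding a_def by linarith
  qed
  have "\<exists>r\<in>S. Sup S - tol 0 < r"
    using less_cSup_iff[of S, OF _ \<open>bdd_above S\<close>, of "Sup S - tol 0"] tol_pos[of 0] p00 by auto
  then obtain x v p where x: "adm x v p" "Sup S - tol 0 < p - ?\<theta> v" unfolding S_def by blast
  have up: "q - ?\<theta> w \<le> p - ?\<theta> v + tol 0" if "adm y w q" for y w q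
  proof -
    have "q - ?\<theta> w \<in> S" using that unfolding S_def by blast
    then show ?thesis using cSup_upper[OF _ \<open>bdd_above S\<close>] x(2) by fastforce
  qed
  have "\<bar>p00\<bar> \<le> 1" using abs_dird_le[OF hf start(2)] norm_e by simp
  moreover have "p00 \<le> Sup S" by (rule cSup_upper[OF p00 \<open>bdd_above S\<close>])
  moreover have "tol 0 \<le> 1" by (simp add: tol_def wt_def slack_def power_le_one)
  ultimately have "-2 \<le> p - ?\<theta> v" using x(2) by linarith
  moreover have "nice 0 ?\<theta>"
  proof -
    have "\<bar>16 * (norm (a - e))\<^sup>2 - 16 * (norm (b - e))\<^sup>2\<bar> \<le> 64 * norm (a - b)"
      if "norm (a - e) \<le> 1/2" "norm (b - e) \<le> 1/2" for a b
      using norm_square_diff_le[OF that, of e] by simp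
    then show ?thesis unfolding nice_def by (auto intro!: continuous_intros)
  qed
  ultimately have "good 0 (x, v, p, 1, ?\<theta>)"
    unfolding good_def nearby_def using x(1) up by auto
  then show ?thesis by blast
qed

text \<open>
  The states of an infinite run have nested sets of competitors, so points, directions and increments
  converge. The increments at x in direction v are within err n |t| of those of state n, where err n
  tends to 0; therefore the derivatives P n converge to the derivative p at x in direction v, and
  (x, v, p) is a competitor of every state. A triple that beats (x, v, p) by eta in the sense of the
  statement would then be a competitor of every late state as well, by nearby_trans, although the
  states are maximal up to tol n. The quadratic term of the total penalty has coefficient
  16 + 1 + 1/2 + ... = 18, and xi is its gradient at v.
\<close>
theorem almost_maximal_direction:
  obtains x v p \<xi> where "x \<in> (\<Inter>n. G n)" "norm (v - e) \<le> 1/2" "dird f x v p"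
    "\<And>\<eta>. 0 < \<eta> \<Longrightarrow> \<exists>\<delta>>0. \<forall>y w q. y \<in> (\<Inter>n. G n) \<longrightarrow> dist y x < \<delta> \<longrightarrow> norm (w - v) \<le> 1 \<longrightarrow> dird f y w q \<longrightarrow>
       \<eta> \<le> q - p - \<xi> \<bullet> (w - v) - 20 * (norm (w - v))\<^sup>2 \<longrightarrow>
       \<not> close_incr f v x y (om K ((q - p - \<xi> \<bullet> (w - v) - 20 * (norm (w - v))\<^sup>2) / 2))"
proof -
  define \<theta>0 where "\<theta>0 = (\<lambda>w::'n hvec. 16 * (norm (w - e))\<^sup>2)"
  obtain x0 v0 p0 where init: "good 0 (x0, v0, p0, 1, \<theta>0)" using initial unfolding \<theta>0_def by blast
  have "\<exists>s. \<forall>n. (good n (s n) \<and> (n = 0 \<longrightarrow> s n = (x0, v0, p0, 1, \<theta>0))) \<and> next_state n (s n) (s (Suc n))"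
  proof (rule dependent_nat_choice)
    show "\<exists>s. good 0 s \<and> (0 = (0::nat) \<longrightarrow> s = (x0, v0, p0, 1, \<theta>0))" using init by blast
    show "\<exists>s'. (good (Suc n) s' \<and> (Suc n = 0 \<longrightarrow> s' = (x0, v0, p0, 1, \<theta>0))) \<and> next_state n s s'"
      if "good n s \<and> (n = 0 \<longrightarrow> s = (x0, v0, p0, 1, \<theta>0))" for s n
      using step[of n s] that by auto
  qed
  then obtain s where s: "\<And>n. good n (s n)" "s 0 = (x0, v0, p0, 1, \<theta>0)" "\<And>n. next_state n (s n) (s (Suc n))" by blast
  define X V P \<Delta> \<Theta> where "X n = fst (s n)" and "V n = fst (snd (s n))" and "P n = fst (snd (snd (s n)))"
    and "\<Delta> n = fst (snd (snd (snd (s n))))" and "\<Theta> n = snd (snd (snd (snd (s n))))" for n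
  have sn: "s n = (X n, V n, P n, \<Delta> n, \<Theta> n)" for n unfolding X_def V_def P_def \<Delta>_def \<Theta>_def by simp
  define nb where "nb n = nearby n (X n, V n, P n, \<Delta> n, \<Theta> n)" for n
  define val where "val n w q = q - pen n (V n) (\<Theta> n) w" for n w q
  have gd: "good n (X n, V n, P n, \<Delta> n, \<Theta> n)" for n using s(1)[of n] unfolding sn .
  have nbdef: "nb n \<epsilon> y w q \<longleftrightarrow> adm y w q \<and> dist y (X n) < \<Delta> n \<and> P n - \<Theta> n (V n) \<le> val n w q \<and>
      close_incr f (V n) (X n) y (slack n - \<epsilon> + om K (val n w q - (P n - \<Theta> n (V n))))" for n \<epsilon> y w q
    unfolding nb_def nearby_def val_def by simp
  have nx: "\<exists>\<epsilon>>0. nb n \<epsilon> (X (Suc n)) (V (Suc n)) (P (Suc n))" "\<Theta> (Suc n) = pen n (V n) (\<Theta> n)"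
    "\<Delta> (Suc n) \<le> \<Delta> n / 2" "dist (X (Suc n)) (X n) + \<Delta> (Suc n) < \<Delta> n" "cball (X (Suc n)) (\<Delta> (Suc n)) \<subseteq> G n"
    "\<And>\<epsilon> y w q. 0 < \<epsilon> \<Longrightarrow> nb n \<epsilon> y w q \<Longrightarrow> val n w q \<le> P (Suc n) - \<Theta> (Suc n) (V (Suc n)) + tol (Suc n)"
    "\<exists>\<epsilon>'>0. \<forall>\<epsilon> y w q. 0 < \<epsilon> \<longrightarrow> nb (Suc n) \<epsilon> y w q \<longrightarrow> nb n \<epsilon>' y w q" for n
  proof -
    note N = s(3)[of n, unfolded sn next_state_def prod.case, folded nb_def]
    show "\<exists>\<epsilon>>0. nb n \<epsilon> (X (Suc n)) (V (Suc n)) (P (Suc n))" using N by (elim conjE)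
    show pen: "\<Theta> (Suc n) = pen n (V n) (\<Theta> n)" using N by (elim conjE)
    show "\<Delta> (Suc n) \<le> \<Delta> n / 2" using N by (elim conjE)
    show "dist (X (Suc n)) (X n) + \<Delta> (Suc n) < \<Delta> n" using N by (elim conjE)
    show "cball (X (Suc n)) (\<Delta> (Suc n)) \<subseteq> G n" using N by (elim conjE)
    show "\<exists>\<epsilon>'>0. \<forall>\<epsilon> y w q. 0 < \<epsilon> \<longrightarrow> nb (Suc n) \<epsilon> y w q \<longrightarrow> nb n \<epsilon>' y w q" using N by (elim conjE)
    have "\<forall>\<epsilon> y w q. 0 < \<epsilon> \<longrightarrow> nb n \<epsilon> y w q \<longrightarrow> q - \<Theta> (Suc n) w \<le> P (Suc n) - \<Theta> (Suc n) (V (Suc n)) + tol (Suc n)"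
      using N by (elim conjE)
    then show "\<And>\<epsilon> y w q. 0 < \<epsilon> \<Longrightarrow> nb n \<epsilon> y w q \<Longrightarrow> val n w q \<le> P (Suc n) - \<Theta> (Suc n) (V (Suc n)) + tol (Suc n)"
      unfolding val_def pen[symmetric] by blast
  qed
  have g: "adm (X n) (V n) (P n)" "0 < \<Delta> n" "nice n (\<Theta> n)" for n
    using gd[of n] unfolding good_def prod.case by blast+
  have nested: "\<exists>\<epsilon>>0. nb n \<epsilon> y w q" if "0 < \<epsilon>" "nb (n + k) \<epsilon> y w q" for n k \<epsilon> y w q
    using that
  proof (induction k arbitrary: \<epsilon>)
    case 0 then show ?case by auto
  next
    case (Suc k)
    obtain \<epsilon>' where \<epsilon>': "0 < \<epsilon>'" and all: "\<forall>\<epsilon> y w q. 0 < \<epsilon> \<longrightarrow> nb (Suc (n + k)) \<epsilon> y w q \<longrightarrow> nb (n + k) \<epsilon>' y w q"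
      using nx(7)[of "n + k"] by blast
    have "nb (n + k) \<epsilon>' y w q"
      by (rule all[rule_format, OF Suc.prems(1) Suc.prems(2)[unfolded add_Suc_right]])
    then show ?case by (rule Suc.IH[OF \<epsilon>'])
  qed
  have later: "\<exists>\<epsilon>>0. nb n \<epsilon> (X m) (V m) (P m)" if "n < m" for n m
  proof -
    obtain k where k: "m = Suc (n + k)" using \<open>n < m\<close> less_iff_Suc_add by auto
    obtain \<epsilon> where "0 < \<epsilon>" "nb (n + k) \<epsilon> (X m) (V m) (P m)" using nx(1)[of "n + k"] unfolding k by blast
    then show ?thesis by (rule nested)
  qed
  note bounds = good_nearby_bounds[OF gd, folded nb_def val_def]
  have Vm: "norm (V m - V n) \<le> (slack n / 400)\<^sup>2" if "n < m" for n m using later[OF that] bounds(3) by blast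
  have slack400: "(slack n / 400)\<^sup>2 \<le> slack n" for n
  proof -
    have "(slack n / 400)\<^sup>2 \<le> slack n / 400 * 1" unfolding power2_eq_square
      using slack_pos[of n] slack_le_1[of n] by (intro mult_left_mono) auto
    then show ?thesis using slack_pos[of n] by linarith
  qed
  have "Cauchy V"
  proof (rule Cauchy_if_dist_le_null_sequence[OF _ slack_tendsto])
    fix n m :: nat assume "n < m"
    then show "dist (V m) (V n) \<le> slack n" using Vm[of n m] slack400[of n] unfolding dist_norm by linarith
  qed
  then obtain v where v: "V \<longlonglongrightarrow> v" using Cauchy_convergent_iff convergent_def by blast
  have ev: "\<forall>\<^sub>F m in sequentially. n < m" for n :: nat by (rule eventually_gt_at_top)
  have vn: "norm (v - V n) \<le> (slack n / 400)\<^sup>2" for n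
  proof (rule tendsto_upperbound[of "\<lambda>m. norm (V m - V n)" _ sequentially])
    show "(\<lambda>m. norm (V m - V n)) \<longlonglongrightarrow> norm (v - V n)" by (intro tendsto_intros v)
    show "\<forall>\<^sub>F m in sequentially. norm (V m - V n) \<le> (slack n / 400)\<^sup>2"
      using ev[of n] by eventually_elim (rule Vm)
  qed simp
  have \<Delta>n: "\<Delta> n \<le> (1/2)^n" for n
  proof (induction n)
    case 0 show ?case using s(2) sn[of 0] by simp
  next
    case (Suc n) then show ?case using nx(3)[of n] by simp
  qed
  have "Cauchy X"
  proof (rule Cauchy_if_dist_le_null_sequence)
    show "dist (X m) (X n) \<le> (1/2)^n" if "n < m" for n m using later[OF that] \<Delta>n[of n] unfolding nbdef by fastforce
    show "(\<lambda>n. (1/2::real)^n) \<longlonglongrightarrow> 0" by (intro LIMSEQ_power_zero) auto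
  qed
  then obtain x where x: "X \<longlonglongrightarrow> x" using Cauchy_convergent_iff convergent_def by blast
  have xn: "dist x (X n) \<le> \<Delta> n" for n
  proof (rule tendsto_upperbound[of "\<lambda>m. dist (X m) (X n)" _ sequentially])
    show "(\<lambda>m. dist (X m) (X n)) \<longlonglongrightarrow> dist x (X n)" by (intro tendsto_intros x)
    show "\<forall>\<^sub>F m in sequentially. dist (X m) (X n) \<le> \<Delta> n"
      using ev[of n] by eventually_elim (use later nbdef in \<open>metis less_imp_le\<close>)
  qed simp
  have xG: "x \<in> (\<Inter>n. G n)"
  proof (rule INT_I)
    fix n
    have "x \<in> cball (X (Suc n)) (\<Delta> (Suc n))" using xn[of "Suc n"] by (simp add: dist_commute)
    then show "x \<in> G n" using nx(5)[of n] by blast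
  qed
  have xlt: "dist x (X n) < \<Delta> n" for n
    using xn[of "Suc n"] nx(4)[of n] dist_triangle[of x "X n" "X (Suc n)"] by linarith
  have incr_lim: "(\<lambda>m. incr f (X m) w t) \<longlonglongrightarrow> incr f x w t" for w t
  proof -
    have "continuous_on UNIV (\<lambda>y. incr f y w t)" unfolding incr_def
      by (intro continuous_on_diff continuous_on_compose2[OF hlip_continuous[OF hf]]) (auto intro!: continuous_intros hlip_continuous[OF hf])
    then have "isCont (\<lambda>y. incr f y w t) x" using continuous_on_eq_continuous_at[OF open_UNIV] by blast
    then show ?thesis by (rule isCont_tendsto_compose[OF _ x])
  qed
  have limit_close: "close_incr f w y x c"
    if cm: "\<forall>\<^sub>F m in sequentially. close_incr f w y (X m) (c' m)" and c': "c' \<longlonglongrightarrow> c" for w y c c'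
    unfolding close_incr_def
  proof (intro allI impI)
    fix t :: real assume t: "\<bar>t\<bar> \<le> 1"
    show "\<bar>incr f x w t - incr f y w t\<bar> \<le> c * \<bar>t\<bar>"
    proof (rule tendsto_le[of sequentially])
      show "(\<lambda>m. \<bar>incr f (X m) w t - incr f y w t\<bar>) \<longlonglongrightarrow> \<bar>incr f x w t - incr f y w t\<bar>" by (intro tendsto_intros incr_lim)
      show "(\<lambda>m. c' m * \<bar>t\<bar>) \<longlonglongrightarrow> c * \<bar>t\<bar>" by (intro tendsto_intros c')
      show "\<forall>\<^sub>F m in sequentially. \<bar>incr f (X m) w t - incr f y w t\<bar> \<le> c' m * \<bar>t\<bar>"
        using cm by eventually_elim (use t in \<open>auto simp: close_incr_def\<close>)
    qed simp
  qed
  \<comment> \<open>The cost of replacing V n by v, plus the deviation tolerated at step n.\<close>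
  define err where "err n = 5 * (slack n / 400) + slack n + om K (tol n)" for n
  have err0: "err \<longlonglongrightarrow> 0"
  proof -
    have "err \<longlonglongrightarrow> 5 * (0 / 400) + 0 + om K 0" unfolding err_def
      by (intro tendsto_intros slack_tendsto tendsto_om tol_tendsto) auto
    then show ?thesis by simp
  qed
  have Vn2: "norm (V n) \<le> 2" for n
  proof -
    have "norm (V n - e) \<le> 1/2" using bounds(1)[of n] nx(1)[of n] by blast
    moreover have "norm (V n) \<le> norm e + norm (V n - e)" by (metis add.commute diff_add_cancel norm_triangle_ineq)
    ultimately show ?thesis using norm_e by linarith
  qed
  have incr_err: "\<bar>incr f x v t - incr f (X n) (V n) t\<bar> \<le> err n * \<bar>t\<bar>" if t: "\<bar>t\<bar> \<le> 1" for n t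
  proof -
    have "close_incr f (V n) (X n) x (slack n + om K (tol n))"
    proof (rule limit_close)
      show "\<forall>\<^sub>F m in sequentially. close_incr f (V n) (X n) (X m) (slack n + om K (tol n))"
        using ev[of n]
      proof eventually_elim
        case (elim m)
        then obtain \<epsilon> where \<epsilon>: "0 < \<epsilon>" "nb n \<epsilon> (X m) (V m) (P m)" using later by blast
        have "om K (val n (V m) (P m) - (P n - \<Theta> n (V n))) \<le> om K (tol n)" by (rule om_mono[OF K bounds(6)[OF \<epsilon>(2,1)]])
        then show ?case using \<epsilon> close_incr_mono unfolding nbdef by fastforce
      qed
    qed simp
    then have 1: "\<bar>incr f x (V n) t - incr f (X n) (V n) t\<bar> \<le> (slack n + om K (tol n)) * \<bar>t\<bar>" using t unfolding close_incr_def by blast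
    have "norm (v - V n) \<le> 1" using vn[of n] slack400[of n] slack_le_1[of n] by linarith
    from incr_direction_change[OF hf Vn2 this, of x t]
    have 2: "\<bar>incr f x v t - incr f x (V n) t\<bar> \<le> 5 * sqrt (norm (v - V n)) * \<bar>t\<bar>" .
    have "sqrt (norm (v - V n)) \<le> slack n / 400" using vn[of n] slack_pos[of n] by (intro real_le_lsqrt) auto
    then have "5 * sqrt (norm (v - V n)) * \<bar>t\<bar> \<le> 5 * (slack n / 400) * \<bar>t\<bar>" by (intro mult_right_mono) auto
    with 1 2 have "\<bar>incr f x v t - incr f (X n) (V n) t\<bar> \<le> 5 * (slack n / 400) * \<bar>t\<bar> + (slack n + om K (tol n)) * \<bar>t\<bar>" by linarith
    also have "\<dots> = err n * \<bar>t\<bar>" unfolding err_def by (simp add: algebra_simps)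
    finally show ?thesis .
  qed
  have near0: "\<exists>d>0. \<forall>t. \<bar>t\<bar> < d \<longrightarrow> \<bar>incr f x v t - P n * t\<bar> \<le> (err n + \<epsilon>) * \<bar>t\<bar>" if "0 < \<epsilon>" for n \<epsilon>
  proof -
    obtain d where d: "d > 0" "\<And>t. \<bar>t\<bar> < d \<Longrightarrow> \<bar>incr f (X n) (V n) t - P n * t\<bar> \<le> \<epsilon> * \<bar>t\<bar>"
      using g(1)[of n] \<open>0 < \<epsilon>\<close> unfolding adm_def dird_iff by blast
    have "\<bar>incr f x v t - P n * t\<bar> \<le> (err n + \<epsilon>) * \<bar>t\<bar>" if "\<bar>t\<bar> < min d 1" for t
      using d(2)[of t] incr_err[of t n] that unfolding distrib_right by linarith
    then show ?thesis using d(1) by (intro exI[of _ "min d 1"]) auto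
  qed
  have PP: "\<bar>P m - P n\<bar> \<le> err n + err m" for n m
  proof (rule field_le_epsilon)
    fix \<epsilon> :: real assume "0 < \<epsilon>"
    then have h: "0 < \<epsilon> / 2" by simp
    obtain d1 where d1: "d1 > 0" "\<And>t. \<bar>t\<bar> < d1 \<Longrightarrow> \<bar>incr f x v t - P n * t\<bar> \<le> (err n + \<epsilon> / 2) * \<bar>t\<bar>" using near0[OF h] by blast
    obtain d2 where d2: "d2 > 0" "\<And>t. \<bar>t\<bar> < d2 \<Longrightarrow> \<bar>incr f x v t - P m * t\<bar> \<le> (err m + \<epsilon> / 2) * \<bar>t\<bar>" using near0[OF h] by blast
    define t where "t = min d1 d2 / 2"
    have t: "0 < t" "\<bar>t\<bar> < d1" "\<bar>t\<bar> < d2" using d1(1) d2(1) unfolding t_def by auto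
    have "\<bar>P m * t - P n * t\<bar> \<le> (err n + \<epsilon> / 2) * \<bar>t\<bar> + (err m + \<epsilon> / 2) * \<bar>t\<bar>" using d1(2)[OF t(2)] d2(2)[OF t(3)] by linarith
    also have "\<dots> = (err n + err m + \<epsilon>) * t" using t(1) by (simp add: algebra_simps)
    also have "\<bar>P m * t - P n * t\<bar> = \<bar>P m - P n\<bar> * t" using t(1) by (simp add: left_diff_distrib[symmetric] abs_mult)
    finally show "\<bar>P m - P n\<bar> \<le> err n + err m + \<epsilon>" using t(1) by simp
  qed
  have "Cauchy P"
  proof (rule metric_CauchyI)
    fix \<epsilon> :: real assume "0 < \<epsilon>"
    then have "\<forall>\<^sub>F n in sequentially. err n < \<epsilon> / 2" using order_tendstoD(2)[OF err0, of "\<epsilon> / 2"] by simp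
    then obtain N where N: "\<And>n. n \<ge> N \<Longrightarrow> err n < \<epsilon> / 2" unfolding eventually_sequentially by blast
    have "dist (P m) (P n) < \<epsilon>" if "m \<ge> N" "n \<ge> N" for m n
      using PP[of m n] N[OF that(1)] N[OF that(2)] unfolding dist_real_def by linarith
    then show "\<exists>M. \<forall>m\<ge>M. \<forall>n\<ge>M. dist (P m) (P n) < \<epsilon>" by blast
  qed
  then obtain p where p: "P \<longlonglongrightarrow> p" using Cauchy_convergent_iff convergent_def by blast
  have dp: "dird f x v p" unfolding dird_iff
  proof (intro allI impI)
    fix \<epsilon> :: real assume "0 < \<epsilon>"
    then have "\<forall>\<^sub>F n in sequentially. err n < \<epsilon> / 3" using order_tendstoD(2)[OF err0, of "\<epsilon> / 3"] by simp
    moreover have "\<forall>\<^sub>F n in sequentially. dist (P n) p < \<epsilon> / 3" using p \<open>0 < \<epsilon>\<close> by (intro tendstoD) auto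
    ultimately have "\<forall>\<^sub>F n in sequentially. err n < \<epsilon> / 3 \<and> dist (P n) p < \<epsilon> / 3" by (rule eventually_conj)
    then obtain n where n: "err n < \<epsilon> / 3" "\<bar>P n - p\<bar> < \<epsilon> / 3" unfolding dist_real_def by (auto dest: eventually_happens)
    obtain d where d: "d > 0" "\<And>t. \<bar>t\<bar> < d \<Longrightarrow> \<bar>incr f x v t - P n * t\<bar> \<le> (err n + \<epsilon> / 3) * \<bar>t\<bar>" using near0[of "\<epsilon> / 3" n] \<open>0 < \<epsilon>\<close> by auto
    have "\<bar>incr f x v t - p * t\<bar> \<le> \<epsilon> * \<bar>t\<bar>" if "\<bar>t\<bar> < d" for t
    proof -
      have "\<bar>P n * t - p * t\<bar> = \<bar>P n - p\<bar> * \<bar>t\<bar>" by (simp add: left_diff_distrib[symmetric] abs_mult)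
      then have "\<bar>incr f x v t - p * t\<bar> \<le> (err n + \<epsilon> / 3) * \<bar>t\<bar> + \<bar>P n - p\<bar> * \<bar>t\<bar>" using d(2)[OF that] by linarith
      also have "\<dots> = (err n + \<epsilon> / 3 + \<bar>P n - p\<bar>) * \<bar>t\<bar>" by (simp add: algebra_simps)
      also have "\<dots> \<le> \<epsilon> * \<bar>t\<bar>" using n by (intro mult_right_mono) auto
      finally show ?thesis .
    qed
    then show "\<exists>d>0. \<forall>t. \<bar>t\<bar> < d \<longrightarrow> \<bar>incr f x v t - p * t\<bar> \<le> \<epsilon> * \<bar>t\<bar>" using d(1) by blast
  qed
  have admx: "adm x v p" using xG dp unfolding adm_def by blast
  have contpen: "isCont (pen n (V n) (\<Theta> n)) w" for n w
  proof -
    have "isCont (\<Theta> n) w"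
      using g(3)[of n] unfolding nice_def continuous_on_eq_continuous_at[OF open_UNIV] by blast
    then show ?thesis unfolding pen_def by (intro continuous_intros)
  qed
  have val_lim: "(\<lambda>m. val n (V m) (P m)) \<longlonglongrightarrow> val n v p" for n
    unfolding val_def by (intro tendsto_diff p isCont_tendsto_compose[OF contpen v])
  have xnb: "\<exists>\<epsilon>>0. nb n \<epsilon> x v p" for n
  proof -
    obtain \<epsilon> where \<epsilon>: "\<epsilon> > 0" "\<And>\<epsilon>' y w q. 0 < \<epsilon>' \<Longrightarrow> nb (Suc n) \<epsilon>' y w q \<Longrightarrow> nb n \<epsilon> y w q" using nx(7)[of n] by blast
    have all: "\<forall>\<^sub>F m in sequentially. nb n \<epsilon> (X m) (V m) (P m)"
      using ev[of "Suc n"] by eventually_elim (use later \<epsilon>(2) in blast)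
    have "P n - \<Theta> n (V n) \<le> val n v p"
      by (rule tendsto_lowerbound[OF val_lim]) (use all in \<open>auto simp: nbdef elim: eventually_mono\<close>)
    moreover have "close_incr f (V n) (X n) x (slack n - \<epsilon> + om K (val n v p - (P n - \<Theta> n (V n))))"
    proof (rule limit_close)
      show "\<forall>\<^sub>F m in sequentially. close_incr f (V n) (X n) (X m) (slack n - \<epsilon> + om K (val n (V m) (P m) - (P n - \<Theta> n (V n))))"
        using all by eventually_elim (simp add: nbdef)
      show "(\<lambda>m. slack n - \<epsilon> + om K (val n (V m) (P m) - (P n - \<Theta> n (V n)))) \<longlonglongrightarrow> slack n - \<epsilon> + om K (val n v p - (P n - \<Theta> n (V n)))"
        by (intro tendsto_add tendsto_const tendsto_om tendsto_diff val_lim)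
    qed
    ultimately show ?thesis using \<epsilon>(1) admx xlt unfolding nbdef by blast
  qed
  have ve: "norm (v - e) \<le> 1/2" using xnb[of 0] bounds(2) by blast
  have \<Theta>_eq: "\<Theta> n w = 16 * (norm (w - e))\<^sup>2 + (\<Sum>k<n. wt k * (norm (w - V k))\<^sup>2)" for n w
  proof (induction n)
    case 0 show ?case using s(2) sn[of 0] by (simp add: \<theta>0_def)
  next
    case (Suc n) then show ?case by (simp add: nx(2) pen_def)
  qed
  \<comment> \<open>The gradient at v of the penalty of state n.\<close>
  define \<xi>n where "\<xi>n n = 32 *\<^sub>R (v - e) + (\<Sum>k<n. (2 * wt k) *\<^sub>R (v - V k))" for n
  have sq: "(norm (w - c))\<^sup>2 - (norm (v - c))\<^sup>2 = (2 *\<^sub>R (v - c)) \<bullet> (w - v) + (norm (w - v))\<^sup>2" for w c :: "'n hvec"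
    unfolding power2_norm_eq_inner by (simp add: inner_diff_left inner_diff_right inner_commute)
  have \<Theta>_diff: "\<Theta> n w - \<Theta> n v = \<xi>n n \<bullet> (w - v) + (16 + (\<Sum>k<n. wt k)) * (norm (w - v))\<^sup>2" for n w
  proof -
    have "\<Theta> n w - \<Theta> n v = 16 * ((norm (w - e))\<^sup>2 - (norm (v - e))\<^sup>2) + (\<Sum>k<n. wt k * ((norm (w - V k))\<^sup>2 - (norm (v - V k))\<^sup>2))"
      unfolding \<Theta>_eq by (simp add: sum_subtractf right_diff_distrib)
    also have "\<dots> = \<xi>n n \<bullet> (w - v) + (16 + (\<Sum>k<n. wt k)) * (norm (w - v))\<^sup>2"
      unfolding sq \<xi>n_def by (simp add: inner_add_left inner_sum_left distrib_left distrib_right sum.distrib sum_distrib_right mult.assoc mult.left_commute)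
    finally show ?thesis .
  qed
  have "summable (\<lambda>k. (2 * wt k) *\<^sub>R (v - V k))"
  proof (rule summable_comparison_test')
    show "summable (\<lambda>k. 2 * (1/2::real)^k)" by (intro summable_mult summable_geometric) simp
    fix k :: nat
    have "norm (v - V k) \<le> 1" using vn[of k] slack400[of k] slack_le_1[of k] by linarith
    then have "2 * wt k * norm (v - V k) \<le> 2 * wt k * 1" using wt_pos[of k] by (intro mult_left_mono) auto
    then show "norm ((2 * wt k) *\<^sub>R (v - V k)) \<le> 2 * (1/2)^k" using wt_pos[of k] by (simp add: wt_def)
  qed
  then obtain l where "(\<lambda>n. \<Sum>k<n. (2 * wt k) *\<^sub>R (v - V k)) \<longlonglongrightarrow> l" using summable_LIMSEQ by blast
  then have "\<xi>n \<longlonglongrightarrow> 32 *\<^sub>R (v - e) + l" unfolding \<xi>n_def by (intro tendsto_intros)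
  then obtain \<xi> where \<xi>: "\<xi>n \<longlonglongrightarrow> \<xi>" by blast
  show ?thesis
  proof (rule that[OF xG ve dp, of \<xi>])
    fix \<eta> :: real assume "0 < \<eta>"
    have "\<forall>\<^sub>F n in sequentially. dist (\<xi>n n) \<xi> < \<eta> / 2" using \<xi> \<open>0 < \<eta>\<close> by (intro tendstoD) auto
    moreover have "\<forall>\<^sub>F n in sequentially. tol n < \<eta> / 2" using order_tendstoD(2)[OF tol_tendsto, of "\<eta> / 2"] \<open>0 < \<eta>\<close> by simp
    ultimately have "\<forall>\<^sub>F n in sequentially. dist (\<xi>n n) \<xi> < \<eta> / 2 \<and> tol n < \<eta> / 2" by (rule eventually_conj)
    then obtain N where N: "\<And>n. n \<ge> N \<Longrightarrow> dist (\<xi>n n) \<xi> < \<eta> / 2 \<and> tol n < \<eta> / 2" unfolding eventually_sequentially by blast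
    define n where "n = N"
    have n: "norm (\<xi>n (Suc n) - \<xi>) < \<eta> / 2" "tol (Suc n) < \<eta> / 2" using N[of "Suc n"] unfolding n_def dist_norm by auto
    obtain \<epsilon> where \<epsilon>: "\<epsilon> > 0" "nb n \<epsilon> x v p" using xnb by blast
    obtain \<epsilon>' \<delta>' where tr: "\<epsilon>' > 0" "\<delta>' > 0"
      "\<And>y w q h. adm y w q \<Longrightarrow> dist y x < \<delta>' \<Longrightarrow> 0 \<le> h \<Longrightarrow> h \<le> q - pen n (V n) (\<Theta> n) w - (p - pen n (V n) (\<Theta> n) v) \<Longrightarrow>
         close_incr f v x y (slack n / 4 + om K h) \<Longrightarrow> nearby n (X n, V n, P n, \<Delta> n, \<Theta> n) \<epsilon>' y w q"
      using nearby_trans[OF gd \<epsilon>(2)[unfolded nb_def] \<epsilon>(1)] by blast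
    show "\<exists>\<delta>>0. \<forall>y w q. y \<in> (\<Inter>n. G n) \<longrightarrow> dist y x < \<delta> \<longrightarrow> norm (w - v) \<le> 1 \<longrightarrow> dird f y w q \<longrightarrow>
       \<eta> \<le> q - p - \<xi> \<bullet> (w - v) - 20 * (norm (w - v))\<^sup>2 \<longrightarrow>
       \<not> close_incr f v x y (om K ((q - p - \<xi> \<bullet> (w - v) - 20 * (norm (w - v))\<^sup>2) / 2))"
    proof (intro exI[of _ \<delta>'] conjI tr(2) allI impI notI)
      fix y w q
      define gain where "gain = q - p - \<xi> \<bullet> (w - v) - 20 * (norm (w - v))\<^sup>2"
      assume y: "y \<in> (\<Inter>n. G n)" "dist y x < \<delta>'" "norm (w - v) \<le> 1" "dird f y w q"
        and "\<eta> \<le> q - p - \<xi> \<bullet> (w - v) - 20 * (norm (w - v))\<^sup>2"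
        and "close_incr f v x y (om K ((q - p - \<xi> \<bullet> (w - v) - 20 * (norm (w - v))\<^sup>2) / 2))"
      then have gain: "\<eta> \<le> gain" and cl: "close_incr f v x y (om K (gain / 2))" unfolding gain_def by auto
      \<comment> \<open>The excess of (y, w, q) over (x, v, p) with respect to the penalty of state n + 1.\<close>
      define h where "h = q - \<Theta> (Suc n) w - (p - \<Theta> (Suc n) v)"
      have heq: "h = q - p - \<xi>n (Suc n) \<bullet> (w - v) - (16 + (\<Sum>k<Suc n. wt k)) * (norm (w - v))\<^sup>2"
        unfolding h_def using \<Theta>_diff[of "Suc n" w] by linarith
      have "(16 + (\<Sum>k<Suc n. wt k)) * (norm (w - v))\<^sup>2 \<le> 20 * (norm (w - v))\<^sup>2"
        using sum_wt[of "Suc n"] by (intro mult_right_mono) auto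
      moreover have "\<bar>(\<xi>n (Suc n) - \<xi>) \<bullet> (w - v)\<bar> \<le> \<eta> / 2"
      proof -
        have "\<bar>(\<xi>n (Suc n) - \<xi>) \<bullet> (w - v)\<bar> \<le> norm (\<xi>n (Suc n) - \<xi>) * norm (w - v)" by (rule Cauchy_Schwarz_ineq2)
        also have "\<dots> \<le> \<eta> / 2 * 1" using n(1) y(3) \<open>0 < \<eta>\<close> by (intro mult_mono) auto
        finally show ?thesis by simp
      qed
      ultimately have h: "gain - \<eta> / 2 \<le> h" unfolding heq gain_def inner_diff_left[of "\<xi>n (Suc n)"] by linarith
      then have h2: "gain / 2 \<le> h" "\<eta> / 2 \<le> h" using gain by auto
      have nby: "nb n \<epsilon>' y w q" unfolding nb_def
      proof (rule tr(3))
        show "adm y w q" using y unfolding adm_def by blast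
        show "0 \<le> h" using h2(2) \<open>0 < \<eta>\<close> by linarith
        show "h \<le> q - pen n (V n) (\<Theta> n) w - (p - pen n (V n) (\<Theta> n) v)" unfolding h_def nx(2) by simp
        have "om K (gain / 2) \<le> slack n / 4 + om K h" using om_mono[OF K h2(1)] slack_pos[of n] by linarith
        then show "close_incr f v x y (slack n / 4 + om K h)" by (rule close_incr_mono[OF cl])
      qed (rule y(2))
      have "val n w q \<le> P (Suc n) - \<Theta> (Suc n) (V (Suc n)) + tol (Suc n)" by (rule nx(6)[OF tr(1) nby])
      moreover have "P (Suc n) - \<Theta> (Suc n) (V (Suc n)) \<le> p - \<Theta> (Suc n) v"
        using xnb[of "Suc n"] pen_ge[of "\<Theta> (Suc n)" v "Suc n" "V (Suc n)"] unfolding nbdef val_def by fastforce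
      ultimately have "h \<le> tol (Suc n)" unfolding h_def val_def nx(2)[symmetric] by linarith
      then show False using h2(2) n(2) by linarith
    qed
  qed
qed

end


section \<open>Detours through a given point\<close>

text \<open>
  The elements reached from 0 in time h by horizontal paths with velocities within k of v satisfy
  these inequalities. The bound for the vertical part is the one that is preserved by products.
\<close>
definition hcone :: "('n::finite) hvec \<Rightarrow> real \<Rightarrow> real \<Rightarrow> 'n heis \<Rightarrow> bool" where
  "hcone v k h g \<longleftrightarrow> norm (hpart g - h *\<^sub>R v) \<le> k * \<bar>h\<bar> \<and> \<bar>vpart g\<bar> \<le> (2 * k * norm v + k\<^sup>2) * h\<^sup>2"

lemma hcone_mult:
  assumes "hcone v k a g" "hcone v k b g'" "0 \<le> a" "0 \<le> b" "0 \<le> k"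
  shows "hcone v k (a + b) (g \<odot> g')"
proof -
  define r where "r = hpart g - a *\<^sub>R v"
  define r' where "r' = hpart g' - b *\<^sub>R v"
  define M where "M = 2 * k * norm v + k\<^sup>2"
  have g: "g \<odot> g' = mk (hpart g + hpart g') (vpart g + vpart g' - 2 * sform (hpart g) (hpart g'))"
    using mult_mk[of g "hpart g'" "vpart g'"] by simp
  have r: "norm r \<le> k * a" "norm r' \<le> k * b" "\<bar>vpart g\<bar> \<le> M * a\<^sup>2" "\<bar>vpart g'\<bar> \<le> M * b\<^sup>2"
    using assms unfolding hcone_def r_def r'_def M_def by auto
  have "sform (hpart g) (hpart g') = b * sform r v + a * sform v r' + sform r r'"
    unfolding r_def r'_def by (simp add: sform_simps algebra_simps)
  moreover have "\<bar>b * sform r v\<bar> \<le> b * (k * a * norm v)"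
    unfolding abs_mult using abs_sform_le[of r v] mult_right_mono[OF r(1), of "norm v"] assms(4) by (simp add: mult_left_mono)
  moreover have "\<bar>a * sform v r'\<bar> \<le> a * (norm v * (k * b))"
    unfolding abs_mult using abs_sform_le[of v r'] mult_left_mono[OF r(2), of "norm v"] assms(3) by (simp add: mult_left_mono)
  moreover have "\<bar>sform r r'\<bar> \<le> (k * a) * (k * b)"
  proof -
    have "norm r * norm r' \<le> (k * a) * (k * b)" using r(1,2) assms by (intro mult_mono) auto
    then show ?thesis using abs_sform_le[of r r'] by linarith
  qed
  ultimately have "\<bar>sform (hpart g) (hpart g')\<bar> \<le> b * (k * a * norm v) + a * (norm v * (k * b)) + (k * a) * (k * b)"
    by linarith
  also have "\<dots> = M * (a * b)" unfolding M_def by (simp add: power2_eq_square algebra_simps)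
  finally have sf: "\<bar>sform (hpart g) (hpart g')\<bar> \<le> M * (a * b)" .
  have "\<bar>vpart (g \<odot> g')\<bar> \<le> M * a\<^sup>2 + M * b\<^sup>2 + 2 * (M * (a * b))" unfolding g using r(3,4) sf by simp
  also have "\<dots> = M * (a + b)\<^sup>2" by (simp add: power2_eq_square algebra_simps)
  finally have "\<bar>vpart (g \<odot> g')\<bar> \<le> M * (a + b)\<^sup>2" .
  moreover have "hpart (g \<odot> g') - (a + b) *\<^sub>R v = r + r'" unfolding g r_def r'_def by (simp add: algebra_simps)
  then have "norm (hpart (g \<odot> g') - (a + b) *\<^sub>R v) \<le> k * \<bar>a + b\<bar>"
    using norm_triangle_ineq[of r r'] r(1,2) assms(3,4) by (simp add: distrib_left)
  ultimately show ?thesis unfolding hcone_def M_def by blast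
qed

lemma hcone_inv: "hcone v k h g \<Longrightarrow> hcone v k (- h) (heis_inv g)"
proof -
  have "heis_inv g = mk (- hpart g) (- vpart g)" using inv_mk[of "hpart g" "vpart g"] by simp
  moreover have "norm (- hpart g - (- h) *\<^sub>R v) = norm (hpart g - h *\<^sub>R v)"
    using norm_minus_commute[of "hpart g" "h *\<^sub>R v"] by simp
  ultimately show "hcone v k h g \<Longrightarrow> hcone v k (- h) (heis_inv g)" unfolding hcone_def by simp
qed

lemma hcone_hor: "norm (w - v) \<le> k \<Longrightarrow> hcone v k h (hor (h *\<^sub>R w))"
proof -
  assume k: "norm (w - v) \<le> k"
  then have "0 \<le> k" using norm_ge_zero[of "w - v"] by linarith
  have "norm (h *\<^sub>R w - h *\<^sub>R v) = norm (w - v) * \<bar>h\<bar>" by (simp add: scaleR_diff_right[symmetric] mult.commute)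
  also have "\<dots> \<le> k * \<bar>h\<bar>" using k by (intro mult_right_mono) auto
  finally show ?thesis using \<open>0 \<le> k\<close> unfolding hcone_def by simp
qed

definition conic_on :: "('n::finite) hvec \<Rightarrow> real \<Rightarrow> real set \<Rightarrow> (real \<Rightarrow> 'n heis) \<Rightarrow> bool" where
  "conic_on v k S \<gamma> \<longleftrightarrow> (\<forall>a\<in>S. \<forall>b\<in>S. a \<le> b \<longrightarrow> hcone v k (b - a) (heis_inv (\<gamma> a) \<odot> \<gamma> b))"

lemma conic_on_segment:
  assumes "norm (w - v) \<le> k" "\<And>t. t \<in> S \<Longrightarrow> \<gamma> t = q \<odot> hor ((t - c) *\<^sub>R w)"
  shows "conic_on v k S \<gamma>"
  unfolding conic_on_def
proof (intro ballI impI)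
  fix a b assume "a \<in> S" "b \<in> S" "a \<le> b"
  have "\<gamma> b = q \<odot> (hor ((a - c) *\<^sub>R w) \<odot> hor ((b - a) *\<^sub>R w))"
    using assms(2)[OF \<open>b \<in> S\<close>] by (simp add: sform_simps scaleR_left_distrib[symmetric])
  then have "\<gamma> b = \<gamma> a \<odot> hor ((b - a) *\<^sub>R w)" using assms(2)[OF \<open>a \<in> S\<close>] by (simp only: heis_mult_assoc)
  then have "heis_inv (\<gamma> a) \<odot> \<gamma> b = hor ((b - a) *\<^sub>R w)" by simp
  then show "hcone v k (b - a) (heis_inv (\<gamma> a) \<odot> \<gamma> b)" using hcone_hor[OF assms(1)] by simp
qed

lemma conic_on_Un:
  assumes S: "conic_on v k S \<gamma>" "conic_on v k T \<gamma>" and m: "m \<in> S" "m \<in> T" "\<And>t. t \<in> S \<Longrightarrow> t \<le> m" "\<And>t. t \<in> T \<Longrightarrow> m \<le> t"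
    and k: "0 \<le> k"
  shows "conic_on v k (S \<union> T) \<gamma>"
  unfolding conic_on_def
proof (intro ballI impI)
  fix a b assume ab: "a \<in> S \<union> T" "b \<in> S \<union> T" "a \<le> b"
  consider "a \<in> S" "b \<in> S" | "a \<in> T" "b \<in> T" | "a \<in> S" "b \<in> T" | "a \<in> T" "b \<in> S" using ab by blast
  then show "hcone v k (b - a) (heis_inv (\<gamma> a) \<odot> \<gamma> b)"
  proof cases
    case 1 then show ?thesis using S(1) ab(3) unfolding conic_on_def by blast
  next
    case 2 then show ?thesis using S(2) ab(3) unfolding conic_on_def by blast
  next
    case 3
    then have am: "a \<le> m" "m \<le> b" using m by auto
    have "hcone v k (m - a) (heis_inv (\<gamma> a) \<odot> \<gamma> m)" "hcone v k (b - m) (heis_inv (\<gamma> m) \<odot> \<gamma> b)"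
      using S 3 am m(1,2) unfolding conic_on_def by blast+
    then have "hcone v k ((m - a) + (b - m)) (heis_inv (\<gamma> a) \<odot> \<gamma> m \<odot> (heis_inv (\<gamma> m) \<odot> \<gamma> b))"
      using am k by (intro hcone_mult) auto
    then show ?thesis by (simp add: heis_mult_assoc)
  next
    case 4
    then have "a = m" "b = m" using m(3)[of b] m(4)[of a] ab(3) by auto
    then show ?thesis using S(1) m(1) unfolding conic_on_def by blast
  qed
qed

lemma heis_inv_quotient: "heis_inv (heis_inv x \<odot> y) = heis_inv y \<odot> x"
  by (cases x; cases y) (simp add: inner_commute algebra_simps)

lemma conic_both_signs:
  assumes "conic_on v k UNIV \<gamma>" shows "hcone v k (b - a) (heis_inv (\<gamma> a) \<odot> \<gamma> b)"
proof (cases "a \<le> b")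
  case True then show ?thesis using assms unfolding conic_on_def by blast
next
  case False
  then have "hcone v k (a - b) (heis_inv (\<gamma> b) \<odot> \<gamma> a)" using assms unfolding conic_on_def by auto
  from hcone_inv[OF this] have "hcone v k (b - a) (heis_inv (heis_inv (\<gamma> b) \<odot> \<gamma> a))" by simp
  then show ?thesis unfolding heis_inv_quotient .
qed

text \<open>
  Two horizontal segments, each of duration s / 2, lead backwards in time from hor (s v) to z. Their
  velocities vel1 and vel2 have the mean v - h / s, with h the horizontal part of z, which makes the
  horizontal end point right. They differ by a multiple of rot v, and twist is the solution of the
  linear equation for the vertical end point. For negative s, the same formulas describe the way to
  z from the other side.
\<close>
definition twist :: "real \<Rightarrow> ('n::finite) hvec \<Rightarrow> 'n heis \<Rightarrow> real" where
  "twist s v z = (vpart z + 2 * s * sform v (hpart z)) / (s * (s * (v \<bullet> v) - hpart z \<bullet> v))"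
definition vel1 :: "real \<Rightarrow> ('n::finite) hvec \<Rightarrow> 'n heis \<Rightarrow> 'n hvec" where
  "vel1 s v z = v - (1 / s) *\<^sub>R hpart z + twist s v z *\<^sub>R rot v"
definition vel2 :: "real \<Rightarrow> ('n::finite) hvec \<Rightarrow> 'n heis \<Rightarrow> 'n hvec" where
  "vel2 s v z = v - (1 / s) *\<^sub>R hpart z - twist s v z *\<^sub>R rot v"
definition midpt :: "real \<Rightarrow> ('n::finite) hvec \<Rightarrow> 'n heis \<Rightarrow> 'n heis" where
  "midpt s v z = hor (s *\<^sub>R v) \<odot> hor (- (s / 2) *\<^sub>R vel1 s v z)"

text \<open>
  Base points and directions of the lines that carry the four segments.
\<close>
definition pieces :: "real \<Rightarrow> ('n::finite) hvec \<Rightarrow> 'n heis \<Rightarrow> ('n heis \<times> 'n hvec) set" where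
  "pieces s v z = {(hor (s *\<^sub>R v), vel1 s v z), (midpt s v z, vel2 s v z),
     (hor ((- s) *\<^sub>R v), vel1 (- s) v z), (midpt (- s) v z, vel2 (- s) v z)}"

lemma sform_rot_left: "sform (rot z) w = - (z \<bullet> w)"
  by (simp add: sform_def rot_def inner_prod_def)

lemma inner_rot_self: "rot z \<bullet> z = 0" "z \<bullet> rot z = 0"
  using sform_simps(11)[of z] by (simp_all add: sform_def inner_commute)

lemma midpt_end:
  assumes "s \<noteq> 0" "s * (v \<bullet> v) - hpart z \<bullet> v \<noteq> 0"
  shows "midpt s v z \<odot> hor (- (s / 2) *\<^sub>R vel2 s v z) = z"
proof -
  define h where "h = hpart z"
  define l where "l = twist s v z"
  have l: "l * (s * (s * (v \<bullet> v) - h \<bullet> v)) = vpart z + 2 * s * sform v h"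
    unfolding l_def twist_def h_def using assms by simp
  have "midpt s v z \<odot> hor (- (s / 2) *\<^sub>R vel2 s v z)
     = mk (s *\<^sub>R v - (s / 2) *\<^sub>R vel1 s v z - (s / 2) *\<^sub>R vel2 s v z)
          (- 2 * sform (s *\<^sub>R v) (- (s / 2) *\<^sub>R vel1 s v z) - 2 * sform (s *\<^sub>R v - (s / 2) *\<^sub>R vel1 s v z) (- (s / 2) *\<^sub>R vel2 s v z))"
    unfolding midpt_def by simp
  also have "s *\<^sub>R v - (s / 2) *\<^sub>R vel1 s v z - (s / 2) *\<^sub>R vel2 s v z = h"
  proof -
    have "vel1 s v z + vel2 s v z = 2 *\<^sub>R (v - (1 / s) *\<^sub>R h)"
    proof -
      have "(v - X + Y) + (v - X - Y) = 2 *\<^sub>R (v - X)" for X Y :: "'a hvec" by (simp add: scaleR_2)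
      then show ?thesis unfolding vel1_def vel2_def h_def .
    qed
    then have "(s / 2) *\<^sub>R vel1 s v z + (s / 2) *\<^sub>R vel2 s v z = s *\<^sub>R v - h"
      using assms(1) by (simp add: scaleR_add_right[symmetric] scaleR_diff_right)
    then show ?thesis by (simp add: algebra_simps)
  qed
  also have "- 2 * sform (s *\<^sub>R v) (- (s / 2) *\<^sub>R vel1 s v z) - 2 * sform (s *\<^sub>R v - (s / 2) *\<^sub>R vel1 s v z) (- (s / 2) *\<^sub>R vel2 s v z) = vpart z"
  proof -
    define A where "A = vel1 s v z"
    define B where "B = vel2 s v z"
    have E1: "- 2 * sform (s *\<^sub>R v) (- (s / 2) *\<^sub>R A) - 2 * sform (s *\<^sub>R v - (s / 2) *\<^sub>R A) (- (s / 2) *\<^sub>R B)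
       = s * s * (sform v A + sform v B - sform A B / 2)"
      by (simp add: sform_simps field_simps)
    have E2: "sform v A = - sform v h / s + l * (v \<bullet> v)" "sform v B = - sform v h / s - l * (v \<bullet> v)"
      unfolding A_def B_def vel1_def vel2_def h_def[symmetric] l_def[symmetric] by (simp_all add: sform_simps sform_rot)
    have E3: "sform A B = - 2 * l * (v \<bullet> v) + 2 * l * (h \<bullet> v) / s"
      unfolding A_def B_def vel1_def vel2_def h_def[symmetric] l_def[symmetric] using sform_swap[of h v]
      by (simp add: sform_simps sform_rot sform_rot_left inner_commute[of v h] inner_rot_self)
         (simp add: algebra_simps diff_divide_distrib add_divide_distrib inner_rot_self)
    have "- 2 * sform (s *\<^sub>R v) (- (s / 2) *\<^sub>R A) - 2 * sform (s *\<^sub>R v - (s / 2) *\<^sub>R A) (- (s / 2) *\<^sub>R B)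
       = s * s * (- 2 * sform v h / s + l * (v \<bullet> v) - l * (h \<bullet> v) / s)"
      unfolding E1 E2 E3 by (simp add: algebra_simps diff_divide_distrib add_divide_distrib)
    also have "\<dots> = l * (s * (s * (v \<bullet> v) - h \<bullet> v)) - 2 * s * sform v h" using assms(1) by (simp add: field_simps)
    also have "\<dots> = vpart z" unfolding l by simp
    finally show ?thesis unfolding A_def B_def .
  qed
  finally show ?thesis by (simp add: h_def)
qed

text \<open>
  If z is within k s of 0 in the homogeneous sense, the displacement h / s changes the velocity by at
  most k, and the vertical correction, whose size is at most |s| k (|s| k + 2 |s| |v|), by at most 3 k.
\<close>
lemma twist_bounds:
  assumes s: "s \<noteq> 0" and k: "0 < k" "4 * k \<le> norm v" and z: "norm (hpart z) \<le> k * \<bar>s\<bar>" "\<bar>vpart z\<bar> \<le> k\<^sup>2 * s\<^sup>2"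
  shows "s * (v \<bullet> v) - hpart z \<bullet> v \<noteq> 0" "norm (vel1 s v z - v) \<le> 4 * k" "norm (vel2 s v z - v) \<le> 4 * k"
proof -
  define V where "V = norm v"
  have V: "0 < V" "4 * k \<le> V" using k unfolding V_def by auto
  have "\<bar>hpart z \<bullet> v\<bar> \<le> norm (hpart z) * V" unfolding V_def by (rule Cauchy_Schwarz_ineq2)
  also have "\<dots> \<le> k * \<bar>s\<bar> * V" using z(1) V by (intro mult_right_mono) auto
  finally have hv: "\<bar>hpart z \<bullet> v\<bar> \<le> k * \<bar>s\<bar> * V" .
  have vv: "v \<bullet> v = V * V" unfolding V_def by (simp add: power2_norm_eq_inner[symmetric] power2_eq_square)
  have "\<bar>s * (v \<bullet> v)\<bar> = \<bar>s\<bar> * (V * V)" unfolding vv by (simp add: abs_mult)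
  then have den: "\<bar>s\<bar> * V * (V - k) \<le> \<bar>s * (v \<bullet> v) - hpart z \<bullet> v\<bar>" using hv by (simp add: algebra_simps)
  have pos: "0 < \<bar>s\<bar> * V * (V - k)" using s V k by simp
  show "s * (v \<bullet> v) - hpart z \<bullet> v \<noteq> 0" using den pos by linarith
  have "\<bar>sform v (hpart z)\<bar> \<le> V * norm (hpart z)" unfolding V_def by (rule abs_sform_le)
  also have "\<dots> \<le> V * (k * \<bar>s\<bar>)" using z(1) V by (intro mult_left_mono) auto
  finally have sf: "\<bar>sform v (hpart z)\<bar> \<le> V * (k * \<bar>s\<bar>)" .
  have "\<bar>vpart z + 2 * s * sform v (hpart z)\<bar> \<le> \<bar>vpart z\<bar> + 2 * \<bar>s\<bar> * \<bar>sform v (hpart z)\<bar>"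
    using abs_triangle_ineq[of "vpart z" "2 * s * sform v (hpart z)"] by (simp add: abs_mult)
  also have "\<dots> \<le> k\<^sup>2 * s\<^sup>2 + 2 * \<bar>s\<bar> * (V * (k * \<bar>s\<bar>))" using z(2) sf by (intro add_mono mult_left_mono) auto
  also have "\<dots> = k * (\<bar>s\<bar> * \<bar>s\<bar>) * (k + 2 * V)" by (simp add: power2_eq_square algebra_simps)
  also have "\<dots> \<le> k * (\<bar>s\<bar> * \<bar>s\<bar>) * (3 * (V - k))" using k V by (intro mult_left_mono) auto
  finally have num: "\<bar>vpart z + 2 * s * sform v (hpart z)\<bar> \<le> k * (\<bar>s\<bar> * \<bar>s\<bar>) * (3 * (V - k))" .
  have "\<bar>twist s v z\<bar> * V = \<bar>vpart z + 2 * s * sform v (hpart z)\<bar> * V / (\<bar>s\<bar> * \<bar>s * (v \<bullet> v) - hpart z \<bullet> v\<bar>)"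
    unfolding twist_def by (simp add: abs_mult)
  also have "\<dots> \<le> (k * (\<bar>s\<bar> * \<bar>s\<bar>) * (3 * (V - k))) * V / (\<bar>s\<bar> * (\<bar>s\<bar> * V * (V - k)))"
    using num den pos V k s by (intro frac_le mult_right_mono mult_left_mono mult_pos_pos) auto
  also have "\<dots> = 3 * k" using s V k by (simp add: field_simps)
  finally have tw: "norm (twist s v z *\<^sub>R rot v) \<le> 3 * k" unfolding V_def by simp
  have "norm ((1 / s) *\<^sub>R hpart z) = norm (hpart z) / \<bar>s\<bar>" by (simp add: divide_inverse mult.commute)
  also have "\<dots> \<le> k" using z(1) s by (simp add: divide_le_eq)
  finally have hz: "norm ((1 / s) *\<^sub>R hpart z) \<le> k" .
  have "vel1 s v z - v = twist s v z *\<^sub>R rot v - (1 / s) *\<^sub>R hpart z" "vel2 s v z - v = - (twist s v z *\<^sub>R rot v) - (1 / s) *\<^sub>R hpart z"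
    unfolding vel1_def vel2_def by simp_all
  then show "norm (vel1 s v z - v) \<le> 4 * k" "norm (vel2 s v z - v) \<le> 4 * k"
    using norm_triangle_ineq4[of "twist s v z *\<^sub>R rot v" "(1 / s) *\<^sub>R hpart z"]
      norm_triangle_ineq4[of "- (twist s v z *\<^sub>R rot v)" "(1 / s) *\<^sub>R hpart z"] tw hz by simp_all
qed

text \<open>
  The line t -> hor (t v), modified for |t| < s so as to pass through z at time 0.
\<close>
definition detour :: "real \<Rightarrow> ('n::finite) hvec \<Rightarrow> 'n heis \<Rightarrow> real \<Rightarrow> 'n heis" where
  "detour s v z t =
    (if t \<le> - s then hor (t *\<^sub>R v)
     else if t \<le> - s / 2 then hor ((- s) *\<^sub>R v) \<odot> hor ((t + s) *\<^sub>R vel1 (- s) v z)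
     else if t \<le> 0 then midpt (- s) v z \<odot> hor ((t + s / 2) *\<^sub>R vel2 (- s) v z)
     else if t \<le> s / 2 then midpt s v z \<odot> hor ((t - s / 2) *\<^sub>R vel2 s v z)
     else if t \<le> s then hor (s *\<^sub>R v) \<odot> hor ((t - s) *\<^sub>R vel1 s v z)
     else hor (t *\<^sub>R v))"

lemma detour_properties:
  fixes v v' :: "('n::finite) hvec"
  assumes s: "0 < s" and k: "0 < k" "4 * k \<le> norm v'" and z: "norm (hpart z) \<le> k * s" "\<bar>vpart z\<bar> \<le> k\<^sup>2 * s\<^sup>2"
    and v: "norm (v' - v) \<le> k"
  shows "detour s v' z 0 = z" "\<And>t. s \<le> \<bar>t\<bar> \<Longrightarrow> detour s v' z t = hor (t *\<^sub>R v')"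
    "conic_on v (5 * k) UNIV (detour s v' z)"
    "\<And>t. \<bar>t\<bar> < s \<Longrightarrow> t \<notin> {- s / 2, 0, s / 2} \<Longrightarrow> \<exists>q w c. (q, w) \<in> pieces s v' z \<and> norm (w - v) \<le> 5 * k \<and>
        (\<forall>\<^sub>F u in nhds t. detour s v' z u = q \<odot> hor ((u - c) *\<^sub>R w))"
proof -
  let ?\<gamma> = "detour s v' z"
  have bp: "s * (v' \<bullet> v') - hpart z \<bullet> v' \<noteq> 0" "norm (vel1 s v' z - v') \<le> 4 * k" "norm (vel2 s v' z - v') \<le> 4 * k"
    using twist_bounds[of s k v' z] s k z by auto
  have bm: "(- s) * (v' \<bullet> v') - hpart z \<bullet> v' \<noteq> 0" "norm (vel1 (- s) v' z - v') \<le> 4 * k" "norm (vel2 (- s) v' z - v') \<le> 4 * k"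
    using twist_bounds[of "- s" k v' z] s k z by auto
  have tri: "norm (w - v) \<le> 5 * k" if "norm (w - v') \<le> 4 * k" for w
    using norm_triangle_ineq[of "w - v'" "v' - v"] that v by simp
  have v5: "norm (v' - v) \<le> 5 * k" using v k(1) by linarith
  have zp: "midpt s v' z \<odot> hor ((0 - s / 2) *\<^sub>R vel2 s v' z) = z"
    using midpt_end[OF _ bp(1)] s by simp
  have zm: "midpt (- s) v' z \<odot> hor ((0 + s / 2) *\<^sub>R vel2 (- s) v' z) = z"
    using midpt_end[OF _ bm(1)] s by simp
  show g0: "?\<gamma> 0 = z" using s zm unfolding detour_def by simp
  have P1: "?\<gamma> t = hor (t *\<^sub>R v')" if "t \<le> - s" for t using that unfolding detour_def by simp
  have P2: "?\<gamma> t = hor ((- s) *\<^sub>R v') \<odot> hor ((t - (- s)) *\<^sub>R vel1 (- s) v' z)" if "- s \<le> t" "t \<le> - s / 2" for t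
    using that unfolding detour_def by (auto simp: mk_zero antisym sform_simps)
  have P3: "?\<gamma> t = midpt (- s) v' z \<odot> hor ((t - (- s / 2)) *\<^sub>R vel2 (- s) v' z)" if "- s / 2 \<le> t" "t \<le> 0" for t
  proof (cases "t = - s / 2")
    case True
    have e: "t - (- s) = - ((- s) / 2)" "t - (- s / 2) = 0" using True by simp_all
    have "?\<gamma> t = midpt (- s) v' z" unfolding midpt_def e(1)[symmetric] by (rule P2) (use True s in auto)
    then show ?thesis unfolding e(2) by (simp add: mk_zero)
  next
    case False then show ?thesis using that s unfolding detour_def by simp
  qed
  have P4: "?\<gamma> t = midpt s v' z \<odot> hor ((t - s / 2) *\<^sub>R vel2 s v' z)" if "0 \<le> t" "t \<le> s / 2" for t
  proof (cases "t = 0")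
    case True then show ?thesis using g0 zp by simp
  next
    case False then show ?thesis using that s unfolding detour_def by simp
  qed
  have P5: "?\<gamma> t = hor (s *\<^sub>R v') \<odot> hor ((t - s) *\<^sub>R vel1 s v' z)" if "s / 2 \<le> t" "t \<le> s" for t
  proof (cases "t = s / 2")
    case True
    have e: "t - s / 2 = 0" "t - s = - (s / 2)" using True by simp_all
    have "?\<gamma> t = midpt s v' z \<odot> hor ((t - s / 2) *\<^sub>R vel2 s v' z)" by (rule P4) (use True s in auto)
    then have "?\<gamma> t = midpt s v' z" unfolding e(1) by (simp add: mk_zero)
    then show ?thesis unfolding e(2) midpt_def .
  next
    case False then show ?thesis using that s unfolding detour_def by simp
  qed
  have P6: "?\<gamma> t = hor (t *\<^sub>R v')" if "s \<le> t" for t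
  proof (cases "t = s")
    case True then show ?thesis using P5[of s] s by (simp add: mk_zero sform_simps)
  next
    case False then show ?thesis using that s unfolding detour_def by simp
  qed
  show "?\<gamma> t = hor (t *\<^sub>R v')" if "s \<le> \<bar>t\<bar>" for t using P1[of t] P6[of t] that by (cases "0 \<le> t") auto
  have k5: "0 \<le> 5 * k" using k(1) by simp
  have z0: "0 \<odot> x = x" for x :: "'n heis" by (rule heis_mult_zero)
  have c1: "conic_on v (5 * k) {..- s} ?\<gamma>"
    by (rule conic_on_segment[OF v5, of _ _ 0 0]) (simp add: P1 z0)
  have c2: "conic_on v (5 * k) {- s..- s / 2} ?\<gamma>" by (rule conic_on_segment[OF tri[OF bm(2)]], rule P2) auto
  have c3: "conic_on v (5 * k) {- s / 2..0} ?\<gamma>" by (rule conic_on_segment[OF tri[OF bm(3)]], rule P3) auto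
  have c4: "conic_on v (5 * k) {0..s / 2} ?\<gamma>" by (rule conic_on_segment[OF tri[OF bp(3)]], rule P4) auto
  have c5: "conic_on v (5 * k) {s / 2..s} ?\<gamma>" by (rule conic_on_segment[OF tri[OF bp(2)]], rule P5) auto
  have c6: "conic_on v (5 * k) {s..} ?\<gamma>"
    by (rule conic_on_segment[OF v5, of _ _ 0 0]) (simp add: P6 z0)
  have d2: "conic_on v (5 * k) ({..- s} \<union> {- s..- s / 2}) ?\<gamma>" by (rule conic_on_Un[OF c1 c2, of "- s"]) (use s k5 in auto)
  have d3: "conic_on v (5 * k) ({..- s} \<union> {- s..- s / 2} \<union> {- s / 2..0}) ?\<gamma>" by (rule conic_on_Un[OF d2 c3, of "- s / 2"]) (use s k5 in auto)
  have d4: "conic_on v (5 * k) ({..- s} \<union> {- s..- s / 2} \<union> {- s / 2..0} \<union> {0..s / 2}) ?\<gamma>" by (rule conic_on_Un[OF d3 c4, of 0]) (use s k5 in auto)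
  have d5: "conic_on v (5 * k) ({..- s} \<union> {- s..- s / 2} \<union> {- s / 2..0} \<union> {0..s / 2} \<union> {s / 2..s}) ?\<gamma>" by (rule conic_on_Un[OF d4 c5, of "s / 2"]) (use s k5 in auto)
  have "conic_on v (5 * k) ({..- s} \<union> {- s..- s / 2} \<union> {- s / 2..0} \<union> {0..s / 2} \<union> {s / 2..s} \<union> {s..}) ?\<gamma>" by (rule conic_on_Un[OF d5 c6, of s]) (use s k5 in auto)
  moreover have "{..- s} \<union> {- s..- s / 2} \<union> {- s / 2..0} \<union> {0..s / 2} \<union> {s / 2..s} \<union> {s..} = (UNIV :: real set)" using s by auto
  ultimately show "conic_on v (5 * k) UNIV ?\<gamma>" by simp
  show "\<exists>q w c. (q, w) \<in> pieces s v' z \<and> norm (w - v) \<le> 5 * k \<and> (\<forall>\<^sub>F u in nhds t. ?\<gamma> u = q \<odot> hor ((u - c) *\<^sub>R w))"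
    if t: "\<bar>t\<bar> < s" "t \<notin> {- s / 2, 0, s / 2}" for t
  proof -
    have ev: "\<forall>\<^sub>F u in nhds t. ?\<gamma> u = q \<odot> hor ((u - c) *\<^sub>R w)"
      if "a < t" "t < b" "\<And>u. a \<le> u \<Longrightarrow> u \<le> b \<Longrightarrow> ?\<gamma> u = q \<odot> hor ((u - c) *\<^sub>R w)" for a b q c w
      by (rule eventually_nhds_in_open[of "{a<..<b}" t, THEN eventually_mono]) (use that in auto)
    consider "- s < t" "t < - s / 2" | "- s / 2 < t" "t < 0" | "0 < t" "t < s / 2" | "s / 2 < t" "t < s" using t by fastforce
    then show ?thesis
    proof cases
      case 1
      show ?thesis using ev[OF 1 P2] tri[OF bm(2)] unfolding pieces_def by blast
    next
      case 2
      show ?thesis using ev[OF 2 P3] tri[OF bm(3)] unfolding pieces_def by blast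
    next
      case 3
      show ?thesis using ev[OF 3 P4] tri[OF bp(3)] unfolding pieces_def by blast
    next
      case 4
      show ?thesis using ev[OF 4 P5] tri[OF bp(2)] unfolding pieces_def by blast
    qed
  qed
qed

text \<open>
  The factor sqrt k comes from the vertical part, which is of order k h^2.
\<close>
lemma hlip_hcone:
  fixes f :: "('n::finite) heis \<Rightarrow> real"
  assumes f: "hlip f" and c: "hcone v k h g" and v: "norm v \<le> 3 / 2" and k: "0 \<le> k" "k \<le> 1 / 20"
  shows "\<bar>f (y \<odot> g) - f y\<bar> \<le> 3 * \<bar>h\<bar>" "\<bar>f (y \<odot> g) - f (y \<odot> hor (h *\<^sub>R v))\<bar> \<le> 7 * sqrt k * \<bar>h\<bar>"
proof -
  define r where "r = hpart g - h *\<^sub>R v"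
  have r: "norm r \<le> k * \<bar>h\<bar>" and vp: "\<bar>vpart g\<bar> \<le> (2 * k * norm v + k\<^sup>2) * h\<^sup>2" using c unfolding hcone_def r_def by auto
  have kv: "k * norm v \<le> k * (3/2)" using v k by (intro mult_left_mono) auto
  have "k * k \<le> k * 1" using k by (intro mult_left_mono) auto
  then have k2: "k\<^sup>2 \<le> k" by (simp add: power2_eq_square)
  have "(2 * k * norm v + k\<^sup>2) * h\<^sup>2 \<le> (4 * k) * h\<^sup>2" using kv k2 by (intro mult_right_mono) auto
  then have vp4: "\<bar>vpart g\<bar> \<le> 4 * k * h\<^sup>2" using vp by linarith
  have g: "g = mk (hpart g) (vpart g)" by simp
  show "\<bar>f (y \<odot> g) - f y\<bar> \<le> 3 * \<bar>h\<bar>"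
  proof -
    have "\<bar>f (y \<odot> g) - f y\<bar> \<le> norm (hpart g) + 2 * sqrt \<bar>vpart g\<bar>" using hlipD[OF f, of y "hpart g" "vpart g"] by simp
    moreover have "norm (hpart g) \<le> norm r + norm (h *\<^sub>R v)" unfolding r_def by (metis diff_add_cancel norm_triangle_ineq)
    moreover have "norm (h *\<^sub>R v) \<le> 3 / 2 * \<bar>h\<bar>" using mult_left_mono[OF v, of "\<bar>h\<bar>"] by (simp add: mult.commute)
    moreover have "k * \<bar>h\<bar> \<le> 1 / 20 * \<bar>h\<bar>" using k by (intro mult_right_mono) auto
    moreover have "sqrt \<bar>vpart g\<bar> \<le> 1 / 2 * \<bar>h\<bar>"
    proof (rule real_le_lsqrt)
      have "4 * k * h\<^sup>2 \<le> 1 / 4 * h\<^sup>2" using k by (intro mult_right_mono) auto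
      then show "\<bar>vpart g\<bar> \<le> (1 / 2 * \<bar>h\<bar>)\<^sup>2" using vp4 by (simp add: power_mult_distrib power2_eq_square)
    qed auto
    ultimately show ?thesis using r by linarith
  qed
  define c' where "c' = vpart g + 2 * (h * sform v r)"
  have eq: "y \<odot> hor (h *\<^sub>R v) \<odot> mk r c' = y \<odot> g"
    unfolding heis_mult_assoc mk_mult c'_def r_def by (simp add: sform_simps)
  have "\<bar>sform v r\<bar> \<le> norm v * norm r" by (rule abs_sform_le)
  also have "\<dots> \<le> 3 / 2 * (k * \<bar>h\<bar>)" using v r k by (intro mult_mono) auto
  finally have "\<bar>h\<bar> * \<bar>sform v r\<bar> \<le> \<bar>h\<bar> * (3 / 2 * (k * \<bar>h\<bar>))" by (intro mult_left_mono) auto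
  moreover have "\<bar>h\<bar> * (3 / 2 * (k * \<bar>h\<bar>)) = 3 / 2 * (k * h\<^sup>2)"
    using abs_mult_self_eq[of h] by (simp add: power2_eq_square mult.left_commute mult.commute)
  ultimately have "\<bar>h * sform v r\<bar> \<le> 3 / 2 * (k * h\<^sup>2)" by (simp only: abs_mult)
  then have "\<bar>c'\<bar> \<le> 7 * (k * h\<^sup>2)" using vp4 unfolding c'_def by linarith
  also have "\<dots> \<le> 9 * (k * h\<^sup>2)" using k by simp
  also have "\<dots> = (3 * sqrt k * \<bar>h\<bar>)\<^sup>2" using k by (simp add: power_mult_distrib)
  finally have "sqrt \<bar>c'\<bar> \<le> 3 * sqrt k * \<bar>h\<bar>" using k by (intro real_le_lsqrt) auto
  moreover have "norm r \<le> sqrt k * \<bar>h\<bar>"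
  proof -
    have "k \<le> sqrt k" using k k2 by (intro real_le_rsqrt) auto
    then have "k * \<bar>h\<bar> \<le> sqrt k * \<bar>h\<bar>" by (intro mult_right_mono) auto
    then show ?thesis using r by linarith
  qed
  moreover have "\<bar>f (y \<odot> g) - f (y \<odot> hor (h *\<^sub>R v))\<bar> \<le> norm r + 2 * sqrt \<bar>c'\<bar>"
    using hlipD[OF f, of "y \<odot> hor (h *\<^sub>R v)" r c'] unfolding eq .
  moreover have "3 * sqrt k * \<bar>h\<bar> = 3 * (sqrt k * \<bar>h\<bar>)" "7 * sqrt k * \<bar>h\<bar> = 7 * (sqrt k * \<bar>h\<bar>)" by simp_all
  ultimately show "\<bar>f (y \<odot> g) - f (y \<odot> hor (h *\<^sub>R v))\<bar> \<le> 7 * sqrt k * \<bar>h\<bar>" by linarith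
qed


section \<open>Linear approximation at an almost maximal direction\<close>

text \<open>
  Along the detour, f minus its expected value f x + p t + xi . (horizontal deviation from t v) is
  called e. It is at most 3 nu |t| for s <= |t| and at least d0 s / 2 at t = 0. After subtraction of
  the affine function alpha + beta t that agrees with e at t = s and t = -s, it is a bump to which
  steep_but_tame_point applies. At the parameter tau so found, f has the derivative
  g + beta + p + xi . (w - v) in the direction w of the detour. The increments of f from there in
  direction v are compared with those along the detour, where the latter are known to be tame for
  increments that stay in [-s, s]; for the others, |t| is at least of order d0 s, so that
  errors of order nu s are of order (nu / d0) |t|.
\<close>
lemma detour_gain:
  fixes f :: "('n::finite) heis \<Rightarrow> real"
  assumes f: "hlip f" and v: "norm v \<le> 3 / 2" and p: "\<bar>p\<bar> \<le> 3 / 2"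
    and \<kappa>: "0 < \<kappa>" "\<kappa> \<le> 1 / 100" "norm (v' - v) \<le> \<kappa>" "4 * \<kappa> \<le> norm v'" "5 * \<kappa> * norm \<xi> \<le> 1 / 2"
    and s: "0 < s" "s \<le> \<rho>" and z: "norm (hpart z) \<le> \<kappa> * s" "\<bar>vpart z\<bar> \<le> \<kappa>\<^sup>2 * s\<^sup>2"
    and d0: "0 < d0" "d0 * s / 2 \<le> \<bar>f (x' \<odot> z) - f x - \<xi> \<bullet> hpart z\<bar>"
    and \<nu>: "0 < \<nu>" "\<nu> \<le> d0 / 12" "\<nu> \<le> 1 / 3"
    and out: "\<And>t. s \<le> \<bar>t\<bar> \<Longrightarrow> \<bar>t\<bar> \<le> 2 * \<rho> \<Longrightarrow> \<bar>f (x' \<odot> hor (t *\<^sub>R v')) - f x - p * t - \<xi> \<bullet> (t *\<^sub>R (v' - v))\<bar> \<le> 3 * \<nu> * \<bar>t\<bar>"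
  obtains \<tau> q w c g a where "\<bar>\<tau>\<bar> < s" "(q, w) \<in> pieces s v' z" "norm (w - v) \<le> 5 * \<kappa>"
    "detour s v' z \<tau> = q \<odot> hor (c *\<^sub>R w)"
    "dird f (x' \<odot> detour s v' z \<tau>) w (g + a + p + \<xi> \<bullet> (w - v))" "\<bar>a\<bar> \<le> 3 * \<nu>" "d0 / 64 \<le> g" "g \<le> 6"
    "\<And>t. \<bar>t\<bar> \<le> \<rho> \<Longrightarrow> \<bar>incr f (x' \<odot> detour s v' z \<tau>) v t - p * t\<bar>
        \<le> (200 * sqrt g + 16 * sqrt \<kappa> + 5 * \<kappa> * norm \<xi> + 3 * \<nu> + 3456 * \<nu> / d0) * \<bar>t\<bar>"
proof -
  define \<gamma> where "\<gamma> = detour s v' z"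
  note dt = detour_properties[OF s(1) \<kappa>(1,4) z \<kappa>(3), folded \<gamma>_def]
  have k: "0 \<le> 5 * \<kappa>" "5 * \<kappa> \<le> 1 / 20" using \<kappa> by auto
  have con: "hcone v (5 * \<kappa>) (b - a) (heis_inv (\<gamma> a) \<odot> \<gamma> b)" for a b by (rule conic_both_signs[OF dt(3)])
  have join: "x' \<odot> \<gamma> a \<odot> (heis_inv (\<gamma> a) \<odot> \<gamma> b) = x' \<odot> \<gamma> b" for a b by (simp add: heis_mult_assoc)
  define F where "F t = f (x' \<odot> \<gamma> t)" for t
  have FL: "\<bar>F b - F a\<bar> \<le> 3 * \<bar>b - a\<bar>" for a b
    using hlip_hcone(1)[OF f con[of b a] v k, of "x' \<odot> \<gamma> a"] unfolding join F_def .
  have Fv: "\<bar>F b - f (x' \<odot> \<gamma> a \<odot> hor ((b - a) *\<^sub>R v))\<bar> \<le> 16 * sqrt \<kappa> * \<bar>b - a\<bar>" for a b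
  proof -
    have "\<bar>F b - f (x' \<odot> \<gamma> a \<odot> hor ((b - a) *\<^sub>R v))\<bar> \<le> 7 * sqrt (5 * \<kappa>) * \<bar>b - a\<bar>"
      using hlip_hcone(2)[OF f con[of b a] v k, of "x' \<odot> \<gamma> a"] unfolding join F_def .
    also have "\<dots> \<le> 16 * sqrt \<kappa> * \<bar>b - a\<bar>"
    proof (intro mult_right_mono)
      have "sqrt 5 \<le> 16 / 7" by (rule real_le_lsqrt) (auto simp: power2_eq_square)
      then have "7 * sqrt 5 * sqrt \<kappa> \<le> 16 * sqrt \<kappa>" using \<kappa>(1) by (intro mult_right_mono) auto
      then show "7 * sqrt (5 * \<kappa>) \<le> 16 * sqrt \<kappa>" by (simp add: real_sqrt_mult)
    qed simp
    finally show ?thesis .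
  qed
  define H where "H t = \<xi> \<bullet> (hpart (\<gamma> t) - t *\<^sub>R v)" for t
  have HL: "\<bar>H b - H a\<bar> \<le> 5 * \<kappa> * norm \<xi> * \<bar>b - a\<bar>" for a b
  proof -
    have "norm (hpart (\<gamma> b) - hpart (\<gamma> a) - (b - a) *\<^sub>R v) \<le> 5 * \<kappa> * \<bar>b - a\<bar>"
      using con[of b a] unfolding hcone_def by simp
    then have "norm \<xi> * norm (hpart (\<gamma> b) - hpart (\<gamma> a) - (b - a) *\<^sub>R v) \<le> norm \<xi> * (5 * \<kappa> * \<bar>b - a\<bar>)"
      by (intro mult_left_mono) auto
    moreover have "H b - H a = \<xi> \<bullet> (hpart (\<gamma> b) - hpart (\<gamma> a) - (b - a) *\<^sub>R v)"
      unfolding H_def by (simp add: algebra_simps inner_diff_right inner_add_right)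
    ultimately show ?thesis
      using Cauchy_Schwarz_ineq2[of \<xi> "hpart (\<gamma> b) - hpart (\<gamma> a) - (b - a) *\<^sub>R v"] by (simp add: mult.commute mult.left_commute)
  qed
  define e where "e t = F t - f x - p * t - H t" for t
  have e_diff: "F b - F a - p * (b - a) = (e b - e a) + (H b - H a)" for a b unfolding e_def by (simp add: algebra_simps)
  have eL: "\<bar>e b - e a\<bar> \<le> 5 * \<bar>b - a\<bar>" for a b
  proof -
    have "5 * \<kappa> * norm \<xi> * \<bar>b - a\<bar> \<le> 1 / 2 * \<bar>b - a\<bar>" using \<kappa>(5) by (intro mult_right_mono) auto
    then have h: "\<bar>H b - H a\<bar> \<le> 1 / 2 * \<bar>b - a\<bar>" using HL[of b a] by linarith
    have pt: "\<bar>p * (b - a)\<bar> \<le> 3 / 2 * \<bar>b - a\<bar>" unfolding abs_mult using p by (intro mult_right_mono) auto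
    have "\<bar>e b - e a\<bar> \<le> \<bar>F b - F a\<bar> + \<bar>p * (b - a)\<bar> + \<bar>H b - H a\<bar>" using e_diff[of b a] by linarith
    then show ?thesis using FL[of b a] h pt by linarith
  qed
  have eout: "\<bar>e t\<bar> \<le> 3 * \<nu> * \<bar>t\<bar>" if "s \<le> \<bar>t\<bar>" "\<bar>t\<bar> \<le> 2 * \<rho>" for t
  proof -
    have "e t = f (x' \<odot> hor (t *\<^sub>R v')) - f x - p * t - \<xi> \<bullet> (t *\<^sub>R (v' - v))"
      unfolding e_def F_def H_def dt(2)[OF that(1)] by (simp add: scaleR_diff_right)
    then show ?thesis using out[OF that] by simp
  qed
  define \<alpha> where "\<alpha> = (e s + e (- s)) / 2"
  define \<beta> where "\<beta> = (e s - e (- s)) / (2 * s)"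
  have es: "\<bar>e s\<bar> \<le> 3 * \<nu> * s" "\<bar>e (- s)\<bar> \<le> 3 * \<nu> * s" using eout[of s] eout[of "- s"] s by auto
  have \<alpha>: "\<bar>\<alpha>\<bar> \<le> 3 * \<nu> * s"
  proof -
    have "\<bar>e s + e (- s)\<bar> \<le> 2 * (3 * \<nu> * s)" using es by linarith
    then show ?thesis unfolding \<alpha>_def by simp
  qed
  have \<beta>: "\<bar>\<beta>\<bar> \<le> 3 * \<nu>"
  proof -
    have "\<bar>e s - e (- s)\<bar> \<le> 3 * \<nu> * (2 * s)" using es by linarith
    then show ?thesis unfolding \<beta>_def using s by (simp add: abs_divide divide_le_eq)
  qed
  have ends: "\<alpha> + \<beta> * s = e s" "\<alpha> + \<beta> * (- s) = e (- s)" unfolding \<alpha>_def \<beta>_def using s by (simp_all add: field_simps)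
  define h where "h t = e t - \<alpha> - \<beta> * t" for t
  have hL: "\<bar>h b - h a\<bar> \<le> 6 * \<bar>b - a\<bar>" for a b
  proof -
    have "\<bar>\<beta> * (b - a)\<bar> \<le> 1 * \<bar>b - a\<bar>" unfolding abs_mult using \<beta> \<nu>(3) by (intro mult_right_mono) auto
    moreover have "h b - h a = (e b - e a) - \<beta> * (b - a)" unfolding h_def by (simp add: algebra_simps)
    ultimately show ?thesis using eL[of b a] by linarith
  qed
  \<comment> \<open>The bump: h on [-s, s], extended by its value 0 at the end points.\<close>
  define cl where "cl t = max (- s) (min s t)" for t
  have clL: "\<bar>cl b - cl a\<bar> \<le> \<bar>b - a\<bar>" for a b unfolding cl_def by (auto simp: max_def min_def)
  have cl_id: "cl t = t" if "\<bar>t\<bar> \<le> s" for t using that unfolding cl_def by auto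
  define \<phi> where "\<phi> t = h (cl t)" for t
  have lip: "\<bar>\<phi> b - \<phi> a\<bar> \<le> 6 * \<bar>b - a\<bar>" for b a
    unfolding \<phi>_def using order_trans[OF hL[of "cl b" "cl a"] mult_left_mono[OF clL[of b a]]] by simp
  have zero: "\<phi> t = 0" if "s \<le> \<bar>t\<bar>" for t
  proof -
    have "cl t = s \<or> cl t = - s" using that s unfolding cl_def by auto
    then show ?thesis unfolding \<phi>_def h_def using ends by auto
  qed
  define d where "d = d0 * s / 4"
  have d: "0 < d" unfolding d_def using d0 s by simp
  have d\<phi>: "d \<le> \<bar>\<phi> 0\<bar>"
  proof -
    have "e 0 = f (x' \<odot> z) - f x - \<xi> \<bullet> hpart z" unfolding e_def F_def H_def dt(1) by simp
    then have "d0 * s / 2 \<le> \<bar>e 0\<bar>" using d0(2) by simp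
    moreover have "3 * \<nu> * s \<le> d0 / 4 * s" using \<nu>(2) s by (intro mult_right_mono) auto
    moreover have "\<phi> 0 = e 0 - \<alpha>" unfolding \<phi>_def h_def using cl_id[of 0] s by simp
    moreover have "d0 * s / 2 = 2 * d" "d0 / 4 * s = d" unfolding d_def by simp_all
    ultimately show ?thesis using \<alpha> by linarith
  qed
  have "finite {- s / 2, 0, s / 2}" by simp
  then obtain \<tau> g where \<tau>: "\<bar>\<tau>\<bar> \<le> s - d / (16 * 6)" "\<tau> \<notin> {- s / 2, 0, s / 2}" "(\<phi> has_real_derivative g) (at \<tau>)"
    "d / (16 * s) \<le> g" "\<And>u. \<bar>\<phi> (\<tau> + u) - \<phi> \<tau>\<bar> \<le> 80 * sqrt (6 * g) * \<bar>u\<bar>"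
    using steep_but_tame_point[OF lip zero d d\<phi>] by metis
  have \<tau>s: "\<bar>\<tau>\<bar> < s" using \<tau>(1) d by simp
  have g64: "d0 / 64 \<le> g" using \<tau>(4) s unfolding d_def by simp
  have g0: "0 < g" using g64 d0 by simp
  have g6: "g \<le> 6"
  proof -
    have "rderiv \<phi> \<tau> = g" using \<tau>(3) DERIV_imp_deriv real_differentiable_def unfolding rderiv_def by metis
    then show ?thesis using rderiv_bound[OF lip, of \<tau>] by simp
  qed
  have tame: "\<bar>\<phi> (\<tau> + u) - \<phi> \<tau>\<bar> \<le> 200 * sqrt g * \<bar>u\<bar>" for u
  proof -
    have "sqrt 6 \<le> 5 / 2" by (rule real_le_lsqrt) (auto simp: power2_eq_square)
    then have "80 * sqrt 6 * sqrt g \<le> 200 * sqrt g" using g0 by (intro mult_right_mono) auto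
    then have "80 * sqrt (6 * g) * \<bar>u\<bar> \<le> 200 * sqrt g * \<bar>u\<bar>" by (intro mult_right_mono) (auto simp: real_sqrt_mult)
    then show ?thesis using \<tau>(5)[of u] by linarith
  qed
  have efull: "e t = \<phi> t + \<alpha> + \<beta> * t" if "\<bar>t\<bar> \<le> s" for t unfolding \<phi>_def cl_id[OF that] h_def by simp
  obtain q w c where qw: "(q, w) \<in> pieces s v' z" "norm (w - v) \<le> 5 * \<kappa>" "\<forall>\<^sub>F u in nhds \<tau>. \<gamma> u = q \<odot> hor ((u - c) *\<^sub>R w)"
    using dt(4)[OF \<tau>s \<tau>(2)] by blast
  then obtain D where D: "D > 0" "\<And>u. dist u \<tau> < D \<Longrightarrow> \<gamma> u = q \<odot> hor ((u - c) *\<^sub>R w)" unfolding eventually_nhds_metric by blast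
  have \<gamma>\<tau>: "\<gamma> \<tau> = q \<odot> hor ((\<tau> - c) *\<^sub>R w)" using D by simp
  have deriv: "dird f (x' \<odot> \<gamma> \<tau>) w (g + \<beta> + p + \<xi> \<bullet> (w - v))"
  proof -
    let ?C = "\<alpha> + \<beta> * \<tau> + f x + p * \<tau> + \<xi> \<bullet> (hpart q + (\<tau> - c) *\<^sub>R w - \<tau> *\<^sub>R v)"
    have eq: "f (x' \<odot> \<gamma> \<tau> \<odot> hor (u *\<^sub>R w)) = \<phi> (u + \<tau>) + ?C + u * (\<beta> + p + \<xi> \<bullet> (w - v))"
      if u: "dist u 0 < min D (s - \<bar>\<tau>\<bar>)" for u
    proof -
      have us: "\<bar>\<tau> + u\<bar> \<le> s" using u by (auto simp: dist_real_def)
      have g1: "\<gamma> (\<tau> + u) = q \<odot> hor ((\<tau> + u - c) *\<^sub>R w)" using u by (intro D(2)) (simp add: dist_real_def)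
      have "x' \<odot> \<gamma> \<tau> \<odot> hor (u *\<^sub>R w) = x' \<odot> (q \<odot> (hor ((\<tau> - c) *\<^sub>R w) \<odot> hor (u *\<^sub>R w)))"
        unfolding \<gamma>\<tau> by (simp only: heis_mult_assoc)
      also have "hor ((\<tau> - c) *\<^sub>R w) \<odot> hor (u *\<^sub>R w) = hor ((\<tau> + u - c) *\<^sub>R w)"
      proof -
        have "\<tau> + u - c = (\<tau> - c) + u" by simp
        then show ?thesis by (simp only: scaleR_left_distrib) (simp add: sform_simps)
      qed
      finally have "f (x' \<odot> \<gamma> \<tau> \<odot> hor (u *\<^sub>R w)) = F (\<tau> + u)" unfolding F_def g1 by simp
      also have "\<dots> = e (\<tau> + u) + f x + p * (\<tau> + u) + H (\<tau> + u)" unfolding e_def by simp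
      also have "H (\<tau> + u) = \<xi> \<bullet> (hpart q + (\<tau> - c) *\<^sub>R w - \<tau> *\<^sub>R v) + u * (\<xi> \<bullet> (w - v))"
        unfolding H_def g1 by (simp add: inner_add_right inner_diff_right algebra_simps)
      finally show ?thesis unfolding efull[OF us] by (simp add: algebra_simps)
    qed
    have "((\<lambda>u. \<phi> (u + \<tau>)) has_real_derivative g) (at 0)" using \<tau>(3) DERIV_shift[of \<phi> g 0 \<tau>] by simp
    then have "((\<lambda>u. \<phi> (u + \<tau>) + ?C + u * (\<beta> + p + \<xi> \<bullet> (w - v))) has_real_derivative (g + \<beta> + p + \<xi> \<bullet> (w - v))) (at 0)"
      by (auto intro!: derivative_eq_intros)
    moreover have "\<forall>\<^sub>F u in nhds 0. f (x' \<odot> \<gamma> \<tau> \<odot> hor (u *\<^sub>R w)) = \<phi> (u + \<tau>) + ?C + u * (\<beta> + p + \<xi> \<bullet> (w - v))"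
      unfolding eventually_nhds_metric using eq D(1) \<tau>s by (intro exI[of _ "min D (s - \<bar>\<tau>\<bar>)"]) auto
    ultimately show ?thesis unfolding dird_def by (rule iffD2[OF DERIV_cong_ev[OF refl _ refl], rotated])
  qed
  have close: "\<bar>incr f (x' \<odot> \<gamma> \<tau>) v t - p * t\<bar>
        \<le> (200 * sqrt g + 16 * sqrt \<kappa> + 5 * \<kappa> * norm \<xi> + 3 * \<nu> + 3456 * \<nu> / d0) * \<bar>t\<bar>" if t: "\<bar>t\<bar> \<le> \<rho>" for t
  proof -
    have 1: "\<bar>F (\<tau> + t) - f (x' \<odot> \<gamma> \<tau> \<odot> hor (t *\<^sub>R v))\<bar> \<le> 16 * sqrt \<kappa> * \<bar>t\<bar>" using Fv[of "\<tau> + t" \<tau>] by simp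
    have 2: "\<bar>H (\<tau> + t) - H \<tau>\<bar> \<le> 5 * \<kappa> * norm \<xi> * \<bar>t\<bar>" using HL[of "\<tau> + t" \<tau>] by simp
    have nd: "0 \<le> 3456 * \<nu> / d0 * \<bar>t\<bar>" using \<nu>(1) d0(1) by simp
    have 3: "\<bar>e (\<tau> + t) - e \<tau>\<bar> \<le> 200 * sqrt g * \<bar>t\<bar> + 3 * \<nu> * \<bar>t\<bar> + 3456 * \<nu> / d0 * \<bar>t\<bar>"
    proof (cases "\<bar>\<tau> + t\<bar> \<le> s")
      case True
      have "e (\<tau> + t) - e \<tau> = (\<phi> (\<tau> + t) - \<phi> \<tau>) + \<beta> * t" using efull[OF True] efull[of \<tau>] \<tau>s by (simp add: algebra_simps)
      moreover have "\<bar>\<beta> * t\<bar> \<le> 3 * \<nu> * \<bar>t\<bar>" unfolding abs_mult using \<beta> by (intro mult_right_mono) auto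
      ultimately show ?thesis using tame[of t] nd by linarith
    next
      case False
      \<comment> \<open>The distance of tau from the ends of [-s, s] is at least d / (16 L) with L = 6.\<close>
      have "d / 96 < \<bar>t\<bar>" using \<tau>(1) False by linarith
      then have "s \<le> 384 / d0 * \<bar>t\<bar>" unfolding d_def using d0(1) by (simp add: field_simps)
      then have "9 * \<nu> * s \<le> 9 * \<nu> * (384 / d0 * \<bar>t\<bar>)" using \<nu>(1) by (intro mult_left_mono) auto
      then have s9: "9 * \<nu> * s \<le> 3456 * \<nu> / d0 * \<bar>t\<bar>" by simp
      have "\<bar>\<tau> + t\<bar> \<le> s + \<bar>t\<bar>" using \<tau>s by linarith
      then have "3 * \<nu> * \<bar>\<tau> + t\<bar> \<le> 3 * \<nu> * (s + \<bar>t\<bar>)" using \<nu>(1) by (intro mult_left_mono) auto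
      moreover have "\<bar>e (\<tau> + t)\<bar> \<le> 3 * \<nu> * \<bar>\<tau> + t\<bar>" using False \<tau>s t s(2) by (intro eout) linarith+
      moreover have "\<phi> (\<tau> + t) = 0" using False by (intro zero) linarith
      moreover have "\<bar>e \<tau>\<bar> \<le> \<bar>\<phi> \<tau>\<bar> + 3 * \<nu> * s + 3 * \<nu> * s"
      proof -
        have "\<bar>\<beta>\<bar> * \<bar>\<tau>\<bar> \<le> 3 * \<nu> * s" using \<beta> \<tau>s \<nu>(1) by (intro mult_mono) auto
        then have "\<bar>\<beta> * \<tau>\<bar> \<le> 3 * \<nu> * s" by (simp only: abs_mult)
        then show ?thesis using efull[of \<tau>] \<tau>s \<alpha> by linarith
      qed
      moreover have "3 * \<nu> * (s + \<bar>t\<bar>) = 3 * \<nu> * s + 3 * \<nu> * \<bar>t\<bar>" by (simp add: distrib_left)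
      moreover have "9 * \<nu> * s = 3 * \<nu> * s + 3 * \<nu> * s + 3 * \<nu> * s" by simp
      ultimately show ?thesis using tame[of t] s9 by linarith
    qed
    have "incr f (x' \<odot> \<gamma> \<tau>) v t - p * t = (f (x' \<odot> \<gamma> \<tau> \<odot> hor (t *\<^sub>R v)) - F (\<tau> + t)) + ((e (\<tau> + t) - e \<tau>) + (H (\<tau> + t) - H \<tau>))"
      using e_diff[of "\<tau> + t" \<tau>] unfolding incr_def F_def by simp
    then have "\<bar>incr f (x' \<odot> \<gamma> \<tau>) v t - p * t\<bar> \<le> 16 * sqrt \<kappa> * \<bar>t\<bar> + (200 * sqrt g * \<bar>t\<bar> + 3 * \<nu> * \<bar>t\<bar> + 3456 * \<nu> / d0 * \<bar>t\<bar>) + 5 * \<kappa> * norm \<xi> * \<bar>t\<bar>"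
      using 1 2 3 by linarith
    also have "\<dots> = (200 * sqrt g + 16 * sqrt \<kappa> + 5 * \<kappa> * norm \<xi> + 3 * \<nu> + 3456 * \<nu> / d0) * \<bar>t\<bar>" by (simp add: distrib_right)
    finally show ?thesis .
  qed
  show ?thesis
    by (rule that[OF \<tau>s qw(1,2) \<gamma>\<tau>[unfolded \<gamma>_def] deriv[unfolded \<gamma>_def] \<beta> g64 g6 close[unfolded \<gamma>_def]])
qed

lemma norm_detour_le:
  fixes v v' :: "('n::finite) hvec"
  assumes s: "0 < s" "s \<le> 1" and k: "0 < k" "k \<le> 1 / 100" "4 * k \<le> norm v'" and z: "norm (hpart z) \<le> k * s" "\<bar>vpart z\<bar> \<le> k\<^sup>2 * s\<^sup>2"
    and v: "norm (v' - v) \<le> k" "norm v \<le> 3 / 2" and t: "\<bar>t\<bar> \<le> s"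
  shows "norm (detour s v' z t) \<le> 5 * s"
proof -
  note dt = detour_properties[OF s(1) k(1,3) z v(1)]
  define g where "g = heis_inv z \<odot> detour s v' z t"
  have "hcone v (5 * k) (t - 0) (heis_inv (detour s v' z 0) \<odot> detour s v' z t)" by (rule conic_both_signs[OF dt(3)])
  then have g: "norm (hpart g - t *\<^sub>R v) \<le> 5 * k * \<bar>t\<bar>" "\<bar>vpart g\<bar> \<le> (2 * (5 * k) * norm v + (5 * k)\<^sup>2) * t\<^sup>2"
    unfolding hcone_def dt(1) g_def by auto
  have eq: "detour s v' z t = z \<odot> g" unfolding g_def by simp
  have "k * norm v \<le> k * (3/2)" using v k by (intro mult_left_mono) auto
  moreover have "k * k \<le> k * (1/100)" using k by (intro mult_left_mono) auto
  ultimately have c: "2 * (5 * k) * norm v + (5 * k)\<^sup>2 \<le> 1" using k(2) by (simp add: power2_eq_square)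
  have t2: "t\<^sup>2 \<le> s"
  proof -
    have "\<bar>t\<bar> * \<bar>t\<bar> \<le> s * 1" using t s by (intro mult_mono) auto
    then show ?thesis by (simp add: power2_eq_square abs_mult_self_eq)
  qed
  have "(2 * (5 * k) * norm v + (5 * k)\<^sup>2) * t\<^sup>2 \<le> 1 * t\<^sup>2" using c by (intro mult_right_mono) auto
  then have vg: "\<bar>vpart g\<bar> \<le> s" using g(2) t2 by linarith
  have "norm (hpart g) \<le> norm (hpart g - t *\<^sub>R v) + norm (t *\<^sub>R v)" by (metis diff_add_cancel norm_triangle_ineq)
  moreover have "norm (t *\<^sub>R v) \<le> s * (3 / 2)" unfolding norm_scaleR using t v s by (intro mult_mono) auto
  moreover have "5 * k * \<bar>t\<bar> \<le> 1 / 20 * s" using t k by (intro mult_mono) auto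
  ultimately have hg: "norm (hpart g) \<le> 31 / 20 * s" using g(1) by linarith
  have ks: "k * s \<le> 1 / 100 * s" using k s by (intro mult_right_mono) auto
  have hz: "norm (hpart z) \<le> 1 / 100 * s" using z(1) ks by linarith
  have vz: "\<bar>vpart z\<bar> \<le> 1 / 100 * s"
  proof -
    have "k \<le> 1" using k by linarith
    then have "k * s \<le> 1" using mult_mono[of k 1 s 1] s by simp
    then have "(k * s) * (k * s) \<le> (1 / 100 * s) * 1" by (rule mult_mono[OF ks]) (use k s in auto)
    then show ?thesis using z(2) by (simp add: power2_eq_square algebra_simps)
  qed
  have sf: "\<bar>sform (hpart z) (hpart g)\<bar> \<le> 31 / 2000 * s"
  proof -
    have "norm (hpart z) * norm (hpart g) \<le> (1 / 100 * s) * (31 / 20 * s)" using hz hg s by (intro mult_mono) auto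
    also have "\<dots> = 31 / 2000 * (s * s)" by simp
    also have "s * s \<le> s * 1" using s by (intro mult_left_mono) auto
    finally show ?thesis using abs_sform_le[of "hpart z" "hpart g"] by simp
  qed
  have "z \<odot> g = mk (hpart z + hpart g) (vpart z + vpart g - 2 * sform (hpart z) (hpart g))"
    using mult_mk[of z "hpart g" "vpart g"] by simp
  then have "norm (detour s v' z t) \<le> norm (hpart z + hpart g) + \<bar>vpart z + vpart g - 2 * sform (hpart z) (hpart g)\<bar>"
    unfolding eq using norm_mk_le[of "hpart z + hpart g" "vpart z + vpart g - 2 * sform (hpart z) (hpart g)"] by (simp only:)
  moreover have "norm (hpart z + hpart g) \<le> norm (hpart z) + norm (hpart g)" by (rule norm_triangle_ineq)
  ultimately show ?thesis using hz hg vz vg sf s by linarith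
qed

text \<open>
  The constants: kappa bounds the deviation of the directions of a detour (up to a factor 5) and is
  small against eps and 1 / |xi|^2. The error eps r at scale r equals d0 s / 2 for s = 2 r / kappa and
  d0 = eps kappa, and the error nu of the linear approximation along the line is small against
  d0^2. The slope g >= d0 / 64 found on a detour exceeds the quadratic loss 20 (5 kappa)^2 because kappa is small against eps, and kappa <= sqrt g
  makes the error of order sqrt kappa in the increments one of order g^(1/4).

  Near x the increments are linear up to nu |t| for |t| <= 2 rho; for larger t, continuity of f alone
  makes increments at y and x close.
\<close>
theorem linear_approximation:
  fixes f :: "('n::finite) heis \<Rightarrow> real" and Q :: "('n heis \<times> 'n hvec \<times> 'n heis \<times> real) set"
  assumes f: "hlip f" and v: "1 / 2 \<le> norm v" "norm v \<le> 3 / 2" and dp: "dird f x v p"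
    and dense: "\<And>S. open S \<Longrightarrow> S \<noteq> {} \<Longrightarrow> \<exists>q\<in>Q. q \<in> S"
    and lines: "\<And>x' v' z s q w t. (x', v', z, s) \<in> Q \<Longrightarrow> (q, w) \<in> pieces s v' z \<Longrightarrow> x' \<odot> q \<odot> hor (t *\<^sub>R w) \<in> N"
    and maxi: "\<And>\<eta>. 0 < \<eta> \<Longrightarrow> \<exists>\<delta>>0. \<forall>y w q. y \<in> N \<longrightarrow> dist y x < \<delta> \<longrightarrow> norm (w - v) \<le> 1 \<longrightarrow> dird f y w q \<longrightarrow>
       \<eta> \<le> q - p - \<xi> \<bullet> (w - v) - 20 * (norm (w - v))\<^sup>2 \<longrightarrow>
       \<not> close_incr f v x y (om 1000 ((q - p - \<xi> \<bullet> (w - v) - 20 * (norm (w - v))\<^sup>2) / 2))"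
    and "0 < \<epsilon>0"
  shows "\<exists>r0>0. \<forall>r z c. 0 < r \<longrightarrow> r < r0 \<longrightarrow> norm z \<le> r \<longrightarrow> \<bar>c\<bar> \<le> r\<^sup>2 \<longrightarrow> \<bar>f (x \<odot> mk z c) - f x - \<xi> \<bullet> z\<bar> \<le> \<epsilon>0 * r"
proof -
  define \<epsilon> where "\<epsilon> = min \<epsilon>0 1"
  have \<epsilon>: "0 < \<epsilon>" "\<epsilon> \<le> 1" "\<epsilon> \<le> \<epsilon>0" using \<open>0 < \<epsilon>0\<close> unfolding \<epsilon>_def by auto
  define R where "R = norm \<xi> + 1"
  have R: "1 \<le> R" "norm \<xi> \<le> R" unfolding R_def by auto
  define \<kappa> where "\<kappa> = \<epsilon> / (10000000 * R\<^sup>2)"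
  have R2: "1 \<le> R\<^sup>2" "R \<le> R\<^sup>2" using R by (auto simp: power2_eq_square mult_ge1_I intro: mult_le_cancel_left1[THEN iffD2])
  have \<kappa>0: "0 < \<kappa>" unfolding \<kappa>_def using \<epsilon> R2 by (intro divide_pos_pos mult_pos_pos) auto
  have \<kappa>R2: "\<kappa> * R\<^sup>2 = \<epsilon> / 10000000" unfolding \<kappa>_def using R by simp
  have \<kappa>R: "\<kappa> * R \<le> \<epsilon> / 10000000" using mult_left_mono[OF R2(2), of \<kappa>] \<kappa>0 \<kappa>R2 by linarith
  have \<kappa>\<epsilon>: "\<kappa> \<le> \<epsilon> / 10000000" using mult_left_mono[OF R2(1), of \<kappa>] \<kappa>0 \<kappa>R2 by linarith
  have \<kappa>1: "\<kappa> \<le> 1 / 10000000" using \<kappa>\<epsilon> \<epsilon> by linarith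
  have \<kappa>\<xi>: "\<kappa> * norm \<xi> \<le> \<kappa> * R" using R \<kappa>0 by (intro mult_left_mono) auto
  define d0 where "d0 = \<epsilon> * \<kappa>"
  have d0: "0 < d0" "d0 \<le> \<kappa>" unfolding d0_def using \<epsilon> \<kappa>0 by (auto intro: mult_left_le_one_le)
  define \<nu> where "\<nu> = d0\<^sup>2 / 100000"
  have \<nu>0: "0 < \<nu>" unfolding \<nu>_def using d0 by simp
  have "d0 * d0 \<le> d0 * 1" using d0 \<kappa>1 by (intro mult_left_mono) auto
  then have \<nu>d: "\<nu> \<le> d0 / 100000" unfolding \<nu>_def by (simp add: power2_eq_square)
  define \<eta> where "\<eta> = d0 / 128"
  have \<eta>: "0 < \<eta>" unfolding \<eta>_def using d0 by simp
  obtain \<delta> where \<delta>: "\<delta> > 0" and maxi': "\<And>y w q. y \<in> N \<Longrightarrow> dist y x < \<delta> \<Longrightarrow> norm (w - v) \<le> 1 \<Longrightarrow> dird f y w q \<Longrightarrow>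
       \<eta> \<le> q - p - \<xi> \<bullet> (w - v) - 20 * (norm (w - v))\<^sup>2 \<Longrightarrow>
       \<not> close_incr f v x y (om 1000 ((q - p - \<xi> \<bullet> (w - v) - 20 * (norm (w - v))\<^sup>2) / 2))"
    using maxi[OF \<eta>] by blast
  obtain \<Delta> where \<Delta>: "\<Delta> > 0" "\<And>t. \<bar>t\<bar> < \<Delta> \<Longrightarrow> \<bar>incr f x v t - p * t\<bar> \<le> \<nu> * \<bar>t\<bar>"
    using dp \<nu>0 unfolding dird_iff by blast
  define \<rho> where "\<rho> = min (\<Delta> / 4) (1 / 2)"
  have \<rho>: "0 < \<rho>" "2 * \<rho> < \<Delta>" "2 * \<rho> \<le> 1" using \<Delta>(1) unfolding \<rho>_def by auto
  have "0 < \<eta> * \<rho> / 4" using \<eta> \<rho> by simp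
  then obtain \<delta>2 where \<delta>2: "\<delta>2 > 0" "\<And>y v' t. dist y x < \<delta>2 \<Longrightarrow> dist v' v < \<delta>2 \<Longrightarrow> \<bar>t\<bar> \<le> 1 \<Longrightarrow>
     \<bar>f (y \<odot> hor (t *\<^sub>R v')) - f (x \<odot> hor (t *\<^sub>R v))\<bar> < \<eta> * \<rho> / 4"
    using segment_values_uniformly_continuous[OF f, of "\<eta> * \<rho> / 4" x v 1] by blast
  have "continuous_on UNIV (\<lambda>q :: 'n heis \<times> 'n heis. fst q \<odot> snd q)" by (intro continuous_intros)
  then have "isCont (\<lambda>q :: 'n heis \<times> 'n heis. fst q \<odot> snd q) (x, 0)" using continuous_on_eq_continuous_at[OF open_UNIV] by blast
  then have "\<exists>d>0. \<forall>q. dist q (x, 0) < d \<longrightarrow> dist (fst q \<odot> snd q) (fst (x, 0 :: 'n heis) \<odot> snd (x, 0 :: 'n heis)) < min \<delta> \<delta>2"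
    unfolding continuous_at_eps_delta by (rule allE[of _ "min \<delta> \<delta>2"]) (use \<delta> \<delta>2(1) in simp)
  then obtain \<delta>3 where \<delta>3: "\<delta>3 > 0" "\<And>q. dist q (x, 0) < \<delta>3 \<Longrightarrow> dist (fst q \<odot> snd q) (fst (x, 0 :: 'n heis) \<odot> snd (x, 0 :: 'n heis)) < min \<delta> \<delta>2"
    by blast
  have near: "dist (x' \<odot> g) x < min \<delta> \<delta>2" if "dist x' x < \<delta>3 / 2" "norm g < \<delta>3 / 2" for x' g
  proof -
    have "dist (x', g) (x, 0) \<le> dist x' x + dist g 0" by (simp add: dist_Pair_Pair sqrt_sum_squares_le_sum)
    then have "dist (x', g) (x, 0) < \<delta>3" using that by simp
    then show ?thesis using \<delta>3(2)[of "(x', g)"] by simp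
  qed
  \<comment> \<open>A detour of size s moves points by at most 5 s, which must stay below delta3 / 2.\<close>
  define smax where "smax = min \<rho> (\<delta>3 / 12)"
  have smax: "0 < smax" "smax \<le> \<rho>" "smax \<le> \<delta>3 / 12" using \<rho> \<delta>3(1) unfolding smax_def by auto
  show ?thesis
  proof (intro exI[of _ "\<kappa> * smax / 4"] conjI allI impI)
    show "0 < \<kappa> * smax / 4" using \<kappa>0 smax by simp
    fix r :: real and z0 :: "'n hvec" and c0 :: real assume r: "0 < r" "r < \<kappa> * smax / 4" and z0: "norm z0 \<le> r" "\<bar>c0\<bar> \<le> r\<^sup>2"
    show "\<bar>f (x \<odot> mk z0 c0) - f x - \<xi> \<bullet> z0\<bar> \<le> \<epsilon>0 * r"
    proof (rule ccontr)
      assume "\<not> ?thesis"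
      then have "\<epsilon>0 * r < \<bar>f (x \<odot> mk z0 c0) - f x - \<xi> \<bullet> z0\<bar>" by simp
      moreover have "\<epsilon> * r \<le> \<epsilon>0 * r" using \<epsilon>(3) r(1) by (intro mult_right_mono) auto
      ultimately have bad: "\<epsilon> * r < \<bar>f (x \<odot> mk z0 c0) - f x - \<xi> \<bullet> z0\<bar>" by linarith
      define s0 where "s0 = 2 * r / \<kappa>"
      have s0: "0 < s0" "\<kappa> * s0 = 2 * r" using r(1) \<kappa>0 unfolding s0_def by auto
      have "\<kappa> * (2 * s0) < \<kappa> * smax" using r(2) s0(2) by simp
      then have s0max: "2 * s0 < smax" using \<kappa>0 by simp
      have d0s0: "d0 * s0 / 2 = \<epsilon> * r" unfolding d0_def using s0(2) by (simp add: mult.assoc)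
      have "0 < \<nu> * s0 / 2" using \<nu>0 s0 by simp
      then obtain \<delta>5 where \<delta>5: "\<delta>5 > 0" "\<And>x' v' t. dist x' x < \<delta>5 \<Longrightarrow> dist v' v < \<delta>5 \<Longrightarrow> \<bar>t\<bar> \<le> 1 \<Longrightarrow>
         \<bar>f (x' \<odot> hor (t *\<^sub>R v')) - f (x \<odot> hor (t *\<^sub>R v))\<bar> < \<nu> * s0 / 2"
        using segment_values_uniformly_continuous[OF f, of "\<nu> * s0 / 2" x v 1] by blast
      define \<delta>v where "\<delta>v = min \<delta>5 (min \<kappa> (\<nu> / R))"
      have \<delta>v: "0 < \<delta>v" "\<delta>v \<le> \<delta>5" "\<delta>v \<le> \<kappa>" "\<delta>v \<le> \<nu> / R" using \<delta>5(1) \<kappa>0 \<nu>0 R unfolding \<delta>v_def by auto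
      define \<delta>x where "\<delta>x = min \<delta>5 (\<delta>3 / 2)"
      have \<delta>x: "0 < \<delta>x" "\<delta>x \<le> \<delta>5" "\<delta>x \<le> \<delta>3 / 2" using \<delta>5(1) \<delta>3(1) unfolding \<delta>x_def by auto
      let ?x = "\<lambda>q :: 'n heis \<times> 'n hvec \<times> 'n heis \<times> real. fst q" and ?v = "\<lambda>q :: 'n heis \<times> 'n hvec \<times> 'n heis \<times> real. fst (snd q)"
        and ?z = "\<lambda>q :: 'n heis \<times> 'n hvec \<times> 'n heis \<times> real. fst (snd (snd q))" and ?s = "\<lambda>q :: 'n heis \<times> 'n hvec \<times> 'n heis \<times> real. snd (snd (snd q))"
      \<comment> \<open>All the conditions on the parameters of a detour are open, so Q contains suitable parameters.\<close>
      define W where "W = {q. dist (?x q) x < \<delta>x} \<inter> {q. dist (?v q) v < \<delta>v} \<inter> {q. norm (hpart (?z q)) < \<kappa> * ?s q} \<inter>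
         {q. \<bar>vpart (?z q)\<bar> < \<kappa>\<^sup>2 * (?s q)\<^sup>2} \<inter> {q. d0 * ?s q / 2 < \<bar>f (?x q \<odot> ?z q) - f x - \<xi> \<bullet> hpart (?z q)\<bar>} \<inter>
         {q. s0 / 2 < ?s q} \<inter> {q. ?s q < 2 * s0}"
      have "open W" unfolding W_def
      proof (intro open_Int open_Collect_less)
        show "continuous_on UNIV (\<lambda>q. \<bar>f (?x q \<odot> ?z q) - f x - \<xi> \<bullet> hpart (?z q)\<bar>)"
          by (intro continuous_on_rabs continuous_on_diff continuous_on_compose2[OF hlip_continuous[OF f]] continuous_on_const
                continuous_on_inner) (auto intro!: continuous_intros)
      qed (auto intro!: continuous_intros)
      moreover have "(x, v, mk z0 c0, s0) \<in> W"
      proof -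
        have "norm z0 < \<kappa> * s0" using z0(1) r(1) s0(2) by linarith
        moreover have "\<bar>c0\<bar> < \<kappa>\<^sup>2 * s0\<^sup>2"
        proof -
          have "\<kappa>\<^sup>2 * s0\<^sup>2 = 4 * r\<^sup>2" unfolding power_mult_distrib[symmetric] s0(2) by simp
          moreover have "0 < r\<^sup>2" using r(1) by simp
          ultimately show ?thesis using z0(2) by linarith
        qed
        moreover have "d0 * s0 / 2 < \<bar>f (x \<odot> mk z0 c0) - f x - \<xi> \<bullet> z0\<bar>" unfolding d0s0 by (rule bad)
        ultimately show ?thesis unfolding W_def using \<delta>x(1) \<delta>v(1) s0(1) by simp
      qed
      ultimately obtain q0 where q0: "q0 \<in> Q" "q0 \<in> W" using dense[of W] by blast
      obtain x' v' z s where q0eq: "q0 = (x', v', z, s)" by (metis prod_cases4)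
      have W: "dist x' x < \<delta>x" "dist v' v < \<delta>v" "norm (hpart z) < \<kappa> * s" "\<bar>vpart z\<bar> < \<kappa>\<^sup>2 * s\<^sup>2"
        "d0 * s / 2 < \<bar>f (x' \<odot> z) - f x - \<xi> \<bullet> hpart z\<bar>" "s0 / 2 < s" "s < 2 * s0"
        using q0(2) unfolding q0eq W_def by auto
      have s: "0 < s" "s \<le> smax" using W(6,7) s0 s0max by auto
      have vv: "norm (v' - v) \<le> \<kappa>" using W(2) \<delta>v(3) unfolding dist_norm by linarith
      have vv\<nu>: "R * norm (v' - v) \<le> \<nu>"
      proof -
        have "R * norm (v' - v) \<le> R * \<delta>v" using W(2) R unfolding dist_norm by (intro mult_left_mono) auto
        also have "\<dots> \<le> R * (\<nu> / R)" using \<delta>v(4) R by (intro mult_left_mono) auto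
        finally show ?thesis using R by simp
      qed
      have v': "4 * \<kappa> \<le> norm v'"
        using norm_triangle_ineq2[of v "v - v'"] v(1) vv \<kappa>1 by (simp add: norm_minus_commute)
      have p: "\<bar>p\<bar> \<le> 3 / 2" using abs_dird_le[OF f dp] v(2) by linarith
      have out: "\<bar>f (x' \<odot> hor (t *\<^sub>R v')) - f x - p * t - \<xi> \<bullet> (t *\<^sub>R (v' - v))\<bar> \<le> 3 * \<nu> * \<bar>t\<bar>"
        if t: "s \<le> \<bar>t\<bar>" "\<bar>t\<bar> \<le> 2 * \<rho>" for t
      proof -
        have "\<bar>f (x' \<odot> hor (t *\<^sub>R v')) - f (x \<odot> hor (t *\<^sub>R v))\<bar> < \<nu> * s0 / 2"
          using W(1,2) \<delta>x(2) \<delta>v(2) t(2) \<rho>(3) by (intro \<delta>5(2)) auto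
        also have "\<dots> = \<nu> * (s0 / 2)" by simp
        also have "\<dots> \<le> \<nu> * \<bar>t\<bar>" using W(6) t(1) \<nu>0 by (intro mult_left_mono) auto
        finally have 1: "\<bar>f (x' \<odot> hor (t *\<^sub>R v')) - f (x \<odot> hor (t *\<^sub>R v))\<bar> \<le> \<nu> * \<bar>t\<bar>" by simp
        have 2: "\<bar>f (x \<odot> hor (t *\<^sub>R v)) - f x - p * t\<bar> \<le> \<nu> * \<bar>t\<bar>" using \<Delta>(2)[of t] t(2) \<rho>(2) unfolding incr_def by simp
        have "\<bar>\<xi> \<bullet> (t *\<^sub>R (v' - v))\<bar> \<le> norm \<xi> * norm (t *\<^sub>R (v' - v))" by (rule Cauchy_Schwarz_ineq2)
        also have "\<dots> \<le> R * norm (t *\<^sub>R (v' - v))" using R by (intro mult_right_mono) auto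
        also have "\<dots> = \<bar>t\<bar> * (R * norm (v' - v))" by simp
        also have "\<dots> \<le> \<bar>t\<bar> * \<nu>" by (rule mult_left_mono[OF vv\<nu>]) simp
        finally have 3: "\<bar>\<xi> \<bullet> (t *\<^sub>R (v' - v))\<bar> \<le> \<nu> * \<bar>t\<bar>" by (simp add: mult.commute)
        have "3 * \<nu> * \<bar>t\<bar> = \<nu> * \<bar>t\<bar> + \<nu> * \<bar>t\<bar> + \<nu> * \<bar>t\<bar>" by simp
        then show ?thesis using 1 2 3 by linarith
      qed
      obtain \<tau> q w c g a where G: "\<bar>\<tau>\<bar> < s" "(q, w) \<in> pieces s v' z" "norm (w - v) \<le> 5 * \<kappa>"
        "detour s v' z \<tau> = q \<odot> hor (c *\<^sub>R w)"
        "dird f (x' \<odot> detour s v' z \<tau>) w (g + a + p + \<xi> \<bullet> (w - v))" "\<bar>a\<bar> \<le> 3 * \<nu>" "d0 / 64 \<le> g" "g \<le> 6"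
        "\<And>t. \<bar>t\<bar> \<le> \<rho> \<Longrightarrow> \<bar>incr f (x' \<odot> detour s v' z \<tau>) v t - p * t\<bar>
        \<le> (200 * sqrt g + 16 * sqrt \<kappa> + 5 * \<kappa> * norm \<xi> + 3 * \<nu> + 3456 * \<nu> / d0) * \<bar>t\<bar>"
      proof (rule detour_gain[OF f v(2) p \<kappa>0 _ vv v' _ s(1) _ _ _ d0(1) _ \<nu>0])
        show "\<kappa> \<le> 1 / 100" using \<kappa>1 by linarith
        show "5 * \<kappa> * norm \<xi> \<le> 1 / 2" using \<kappa>\<xi> \<kappa>R \<epsilon>(2) by linarith
        show "s \<le> \<rho>" using s(2) smax by linarith
        show "norm (hpart z) \<le> \<kappa> * s" "\<bar>vpart z\<bar> \<le> \<kappa>\<^sup>2 * s\<^sup>2" "d0 * s / 2 \<le> \<bar>f (x' \<odot> z) - f x - \<xi> \<bullet> hpart z\<bar>" using W by auto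
        show "\<nu> \<le> d0 / 12" "\<nu> \<le> 1 / 3" using \<nu>d d0 \<kappa>1 by auto
        show "\<bar>f (x' \<odot> hor (t *\<^sub>R v')) - f x - p * t - \<xi> \<bullet> (t *\<^sub>R (v' - v))\<bar> \<le> 3 * \<nu> * \<bar>t\<bar>"
          if "s \<le> \<bar>t\<bar>" "\<bar>t\<bar> \<le> 2 * \<rho>" for t by (rule out[OF that])
      qed (rule that)
      define y where "y = x' \<odot> detour s v' z \<tau>"
      have yN: "y \<in> N" unfolding y_def G(4) heis_mult_assoc[symmetric] using lines q0(1) G(2) unfolding q0eq by blast
      have "norm (detour s v' z \<tau>) \<le> 5 * s"
        by (rule norm_detour_le[OF s(1) _ \<kappa>0 _ v' _ _ vv v(2)]) (use s(2) smax \<rho> \<kappa>1 W G(1) in auto)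
      also have "\<dots> < \<delta>3 / 2" using s smax by linarith
      finally have yx: "dist y x < min \<delta> \<delta>2" unfolding y_def using W(1) \<delta>x(3) by (intro near) auto
      define gain where "gain = (g + a + p + \<xi> \<bullet> (w - v)) - p - \<xi> \<bullet> (w - v) - 20 * (norm (w - v))\<^sup>2"
      have gg: "g / 2 \<le> gain"
      proof -
        have "(norm (w - v))\<^sup>2 \<le> (5 * \<kappa>)\<^sup>2" using G(3) by (intro power_mono) auto
        also have "\<dots> = 25 * (\<kappa> * \<kappa>)" by (simp add: power2_eq_square)
        also have "\<kappa> * \<kappa> \<le> \<kappa> * (\<epsilon> / 10000000)" using \<kappa>\<epsilon> \<kappa>0 by (intro mult_left_mono) auto
        finally have "20 * (norm (w - v))\<^sup>2 \<le> 500 * (\<kappa> * (\<epsilon> / 10000000))" by simp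
        also have "\<dots> = d0 / 20000" unfolding d0_def by simp
        finally show ?thesis unfolding gain_def using G(6,7) \<nu>d d0(1) by linarith
      qed
      have gain\<eta>: "\<eta> \<le> gain" using gg G(7) unfolding \<eta>_def by linarith
      have "close_incr f v x y (om 1000 (gain / 2))" unfolding close_incr_def
      proof (intro allI impI)
        fix t :: real assume t: "\<bar>t\<bar> \<le> 1"
        show "\<bar>incr f y v t - incr f x v t\<bar> \<le> om 1000 (gain / 2) * \<bar>t\<bar>"
        proof (cases "\<bar>t\<bar> \<le> \<rho>")
          case True
          define b where "b = sqrt (sqrt g)"
          have g0: "0 < g" using G(7) d0(1) by linarith
          have b0: "0 < b" unfolding b_def using g0 by simp
          have bb: "sqrt g = b * b" unfolding b_def using g0 by simp
          have b16: "b \<le> 8 / 5"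
          proof -
            have "sqrt g \<le> (8 / 5)\<^sup>2" using G(8) by (intro real_le_lsqrt) (auto simp: power2_eq_square)
            then have "sqrt (sqrt g) \<le> sqrt ((8 / 5)\<^sup>2)" by (rule real_sqrt_le_mono)
            then show ?thesis unfolding b_def real_sqrt_abs by simp
          qed
          have sg: "200 * sqrt g \<le> 320 * b" unfolding bb using mult_right_mono[OF b16, of b] b0 by simp
          have \<kappa>b: "sqrt \<kappa> \<le> b"
          proof -
            have "\<kappa> * \<kappa> \<le> \<kappa> * (\<epsilon> / 64)" using \<kappa>\<epsilon> \<kappa>0 \<epsilon> by (intro mult_left_mono) auto
            then have "\<kappa>\<^sup>2 \<le> g" using G(7) unfolding d0_def by (simp add: power2_eq_square mult.commute)
            then have "\<kappa> \<le> sqrt g" by (rule real_le_rsqrt)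
            then show ?thesis unfolding b_def by simp
          qed
          have sk: "sqrt \<kappa> * sqrt \<kappa> = \<kappa>" "0 < sqrt \<kappa>" using \<kappa>0 by auto
          have \<kappa>\<xi>b: "5 * \<kappa> * norm \<xi> \<le> 5 * b"
          proof -
            have "(sqrt \<kappa> * R)\<^sup>2 = \<kappa> * R\<^sup>2" using \<kappa>0 by (simp add: power_mult_distrib)
            then have "(sqrt \<kappa> * R)\<^sup>2 \<le> 1\<^sup>2" using \<kappa>R2 \<epsilon>(2) by simp
            then have "sqrt \<kappa> * R \<le> 1" using power2_le_imp_le zero_le_one by blast
            then have "sqrt \<kappa> * (sqrt \<kappa> * R) \<le> sqrt \<kappa> * 1" using sk(2) by (intro mult_left_mono) auto
            then have "\<kappa> * R \<le> sqrt \<kappa>" unfolding mult.assoc[symmetric] sk(1) by simp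
            then show ?thesis using \<kappa>\<xi> \<kappa>b by linarith
          qed
          have d0b: "d0 \<le> b"
          proof -
            have "\<kappa> \<le> sqrt \<kappa>"
            proof (rule real_le_rsqrt)
              have "\<kappa> * \<kappa> \<le> \<kappa> * 1" using \<kappa>0 \<kappa>1 by (intro mult_left_mono) auto
              then show "\<kappa>\<^sup>2 \<le> \<kappa>" by (simp add: power2_eq_square)
            qed
            then show ?thesis using \<kappa>b d0(2) by linarith
          qed
          have \<nu>d0: "3456 * \<nu> / d0 = 3456 / 100000 * d0" unfolding \<nu>_def using d0(1) by (simp add: power2_eq_square)
          have coef: "200 * sqrt g + 16 * sqrt \<kappa> + 5 * \<kappa> * norm \<xi> + 3 * \<nu> + 3456 * \<nu> / d0 + \<nu> \<le> 500 * b"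
            unfolding \<nu>d0 using sg \<kappa>b \<kappa>\<xi>b d0b \<nu>d b0 by linarith
          have "500 * b \<le> om 1000 (gain / 2)"
          proof -
            have "b / 2 \<le> sqrt (sqrt (gain / 2))"
            proof (rule real_le_rsqrt, rule real_le_rsqrt)
              have "((b / 2)\<^sup>2)\<^sup>2 = (b * b) * (b * b) / 16" by (simp add: power2_eq_square)
              also have "(b * b) * (b * b) = g" unfolding bb[symmetric] using g0 by simp
              finally show "((b / 2)\<^sup>2)\<^sup>2 \<le> gain / 2" using gg g0 by linarith
            qed
            then show ?thesis unfolding om_def using gg g0 by linarith
          qed
          then have om: "(200 * sqrt g + 16 * sqrt \<kappa> + 5 * \<kappa> * norm \<xi> + 3 * \<nu> + 3456 * \<nu> / d0 + \<nu>) * \<bar>t\<bar> \<le> om 1000 (gain / 2) * \<bar>t\<bar>"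
            using coef by (intro mult_right_mono) auto
          have 1: "\<bar>incr f y v t - p * t\<bar> \<le> (200 * sqrt g + 16 * sqrt \<kappa> + 5 * \<kappa> * norm \<xi> + 3 * \<nu> + 3456 * \<nu> / d0) * \<bar>t\<bar>"
            unfolding y_def by (rule G(9)[OF True])
          have 2: "\<bar>incr f x v t - p * t\<bar> \<le> \<nu> * \<bar>t\<bar>" using True \<rho> by (intro \<Delta>(2)) auto
          show ?thesis using 1 2 om unfolding distrib_right[of _ \<nu>] by linarith
        next
          case False
          have "dist y x < \<delta>2" using yx by simp
          then have "\<bar>f (y \<odot> hor (t *\<^sub>R v)) - f (x \<odot> hor (t *\<^sub>R v))\<bar> < \<eta> * \<rho> / 4" "\<bar>f (y \<odot> hor (0 *\<^sub>R v)) - f (x \<odot> hor (0 *\<^sub>R v))\<bar> < \<eta> * \<rho> / 4"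
            using \<delta>2 t by (auto intro!: \<delta>2(2) simp del: scaleR_zero_left)
          then have d: "\<bar>f (y \<odot> hor (t *\<^sub>R v)) - f (x \<odot> hor (t *\<^sub>R v))\<bar> < \<eta> * \<rho> / 4" "\<bar>f y - f x\<bar> < \<eta> * \<rho> / 4"
            by (simp_all add: mk_zero)
          have "incr f y v t - incr f x v t = (f (y \<odot> hor (t *\<^sub>R v)) - f (x \<odot> hor (t *\<^sub>R v))) - (f y - f x)" unfolding incr_def by simp
          then have "\<bar>incr f y v t - incr f x v t\<bar> \<le> \<bar>f (y \<odot> hor (t *\<^sub>R v)) - f (x \<odot> hor (t *\<^sub>R v))\<bar> + \<bar>f y - f x\<bar>"
            by (simp only: abs_triangle_ineq4)
          then have "\<bar>incr f y v t - incr f x v t\<bar> \<le> \<eta> / 2 * \<rho>" using d by simp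
          also have "\<dots> \<le> om 1000 (gain / 2) * \<bar>t\<bar>"
          proof (rule mult_mono)
            have "0 \<le> sqrt (sqrt (gain / 2))" using gain\<eta> \<eta> by simp
            then show "\<eta> / 2 \<le> om 1000 (gain / 2)" unfolding om_def using gain\<eta> by linarith
            then show "0 \<le> om 1000 (gain / 2)" using \<eta> by linarith
          qed (use False \<rho> in auto)
          finally show ?thesis .
        qed
      qed
      moreover have "\<not> close_incr f v x y (om 1000 (gain / 2))"
        unfolding gain_def
      proof (rule maxi'[OF yN])
        show "dist y x < \<delta>" using yx by simp
        show "norm (w - v) \<le> 1" using G(3) \<kappa>1 by linarith
        show "dird f y w (g + a + p + \<xi> \<bullet> (w - v))" unfolding y_def by (rule G(5))
        show "\<eta> \<le> (g + a + p + \<xi> \<bullet> (w - v)) - p - \<xi> \<bullet> (w - v) - 20 * (norm (w - v))\<^sup>2" using gain\<eta> unfolding gain_def .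
      qed
      ultimately show False by blast
    qed
  qed
qed

section \<open>The null set\<close>

lemma null_G_delta_of_lines:
  fixes P :: "(('n::finite) heis \<times> 'n hvec) set"
  assumes "countable P"
  obtains G :: "nat \<Rightarrow> 'n heis set" where "\<And>n. open (G n)" "(\<Inter>n. G n) \<in> null_sets lebesgue"
    "\<And>q w t. (q, w) \<in> P \<Longrightarrow> q \<odot> hor (t *\<^sub>R w) \<in> (\<Inter>n. G n)"
proof -
  define l where "l a = (case a of (q, w) \<Rightarrow> range (\<lambda>t. q \<odot> hor (t *\<^sub>R w)))" for a :: "'n heis \<times> 'n hvec"
  have "negligible (l a)" for a
  proof -
    obtain q w where a: "a = (q, w)" by (metis surj_pair)
    define u where "u = mk w (- 2 * sform (hpart q) w)"
    have "q \<odot> hor (t *\<^sub>R w) = q + t *\<^sub>R u" for t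
    proof -
      have "q + t *\<^sub>R u = mk (hpart q) (vpart q) + t *\<^sub>R u" by simp
      also have "\<dots> = mk (hpart q + t *\<^sub>R w) (vpart q - 2 * sform (hpart q) (t *\<^sub>R w))"
        unfolding u_def by (simp add: mk_def sform_simps)
      finally show ?thesis by (simp add: mult_mk)
    qed
    then have "l a = (+) q ` range (\<lambda>t. t *\<^sub>R u)" unfolding l_def a by auto
    moreover have "negligible (range (\<lambda>t. t *\<^sub>R u))"
    proof (rule negligible_subset[OF negligible_lowdim])
      have "dim (span {u}) \<le> card {u}" by (simp add: dim_le_card')
      then show "dim (span {u}) < DIM('n heis)" by simp
      show "range (\<lambda>t. t *\<^sub>R u) \<subseteq> span {u}" by (intro image_subsetI span_mul span_base singletonI)
    qed
    ultimately show ?thesis using negligible_translation by metis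
  qed
  then have neg: "negligible (\<Union> (l ` P))" using assms by (intro negligible_countable_Union) auto
  define U where "U = \<Union> (l ` P)"
  have "\<exists>T. open T \<and> U \<subseteq> T \<and> emeasure lebesgue T < ennreal (1 / real (Suc n))" for n
    by (rule negligible_open_superset[of U "1 / real (Suc n)"]) (use neg in \<open>auto simp: U_def\<close>)
  then obtain G where G: "\<And>n. open (G n)" "\<And>n. U \<subseteq> G n" "\<And>n. emeasure lebesgue (G n) < ennreal (1 / real (Suc n))" by metis
  show ?thesis
  proof (rule that[OF G(1)])
    have m: "(\<Inter>n. G n) \<in> sets lebesgue" using G(1) by (intro sets.countable_INT) auto
    have "emeasure lebesgue (\<Inter>n. G n) \<le> ennreal (1 / real (Suc n))" for n
    proof -
      have "emeasure lebesgue (\<Inter>n. G n) \<le> emeasure lebesgue (G n)" using G(1) by (intro emeasure_mono) auto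
      then show ?thesis using G(3)[of n] by simp
    qed
    moreover have "(\<lambda>n. ennreal (1 / real (Suc n))) \<longlonglongrightarrow> ennreal 0"
      by (intro tendsto_ennrealI LIMSEQ_Suc lim_1_over_n)
    ultimately have "emeasure lebesgue (\<Inter>n. G n) \<le> ennreal 0"
      by (intro LIMSEQ_le_const[of _ "ennreal 0"]) auto
    then show "(\<Inter>n. G n) \<in> null_sets lebesgue" using m by (intro null_setsI) auto
    show "q \<odot> hor (t *\<^sub>R w) \<in> (\<Inter>n. G n)" if "(q, w) \<in> P" for q w t
    proof -
      have "q \<odot> hor (t *\<^sub>R w) \<in> l (q, w)" unfolding l_def by auto
      then have "q \<odot> hor (t *\<^sub>R w) \<in> U" unfolding U_def using that by blast
      then show ?thesis using G(2) by blast
    qed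
  qed
qed

lemma exists_dird_on_line:
  fixes f :: "('n::finite) heis \<Rightarrow> real"
  assumes f: "hlip f" and e: "norm e = 1"
  obtains t p where "dird f (x \<odot> hor (t *\<^sub>R e)) e p"
proof -
  define \<phi> where "\<phi> t = f (x \<odot> hor (t *\<^sub>R e))" for t
  have shift: "x \<odot> hor (a *\<^sub>R e) \<odot> hor (u *\<^sub>R e) = x \<odot> hor ((u + a) *\<^sub>R e)" for a u
    by (simp add: heis_mult_assoc sform_simps scaleR_left_distrib add.commute)
  have "\<bar>\<phi> b - \<phi> a\<bar> \<le> 1 * \<bar>b - a\<bar>" for a b
    using hlip_hor[OF f, of "x \<odot> hor (a *\<^sub>R e)" "(b - a) *\<^sub>R e"] e unfolding \<phi>_def shift by simp
  from lipschitz_differentiable_AE[OF this] have "negligible {t. \<not> \<phi> differentiable (at t)}" .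
  then have "{t. \<not> \<phi> differentiable (at t)} \<noteq> UNIV" using non_negligible_UNIV by metis
  then obtain t where "\<phi> differentiable (at t)" by blast
  then obtain p where "(\<phi> has_real_derivative p) (at t)" unfolding real_differentiable_def by blast
  then have "((\<lambda>u. \<phi> (u + t)) has_real_derivative p) (at 0)" using DERIV_shift[of \<phi> p 0 t] by simp
  then have "dird f (x \<odot> hor (t *\<^sub>R e)) e p" unfolding dird_def shift \<phi>_def .
  then show ?thesis by (rule that)
qed

text \<open>
  The null set contains the lines of all detours with parameters from a countable dense set, and one
  line in direction e, on which the search for an almost maximal derivative starts.
\<close>
theorem theorem2p12:
  shows "\<exists>N :: ('n::finite) heis set. N \<in> null_sets lebesgue \<and>
           (\<forall>f. heis_lipschitz f \<longrightarrow> (\<exists>x\<in>N. pansu_differentiable_at f x))"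
proof -
  obtain e :: "'n hvec" where e: "norm e = 1" using exists_unit_hvec by blast
  obtain Q :: "('n heis \<times> 'n hvec \<times> 'n heis \<times> real) set" where Q: "countable Q" "\<And>S. open S \<Longrightarrow> S \<noteq> {} \<Longrightarrow> \<exists>q\<in>Q. q \<in> S"
    using countable_dense_setE by blast
  define P where "P = insert (0, e) (\<Union>(x', v', z, s)\<in>Q. (\<lambda>(q, w). (x' \<odot> q, w)) ` pieces s v' z)"
  have "countable P" unfolding P_def using Q(1) by (auto simp: pieces_def intro!: countable_UN)
  then obtain G :: "nat \<Rightarrow> 'n heis set" where G: "\<And>n. open (G n)" "(\<Inter>n. G n) \<in> null_sets lebesgue"
    "\<And>q w t. (q, w) \<in> P \<Longrightarrow> q \<odot> hor (t *\<^sub>R w) \<in> (\<Inter>n. G n)" using null_G_delta_of_lines by blast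
  have lines: "x' \<odot> q \<odot> hor (t *\<^sub>R w) \<in> (\<Inter>n. G n)" if "(x', v', z, s) \<in> Q" "(q, w) \<in> pieces s v' z" for x' v' z s q w t
    by (rule G(3)) (use that in \<open>force simp: P_def\<close>)
  have "\<exists>x\<in>(\<Inter>n. G n). pansu_differentiable_at f x" if lip: "heis_lipschitz f" for f
  proof -
    obtain C where C: "C > 0" "hlip (\<lambda>x. f x / C)" using hlip_of_heis_lipschitz[OF lip] by blast
    define F where "F = (\<lambda>x. f x / C)"
    have F: "hlip F" using C(2) unfolding F_def .
    obtain t p00 where start: "dird F (0 \<odot> hor (t *\<^sub>R e)) e p00" using exists_dird_on_line[OF F e] by blast
    interpret direction_search F G e 1000 "0 \<odot> hor (t *\<^sub>R e)" p00
      by unfold_locales (use F G e start in \<open>auto simp: P_def\<close>)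
    obtain x v p \<xi> where x: "x \<in> (\<Inter>n. G n)" "norm (v - e) \<le> 1/2" "dird F x v p"
      and maxi: "\<And>\<eta>. 0 < \<eta> \<Longrightarrow> \<exists>\<delta>>0. \<forall>y w q. y \<in> (\<Inter>n. G n) \<longrightarrow> dist y x < \<delta> \<longrightarrow> norm (w - v) \<le> 1 \<longrightarrow> dird F y w q \<longrightarrow>
       \<eta> \<le> q - p - \<xi> \<bullet> (w - v) - 20 * (norm (w - v))\<^sup>2 \<longrightarrow>
       \<not> close_incr F v x y (om 1000 ((q - p - \<xi> \<bullet> (w - v) - 20 * (norm (w - v))\<^sup>2) / 2))"
    proof (rule almost_maximal_direction, goal_cases)
      case 1 show ?case by (rule that[OF 1(2-4)]) (rule 1(5))
    qed
    have v: "1 / 2 \<le> norm v" "norm v \<le> 3 / 2"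
      using x(2) e norm_triangle_ineq2[of e "e - v"] norm_triangle_ineq[of e "v - e"] by (auto simp: norm_minus_commute)
    have "pansu_differentiable_at f x"
    proof (rule pansu_differentiable_if_box_approximation[OF C(1)])
      fix \<epsilon> :: real assume "0 < \<epsilon>"
      from linear_approximation[OF F v x(3) Q(2) lines maxi this]
      show "\<exists>r0>0. \<forall>r z c. 0 < r \<longrightarrow> r < r0 \<longrightarrow> norm z \<le> r \<longrightarrow> \<bar>c\<bar> \<le> r\<^sup>2 \<longrightarrow> \<bar>f (x \<odot> mk z c) / C - f x / C - \<xi> \<bullet> z\<bar> \<le> \<epsilon> * r"
        unfolding F_def .
    qed
    then show ?thesis using x(1) by blast
  qed
  then show ?thesis using G(2) by blast
qed

end
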